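(* Let $\mathbb{F}$ be a subfield of a local field (with the inherited topology), let $\widehat{\mathbb{F}}$ be its completion, and let $n$ be a positive integer. The following conditions are equivalent: (1) $\mathrm{PSL}(n,\mathbb{F})$ is totally minimal; (2) $\mathrm{SL}(n,\mathbb{F})$ is totally minimal; (3) $Z(\mathrm{SL}(n,\mathbb{F}))=Z(\mathrm{SL}(n,\widehat{\mathbb{F}}))$ (i.e., $\mu_n(\mathbb{F})=\mu_n(\widehat{\mathbb{F}})$).
   Context: A local field is a non-discrete locally compact (Hausdorff) topological field; no restriction on the characteristic is made. If $\mathbb{F}$ is a subfield of a local field $P$, its completion $\widehat{\mathbb{F}}$ is identified with the closure of $\mathbb{F}$ in $P$. $\mathrm{SL}(n,\mathbb{F})$ is the group of $n\times n$ matrices of determinant $1$ with the pointwise topology inherited from $\mathbb{F}^{n^2}$; $Z(G)$ denotes the center of $G$; $\mathrm{PSL}(n,\mathbb{F})=\mathrm{SL}(n,\mathbb{F})/Z(\mathrm{SL}(n,\mathbb{F}))$ has the quotient topology. $\mu_n(\mathbb{F})$ is the group of $n$-th roots of unity in $\mathbb{F}$; $Z(\mathrm{SL}(n,\mathbb{F}))=\{\lambda I:\lambda\in\mu_n(\mathbb{F})\}$. All topological groups are Hausdorff. A topological group is minimal if it admits no strictly coarser Hausdorff group topology; $G$ is totally minimal if every Hausdorff quotient group $G/N$ ($N$ a closed normal subgroup) is minimal. *)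

theory Defs
  imports "HOL-Analysis.Analysis" "HOL-Algebra.Coset" "HOL-Algebra.Subrings"
    "HOL-Algebra.Algebraic_Closure_Type"
begin

section \<open>Local fields\<close>

class topological_field = field + t2_space + topological_ab_group_add +
  topological_comm_monoid_mult +
  assumes tendsto_inverse_nhds: "a \<noteq> 0 \<Longrightarrow> (inverse \<longlongrightarrow> inverse a) (nhds a)"

class local_field = topological_field +
  assumes not_discrete: "\<exists>S. \<not> open S"
    and locally_compact: "\<exists>U K. open U \<and> compact K \<and> x \<in> U \<and> U \<subseteq> K"


section \<open>Topological groups\<close>

definition center :: "('g, 'm) monoid_scheme \<Rightarrow> 'g set" where
  "center G = {z \<in> carrier G. \<forall>x \<in> carrier G. z \<otimes>\<^bsub>G\<^esub> x = x \<otimes>\<^bsub>G\<^esub> z}"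

definition hausdorff_group_topology :: "('g, 'm) monoid_scheme \<Rightarrow> 'g topology \<Rightarrow> bool" where
  "hausdorff_group_topology G T \<longleftrightarrow>
     group G \<and> topspace T = carrier G \<and> Hausdorff_space T \<and>
     continuous_map (prod_topology T T) T (\<lambda>(x, y). x \<otimes>\<^bsub>G\<^esub> y) \<and>
     continuous_map T T (\<lambda>x. inv\<^bsub>G\<^esub> x)"

definition minimal_group :: "('g, 'm) monoid_scheme \<Rightarrow> 'g topology \<Rightarrow> bool" where
  "minimal_group G T \<longleftrightarrow>
     hausdorff_group_topology G T \<and>
     (\<forall>T'. hausdorff_group_topology G T' \<and> (\<forall>U. openin T' U \<longrightarrow> openin T U) \<longrightarrow> T' = T)"

definition quotient_group_topology ::
    "('g, 'm) monoid_scheme \<Rightarrow> 'g set \<Rightarrow> 'g topology \<Rightarrow> 'g set topology" where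
  "quotient_group_topology G N T =
     topology (\<lambda>U. U \<subseteq> carrier (G Mod N) \<and> openin T {x \<in> carrier G. N #>\<^bsub>G\<^esub> x \<in> U})"

lemma openin_quotient_group_topology:
  "openin (quotient_group_topology G N T) U \<longleftrightarrow>
     U \<subseteq> carrier (G Mod N) \<and> openin T {x \<in> carrier G. N #>\<^bsub>G\<^esub> x \<in> U}"
proof -
  have "istopology (\<lambda>U. U \<subseteq> carrier (G Mod N) \<and> openin T {x \<in> carrier G. N #>\<^bsub>G\<^esub> x \<in> U})"
    unfolding istopology_def
  proof (intro conjI allI impI; (elim conjE)?)
    fix S S' assume "openin T {x \<in> carrier G. N #>\<^bsub>G\<^esub> x \<in> S}"
      "openin T {x \<in> carrier G. N #>\<^bsub>G\<^esub> x \<in> S'}"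
    then have "openin T ({x \<in> carrier G. N #>\<^bsub>G\<^esub> x \<in> S} \<inter> {x \<in> carrier G. N #>\<^bsub>G\<^esub> x \<in> S'})"
      by (rule openin_Int)
    moreover have "{x \<in> carrier G. N #>\<^bsub>G\<^esub> x \<in> S} \<inter> {x \<in> carrier G. N #>\<^bsub>G\<^esub> x \<in> S'}
        = {x \<in> carrier G. N #>\<^bsub>G\<^esub> x \<in> S \<inter> S'}" by auto
    ultimately show "openin T {x \<in> carrier G. N #>\<^bsub>G\<^esub> x \<in> S \<inter> S'}" by simp
  next
    fix K assume "\<forall>S\<in>K. S \<subseteq> carrier (G Mod N) \<and> openin T {x \<in> carrier G. N #>\<^bsub>G\<^esub> x \<in> S}"
    then have "openin T (\<Union>S\<in>K. {x \<in> carrier G. N #>\<^bsub>G\<^esub> x \<in> S})" by blast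
    moreover have "(\<Union>S\<in>K. {x \<in> carrier G. N #>\<^bsub>G\<^esub> x \<in> S}) = {x \<in> carrier G. N #>\<^bsub>G\<^esub> x \<in> \<Union>K}"
      by auto
    ultimately show "openin T {x \<in> carrier G. N #>\<^bsub>G\<^esub> x \<in> \<Union>K}" by simp
  qed auto
  then show ?thesis
    by (simp add: quotient_group_topology_def topology_inverse')
qed

lemma quotient_map_quotient_group_topology:
  assumes "topspace T = carrier G"
  shows "quotient_map T (quotient_group_topology G N T) (\<lambda>x. N #>\<^bsub>G\<^esub> x)"
proof -
  have *: "(\<lambda>x. N #>\<^bsub>G\<^esub> x) ` carrier G = carrier (G Mod N)"
    by (auto simp: FactGroup_def RCOSETS_def)
  then have "{x \<in> carrier G. N #>\<^bsub>G\<^esub> x \<in> carrier (G Mod N)} = topspace T"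
    using assms by auto
  then have "openin (quotient_group_topology G N T) (carrier (G Mod N))"
    by (simp add: openin_quotient_group_topology)
  then have "topspace (quotient_group_topology G N T) = carrier (G Mod N)"
    by (meson openin_quotient_group_topology openin_subset openin_topspace subset_antisym)
  then show ?thesis
    using * assms by (auto simp: quotient_map_def openin_quotient_group_topology)
qed

definition totally_minimal_group :: "('g, 'm) monoid_scheme \<Rightarrow> 'g topology \<Rightarrow> bool" where
  "totally_minimal_group G T \<longleftrightarrow>
     hausdorff_group_topology G T \<and>
     (\<forall>N. N \<lhd> G \<and> closedin T N \<longrightarrow> minimal_group (G Mod N) (quotient_group_topology G N T))"


section \<open>Special and projective special linear groups\<close>

definition SL :: "'a::comm_ring_1 set \<Rightarrow> ('a^'n^'n) monoid" where
  "SL F = \<lparr>carrier = {A. (\<forall>i j. A $ i $ j \<in> F) \<and> det A = 1},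
           monoid.mult = (**), one = mat 1\<rparr>"

text \<open>The ambient Euclidean topology on matrices is the product topology, so this is the
  topology of entrywise convergence.\<close>

definition SL_topology :: "'a::{comm_ring_1, topological_space} set \<Rightarrow> ('a^'n^'n) topology" where
  "SL_topology F = top_of_set (carrier (SL F))"

definition PSL :: "'a::comm_ring_1 set \<Rightarrow> ('a^'n^'n) set monoid" where
  "PSL F = SL F Mod center (SL F)"

definition PSL_topology ::
    "'a::{comm_ring_1, topological_space} set \<Rightarrow> ('a^'n^'n) set topology" where
  "PSL_topology F = quotient_group_topology (SL F) (center (SL F)) (SL_topology F)"

definition roots_of_unity_in :: "nat \<Rightarrow> 'a::monoid_mult set \<Rightarrow> 'a set" where
  "roots_of_unity_in n F = {x \<in> F. x ^ n = 1}"

end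

theory Submission
  imports Defs
begin

text \<open>Write \<open>K\<close> for the closure of \<open>F\<close>. If \<open>l\<close> is an \<open>n\<close>-th root of unity in \<open>K\<close> but not in \<open>F\<close>, then
  \<open>PSL(n, F)\<close> embeds into \<open>PSL(n, K)\<close>, and the topology induced by this embedding is strictly coarser:
  by density there are elements of \<open>SL(n, F)\<close> close to \<open>l I\<close>.

  Conversely, pull a coarser Hausdorff group topology on a quotient of \<open>SL(n, F)\<close> back to \<open>SL(n, F)\<close>.
  The closures in \<open>SL(n, K)\<close> of the resulting neighbourhoods of the identity form a base of
  neighbourhoods of the identity for a coarser group topology on \<open>SL(n, K)\<close>. Their intersection \<open>M\<close>
  is a normal subgroup. If \<open>M\<close> contains a nontrivial transvection, then \<open>M = SL(n, K)\<close>. Otherwise the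
  torus action, whose differences of squares \<open>s\<^sup>2 - t\<^sup>2\<close> include all sufficiently large powers of a
  contracting element, forces small elements of the root groups to be bounded. Compactness extends
  this to all transvections, hence to the conjugates \<open>g E\<^sub>i\<^sub>j g\<^sup>-\<^sup>1\<close> and finally to \<open>g\<close> itself. So some
  neighbourhood is compact, \<open>M\<close> is central, and the topology is the one induced from \<open>SL(n, K) / M\<close>.
  When the roots of unity in \<open>F\<close> and \<open>K\<close> agree, \<open>M\<close> lies in \<open>SL(n, F)\<close> and is the kernel of the quotient.\<close>

text \<open>The obstacle is that \<open>F\<close> need be neither complete nor locally compact, and
  that neither an absolute value nor a restriction on the characteristic is at hand. So the
  estimates take place over \<open>closure F\<close>, and size is measured by one contracting
  element \<open>b\<close>: bounded means contained in a compact set, and every nonzero scalar is an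
  integral power of \<open>b\<close> times an element of a compact annulus avoiding 0. If a scalar
  \<open>x\<close> is huge, some \<open>b ^ n * x\<close> with large \<open>n\<close> lands in that
  annulus, which a suitable neighbourhood avoids; this is why all large powers of \<open>b\<close>
  are wanted as multipliers. Squares enter because the torus scales a root group by
  \<open>s ^ 2\<close>, so each such power must be a difference of squares of elements tending to 1,
  in every characteristic. Passing to closures may destroy the Hausdorff property, so
  \<open>M\<close> can be nontrivial. The condition on roots of unity keeps a central
  \<open>M\<close> inside SL(n, F), where the Hausdorff property of the given topology applies. If
  \<open>F\<close> is finite or n = 1, the group is finite and minimality is immediate.\<close>

no_notation fps_nth (infixl \<open>$\<close> 75)

section \<open>Topology of local fields\<close>

lemma tendsto_inverse_field:
  fixes f :: "'b \<Rightarrow> 'a::topological_field"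
  assumes "(f \<longlongrightarrow> a) F" "a \<noteq> 0"
  shows "((\<lambda>x. inverse (f x)) \<longlongrightarrow> inverse a) F"
  using filterlim_compose[OF tendsto_inverse_nhds[OF assms(2)] assms(1)] .

lemma continuous_on_inverse_field:
  fixes f :: "'b::topological_space \<Rightarrow> 'a::topological_field"
  assumes "continuous_on S f" "\<And>x. x \<in> S \<Longrightarrow> f x \<noteq> 0"
  shows "continuous_on S (\<lambda>x. inverse (f x))"
  using assms unfolding continuous_on_def by (blast intro: tendsto_inverse_field)

lemma Hausdorff_space_vec:
  assumes "Hausdorff_space (euclidean :: 'a::topological_space topology)"
  shows "Hausdorff_space (euclidean :: ('a^'b::finite) topology)"
  unfolding Hausdorff_space_def
proof (intro allI impI; elim conjE)
  fix x y :: "'a^'b" assume "x \<noteq> y"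
  then obtain i where "x $ i \<noteq> y $ i" by (auto simp: vec_eq_iff)
  then obtain U V where "open U" "open V" "x $ i \<in> U" "y $ i \<in> V" "disjnt U V"
    using assms unfolding Hausdorff_space_def by (auto simp: open_openin[symmetric]) metis
  then show "\<exists>U V. openin euclidean U \<and> openin euclidean V \<and> x \<in> U \<and> y \<in> V \<and> disjnt U V"
    by (intro exI[of _ "(\<lambda>x. x $ i) -` U"] exI[of _ "(\<lambda>x. x $ i) -` V"])
      (auto simp: open_vimage_vec_nth disjnt_iff)
qed

lemma Hausdorff_space_matrix: "Hausdorff_space (euclidean :: ('a::t2_space^'n^'m) topology)"
    by (intro Hausdorff_space_vec) (use hausdorff in \<open>fastforce simp: Hausdorff_space_def disjnt_def\<close>)

lemma compact_vector_box:
  fixes C :: "'n::finite \<Rightarrow> 'a::topological_space set"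
  assumes "\<And>i. compact (C i)"
  shows "compact {x::'a^'n. \<forall>i. x $ i \<in> C i}"
proof -
  have "compactin (product_topology (\<lambda>i. euclidean) UNIV) (PiE UNIV C)"
    using assms by (auto simp: compactin_PiE)
  then have c: "compact (PiE UNIV C)"
    by (simp add: euclidean_product_topology)
  have "continuous_on (PiE UNIV C) (\<lambda>f. \<chi> i. f i)"
    by (intro continuous_on_vec_lambda) (rule continuous_on_subset[OF continuous_on_product_coordinates subset_UNIV])
  from compact_continuous_image[OF this c]
  have "compact ((\<lambda>f. \<chi> i. f i) ` PiE UNIV C)" .
  also have "(\<lambda>f. \<chi> i. f i) ` PiE UNIV C = {x::'a^'n. \<forall>i. x $ i \<in> C i}"
    by (auto simp: image_iff PiE_iff intro!: bexI[of _ "vec_nth _"])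
  finally show ?thesis .
qed

lemma compact_matrix_box:
  assumes "compact (C :: 'a::topological_space set)"
  shows "compact {A::'a^'n^'m. \<forall>i j. A $ i $ j \<in> C}"
  using compact_vector_box[of "\<lambda>_. {x::'a^'n. \<forall>j. x $ j \<in> C}"] compact_vector_box[of "\<lambda>_. C"] assms
  by simp

lemma continuous_on_matrix_mult:
  fixes f :: "'b::topological_space \<Rightarrow> 'a::topological_field^'n^'m"
  assumes "continuous_on S f" "continuous_on S g"
  shows "continuous_on S (\<lambda>x. f x ** g x)"
  unfolding matrix_matrix_mult_def
  by (intro continuous_on_vec_lambda continuous_on_sum continuous_on_mult' continuous_on_component assms)

lemma continuous_on_det_field:
  fixes f :: "'b::topological_space \<Rightarrow> 'a::topological_field^'n^'n"
  assumes "continuous_on S f"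
  shows "continuous_on S (\<lambda>x. det (f x))"
  unfolding det_def
  by (intro continuous_on_sum continuous_on_mult' continuous_on_const continuous_on_prod'
      continuous_on_component assms)

text \<open>The tube lemma around the slice \<open>{0} \<times> Z\<close> under multiplication:
  small times bounded is small. This stands in for a norm estimate.\<close>

lemma absorbing_nhd:
  fixes Z V :: "'a::topological_field set"
  assumes "compact Z" "open V" "0 \<in> V"
  obtains W where "open W" "0 \<in> W" "\<And>w z. w \<in> W \<Longrightarrow> z \<in> Z \<Longrightarrow> w * z \<in> V"
proof -
  have "open {p::'a \<times> 'a. fst p * snd p \<in> V}"
    by (rule open_vimage[OF assms(2), of "\<lambda>p::'a \<times> 'a. fst p * snd p", unfolded vimage_def])
      (intro continuous_on_mult' continuous_on_fst continuous_on_snd continuous_on_id)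
  moreover have "{0} \<times> Z \<subseteq> {p::'a \<times> 'a. fst p * snd p \<in> V}"
    using assms(3) by auto
  ultimately obtain W where "open W" "0 \<in> W" "W \<times> Z \<subseteq> {p. fst p * snd p \<in> V}"
    using Elementary_Topology.tube_lemma[OF assms(1), of "{p. fst p * snd p \<in> V}" 0] by metis
  then show ?thesis by (intro that) auto
qed

lemma compact_mult_image:
  fixes C D :: "'a::topological_field set"
  assumes "compact C" "compact D"
  shows "compact {x * y | x y. x \<in> C \<and> y \<in> D}"
proof -
  have "{x * y | x y. x \<in> C \<and> y \<in> D} = (\<lambda>p. fst p * snd p) ` (C \<times> D)" by force
  then show ?thesis
    by (simp only:) (intro compact_continuous_image compact_Times assms continuous_on_mult'
        continuous_on_fst continuous_on_snd continuous_on_id)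
qed

lemma compact_scaled:
  fixes C :: "'a::topological_field set"
  assumes "compact C"
  shows "compact ((\<lambda>x. c * x) ` C)"
  by (intro compact_continuous_image assms continuous_on_mult' continuous_on_const continuous_on_id)

lemma open_scaled:
  fixes V :: "'a::topological_field set"
  assumes "open V" "c \<noteq> 0"
  shows "open ((\<lambda>x. c * x) ` V)"
proof -
  have "(\<lambda>x. c * x) ` V = (\<lambda>x. inverse c * x) -` V"
    using assms(2) by (auto simp: image_iff field_simps intro!: bexI[of _ "inverse c * _"])
  then show ?thesis
    using assms(1) by (simp add: open_vimage continuous_on_mult' continuous_on_const continuous_on_id)
qed

lemma compact_inverse_image:
  fixes S :: "'a::topological_field set"
  assumes "compact S" "0 \<notin> S"
  shows "compact (inverse ` S)"
  using assms by (intro compact_continuous_image continuous_on_inverse_field continuous_on_id) auto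

section \<open>Contracting elements as a substitute for an absolute value\<close>

lemma not_open_zero: "\<not> open {0::'a::local_field}"
proof
  assume *: "open {0::'a}"
  have "open {x}" for x :: 'a
  proof -
    have "open ((\<lambda>y. y - x) -` {0})"
      by (rule open_vimage[OF *])
        (simp add: diff_conv_add_uminus continuous_on_add continuous_on_const continuous_on_id del: add_uminus_conv_diff)
    moreover have "(\<lambda>y. y - x) -` {0} = {x}" by auto
    ultimately show ?thesis by simp
  qed
  then have "open S" for S :: "'a set"
    using open_Union[of "(\<lambda>x. {x}) ` S"] by auto
  then show False using not_discrete by blast
qed

lemma compact_nhd_cover:
  assumes "compact S" "\<And>x. x \<in> S \<Longrightarrow> open (N x) \<and> x \<in> N x"
  shows "\<exists>D\<subseteq>S. finite D \<and> S \<subseteq> (\<Union>x\<in>D. N x)"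
proof -
  have "S \<subseteq> (\<Union>x\<in>S. N x)" using assms(2) by auto
  from compactE_image[OF assms(1) _ this] assms(2) show ?thesis by metis
qed

text \<open>If every point of \<open>C\<close> had a neighbourhood visited only finitely often,
  finitely many of them would cover \<open>C\<close>. A cluster point is all that compactness gives
  here, since first countability is not assumed.\<close>

lemma compact_sequence_cluster:
  fixes x :: "nat \<Rightarrow> 'a::t2_space"
  assumes "compact C" "infinite {n. x n \<in> C}"
  obtains y where "y \<in> C" "\<And>N. open N \<Longrightarrow> y \<in> N \<Longrightarrow> infinite {n. x n \<in> N}"
proof (rule ccontr)
  assume "\<not> thesis"
  then have "\<forall>y\<in>C. \<exists>N. open N \<and> y \<in> N \<and> finite {n. x n \<in> N}" using that by blast
  then obtain N where N: "\<And>y. y \<in> C \<Longrightarrow> open (N y) \<and> y \<in> N y \<and> finite {n. x n \<in> N y}"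
    by metis
  then obtain D where D: "D \<subseteq> C" "finite D" "C \<subseteq> (\<Union>y\<in>D. N y)"
    using compact_nhd_cover[OF assms(1), of N] by blast
  then have "{n. x n \<in> C} \<subseteq> (\<Union>y\<in>D. {n. x n \<in> N y})" by auto
  moreover have "finite (\<Union>y\<in>D. {n. x n \<in> N y})" using D N by auto
  ultimately show False using assms(2) finite_subset by blast
qed

text \<open>\<open>b\<close> acts like an element of absolute value less than 1, \<open>C\<close>
  like a compact ball stable under \<open>b\<close>, and \<open>V\<^sub>0\<close> is an open
  neighbourhood of 0 inside it.\<close>

locale contraction =
  fixes b :: "'a::local_field" and C V\<^sub>0 :: "'a set"
  assumes compact_C: "compact C"
    and open_V0: "open V\<^sub>0" "0 \<in> V\<^sub>0" "V\<^sub>0 \<subseteq> C"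
    and b_nonzero: "b \<noteq> 0"
    and b_C: "c \<in> C \<Longrightarrow> b * c \<in> C"
    and b_powers: "(\<lambda>n. b ^ n) \<longlonglongrightarrow> 0"

text \<open>Any sufficiently small nonzero \<open>b\<close> in \<open>F\<close> works: it maps the
  compact \<open>C\<close> into itself, and its powers cannot cluster away from 0, because quotients
  of nearby terms would be positive powers of \<open>b\<close> close to 1. Taking \<open>F\<close>
  as a parameter allows \<open>b\<close> to be chosen in a subfield.\<close>

lemma ex_contraction:
  fixes F :: "'a::local_field set"
  assumes "\<And>V. open V \<Longrightarrow> 0 \<in> V \<Longrightarrow> \<exists>x\<in>F. x \<noteq> 0 \<and> x \<in> V"
  obtains b C V\<^sub>0 where "b \<in> F" "contraction b C V\<^sub>0"
proof -
  obtain U C :: "'a set" where UC: "open U" "compact C" "0 \<in> U" "U \<subseteq> C"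
    using locally_compact[of "0::'a"] by (elim exE conjE)
  obtain c where c: "c \<in> U" "c \<noteq> 0"
    using assms[OF UC(1,3)] by blast
  \<comment> \<open>Deleting \<open>c\<close> from \<open>U\<close> puts \<open>c\<close> outside
    the closed set \<open>b * C\<close>. As \<open>b ^ k * c\<close> lies in \<open>b * C\<close>
    for positive \<open>k\<close>, this keeps \<open>b ^ k\<close> away from 1.\<close>
  have "open (U \<inter> - {c})" "0 \<in> U \<inter> - {c}" using UC c by auto
  then obtain W where W: "open W" "0 \<in> W" "\<And>w z. w \<in> W \<Longrightarrow> z \<in> C \<Longrightarrow> w * z \<in> U \<inter> - {c}"
    using absorbing_nhd[OF UC(2)] by metis
  obtain b where b: "b \<in> F" "b \<noteq> 0" "b \<in> W" using assms W by blast
  have bC: "b * z \<in> C" if "z \<in> C" for z using W(3)[OF b(3) that] UC by auto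
  have powC: "b ^ n * c \<in> C" for n
    by (induction n) (use bC c UC in \<open>auto simp: mult.assoc\<close>)
  have c_notin: "c \<notin> (\<lambda>z. b * z) ` C" using W(3)[OF b(3)] by auto
  have lim: "(\<lambda>n. b ^ n * c) \<longlonglongrightarrow> 0"
  proof (rule ccontr)
    assume "\<not> ?thesis"
    then obtain V where V: "open V" "0 \<in> V" "\<not> (\<forall>\<^sub>F n in sequentially. b ^ n * c \<in> V)"
      by (auto simp: tendsto_def)
    then have "infinite {n. b ^ n * c \<in> C - V}"
      using powC unfolding cofinite_eq_sequentially[symmetric] eventually_cofinite by auto
    moreover have "compact (C - V)" using UC V by (simp add: compact_diff)
    ultimately obtain y where y: "y \<in> C - V"
        "\<And>N. open N \<Longrightarrow> y \<in> N \<Longrightarrow> infinite {n. b ^ n * c \<in> N}"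
      using compact_sequence_cluster[of "C - V" "\<lambda>n. b ^ n * c"] by metis
    then have "y \<noteq> 0" using V by auto
    define O1 where "O1 = (\<lambda>z. z * c) -` (- (\<lambda>z. b * z) ` C)"
    have "closed ((\<lambda>z. b * z) ` C)" using compact_scaled UC(2) compact_imp_closed by blast
    then have "open O1" unfolding O1_def
      by (intro open_vimage) (auto intro!: continuous_on_mult' continuous_on_const continuous_on_id)
    have "1 \<in> O1" using c_notin by (simp add: O1_def)
    have "((\<lambda>p. snd p * inverse (fst p)) \<longlongrightarrow> y * inverse y) (nhds y \<times>\<^sub>F nhds y)"
      by (intro tendsto_mult tendsto_inverse_field \<open>y \<noteq> 0\<close> filterlim_fst filterlim_snd)
    then have "((\<lambda>p. snd p * inverse (fst p)) \<longlongrightarrow> 1) (nhds y \<times>\<^sub>F nhds y)"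
      using \<open>y \<noteq> 0\<close> by simp
    then have "\<forall>\<^sub>F p in nhds y \<times>\<^sub>F nhds y. snd p * inverse (fst p) \<in> O1"
      using \<open>open O1\<close> \<open>1 \<in> O1\<close> by (simp add: tendsto_def)
    then obtain P where P: "eventually P (nhds y)"
        "\<And>u v. P u \<Longrightarrow> P v \<Longrightarrow> v * inverse u \<in> O1"
      unfolding eventually_prod_same by auto
    then obtain N where N: "open N" "y \<in> N" "\<And>u. u \<in> N \<Longrightarrow> P u"
      by (auto simp: eventually_nhds)
    \<comment> \<open>Two visits to \<open>N\<close> at times \<open>n < k\<close> have ratio
      \<open>b ^ (k - n)\<close> in \<open>O1\<close>, which contradicts
      \<open>b ^ (k - n) * c\<close> lying in \<open>b * C\<close>.\<close>
    have inf: "infinite {n. b ^ n * c \<in> N}" using y N by blast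
    then obtain n where n: "b ^ n * c \<in> N" using not_finite_existsD by auto
    obtain k where k: "k > n" "b ^ k * c \<in> N" using inf unfolding infinite_nat_iff_unbounded by auto
    have "b ^ k * c * inverse (b ^ n * c) \<in> O1" using P N n k by blast
    moreover have "b ^ k * c * inverse (b ^ n * c) = b ^ (k - n)"
      using k c b by (simp add: power_diff field_simps)
    ultimately have "b ^ (k - n) * c \<notin> (\<lambda>z. b * z) ` C" by (simp add: O1_def)
    moreover have "b ^ (k - n) * c = b * (b ^ (k - n - 1) * c)"
      using k by (simp add: power_eq_if)
    ultimately show False using powC by blast
  qed
  have "(\<lambda>n. b ^ n * c * inverse c) \<longlonglongrightarrow> 0 * inverse c"
    by (intro tendsto_mult lim tendsto_const)
  then have "(\<lambda>n. b ^ n) \<longlonglongrightarrow> 0" using c by (simp add: mult.assoc)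
  then have "contraction b C U" using UC b bC by unfold_locales auto
  then show ?thesis using b that by blast
qed

context contraction
begin

lemma b_pow_C: "c \<in> C \<Longrightarrow> b ^ n * c \<in> C"
  by (induction n) (auto simp: mult.assoc b_C)

lemma zero_C: "0 \<in> C"
  using open_V0 by auto

lemma ev_b_powers: "open V \<Longrightarrow> 0 \<in> V \<Longrightarrow> \<forall>\<^sub>F n in sequentially. b ^ n \<in> V"
  using b_powers by (simp add: tendsto_def)

lemma b_pow_absorb: "\<exists>n. b ^ n * x \<in> C"
proof -
  have "(\<lambda>n. b ^ n * x) \<longlonglongrightarrow> 0 * x" by (intro tendsto_mult b_powers tendsto_const)
  then have "\<forall>\<^sub>F n in sequentially. b ^ n * x \<in> V\<^sub>0"
    using open_V0 by (simp add: tendsto_def)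
  then show ?thesis using open_V0 eventually_sequentially by (meson order_refl subsetD)
qed

lemma ev_scaled_compact:
  fixes V Z :: "'a set"
  assumes "compact Z" "open V" "0 \<in> V"
  shows "\<forall>\<^sub>F n in sequentially. \<forall>z\<in>Z. b ^ n * z \<in> V"
proof -
  obtain W where "open W" "0 \<in> W" "\<And>w z. w \<in> W \<Longrightarrow> z \<in> Z \<Longrightarrow> w * z \<in> V"
    using absorbing_nhd[OF assms] by metis
  then show ?thesis using ev_b_powers[of W] by (auto elim: eventually_mono)
qed

lemma not_infinitely_divisible:
  fixes Z :: "'a set"
  assumes "x \<noteq> 0" "compact Z"
  shows "\<exists>m. \<forall>n\<ge>m. \<forall>z\<in>Z. b ^ n * z \<noteq> x"
  using ev_scaled_compact[OF assms(2), of "- {x}"] assms(1)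
  by (auto simp: eventually_sequentially)

text \<open>A compact annulus around 0, the analogue of the scalars x with |b| < |x| \<le>
  1.\<close>

definition "S = C - (\<lambda>x. b * x) ` V\<^sub>0"

lemma compact_S: "compact S"
  unfolding S_def by (intro compact_diff compact_C open_scaled open_V0 b_nonzero)

lemma zero_S: "0 \<notin> S"
  using open_V0 by (auto simp: S_def)

lemma S_C: "S \<subseteq> C"
  by (auto simp: S_def)

text \<open>For \<open>x\<close> in \<open>C\<close>, divide by \<open>b\<close> until the next
  division leaves \<open>C\<close>; this must happen since \<open>x\<close> is not infinitely
  divisible, and the last value inside is not in \<open>b * V\<^sub>0\<close> because
  \<open>V\<^sub>0 \<subseteq> C\<close>. For \<open>x\<close> outside \<open>C\<close>, multiply by
  \<open>b\<close> until \<open>C\<close> is first entered.\<close>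

lemma annulus_decomposition:
  fixes x :: 'a
  assumes "x \<noteq> 0"
  obtains (inside) n s where "s \<in> S" "x = b ^ n * s"
    | (outside) n s where "s \<in> S" "b ^ n * x = s"
proof (cases "x \<in> C")
  case True
  let ?P = "\<lambda>n. inverse b ^ n * x \<notin> C"
  obtain m where "\<forall>z\<in>C. b ^ m * z \<noteq> x"
    using not_infinitely_divisible[OF assms compact_C] by blast
  moreover have "b ^ m * (inverse b ^ m * x) = x"
    using b_nonzero by (simp add: field_simps)
  ultimately have "?P m" by blast
  moreover have "\<not> ?P 0" using True by simp
  ultimately obtain k where k: "?P (Suc k)" "\<not> ?P k"
    using ex_least_nat_less[of ?P m] by (metis lessI less_Suc_eq_le)
  have "inverse b ^ k * x \<in> S"
  proof (rule ccontr)
    assume "inverse b ^ k * x \<notin> S"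
    then obtain v where "v \<in> V\<^sub>0" "inverse b ^ k * x = b * v" using k by (auto simp: S_def)
    then have "inverse b ^ Suc k * x = v" using b_nonzero by (simp add: field_simps)
    then show False using k open_V0 \<open>v \<in> V\<^sub>0\<close> by auto
  qed
  moreover have "x = b ^ k * (inverse b ^ k * x)" using b_nonzero by (simp add: field_simps)
  ultimately show ?thesis using inside by blast
next
  case False
  let ?P = "\<lambda>n. b ^ n * x \<in> C"
  obtain m where "?P m" using b_pow_absorb by blast
  moreover have "\<not> ?P 0" using False by simp
  ultimately obtain k where k: "?P (Suc k)" "\<not> ?P k"
    using ex_least_nat_less[of ?P m] by (metis lessI less_Suc_eq_le)
  have "b ^ Suc k * x \<in> S"
    using k open_V0 b_nonzero by (auto simp: S_def mult.assoc)
  then show ?thesis using outside by blast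
qed

lemma compact_scaled_C: "compact {x. b ^ m * x \<in> C}"
proof -
  have "{x. b ^ m * x \<in> C} = (\<lambda>x. inverse b ^ m * x) ` C"
    using b_nonzero by (auto simp: image_iff field_simps intro!: bexI[of _ "b ^ m * _"])
  then show ?thesis using compact_scaled[OF compact_C] by simp
qed

lemma scaled_C_mono: "b ^ n * x \<in> C \<Longrightarrow> n \<le> m \<Longrightarrow> b ^ m * x \<in> C"
  using b_pow_C[of "b ^ n * x" "m - n"] by (simp add: mult.assoc[symmetric] power_add[symmetric])

lemma inverse_nhd_bounded:
  fixes V :: "'a set"
  assumes "open V" "0 \<in> V"
  shows "\<exists>D. compact D \<and> (\<forall>x. inverse x \<notin> V \<longrightarrow> x \<in> D)"
proof -
  obtain m where m: "\<forall>n\<ge>m. \<forall>z\<in>inverse ` S. b ^ n * z \<in> V"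
    using ev_scaled_compact[OF compact_inverse_image[OF compact_S zero_S] assms]
    by (auto simp: eventually_sequentially)
  show ?thesis
  proof (intro exI[of _ "{x. b ^ m * x \<in> C}"] conjI compact_scaled_C allI impI)
    fix x assume x: "inverse x \<notin> V"
    then have "x \<noteq> 0" using assms by auto
    then show "x \<in> {x. b ^ m * x \<in> C}"
    proof (cases rule: annulus_decomposition)
      case (inside n s)
      then have "b ^ 0 * x \<in> C" using b_pow_C S_C by auto
      then show ?thesis using scaled_C_mono[of 0 x m] by simp
    next
      case (outside n s)
      then have "b ^ n * inverse s = inverse x"
        using b_nonzero \<open>x \<noteq> 0\<close> by (auto simp: field_simps)
      then have "n < m" using m x outside by (metis image_eqI not_le)
      then show ?thesis using scaled_C_mono[of n x m] outside S_C by auto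
    qed
  qed
qed

text \<open>An unbounded \<open>x\<close> would have a small inverse, and then
  \<open>inverse x ^ n * x ^ n\<close> could not equal 1 with \<open>x ^ n\<close> confined to
  \<open>Z\<close>.\<close>

lemma bounded_root:
  fixes Z :: "'a set"
  assumes "compact Z" "n > 0"
  shows "\<exists>Z'. compact Z' \<and> (\<forall>x. x ^ n \<in> Z \<longrightarrow> x \<in> Z')"
proof -
  obtain W :: "'a set" where W: "open W" "0 \<in> W" "\<And>w z. w \<in> W \<Longrightarrow> z \<in> Z \<Longrightarrow> w * z \<in> - {1}"
    using absorbing_nhd[OF assms(1), of "- {1}"] by auto
  define V where "V = (\<lambda>v. v ^ n) -` W"
  have "open V" unfolding V_def
    by (intro open_vimage W) (simp add: continuous_on_def tendsto_power_strong tendsto_ident_at)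
  moreover have "0 \<in> V" using W assms by (simp add: V_def zero_power)
  ultimately obtain D where D: "compact D" "\<And>x. inverse x \<notin> V \<Longrightarrow> x \<in> D"
    using inverse_nhd_bounded by blast
  have "x \<in> insert 0 D" if "x ^ n \<in> Z" for x
  proof (cases "x = 0")
    case False
    have "inverse x \<notin> V"
    proof
      assume "inverse x \<in> V"
      then have "inverse x ^ n * x ^ n \<noteq> 1" using W(3)[of "inverse x ^ n"] that by (auto simp: V_def)
      then show False using False by (simp add: field_simps)
    qed
    then show ?thesis using D by auto
  qed auto
  then show ?thesis using compact_insert[OF D(1), of 0] by blast
qed

text \<open>The scalars \<open>inverse b ^ m\<close> are unbounded: otherwise
  \<open>\<alpha>\<close> would be \<open>b ^ m\<close> times an element of one compact set for
  every \<open>m\<close>.\<close>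

lemma bounded_linear_imp_constant:
  fixes \<alpha> \<gamma> :: 'a
  assumes "compact Z" "\<And>m. \<gamma> + inverse b ^ m * \<alpha> \<in> Z"
  shows "\<alpha> = 0"
proof (rule ccontr)
  assume "\<alpha> \<noteq> 0"
  have "compact ((\<lambda>z. z + (- \<gamma>)) ` Z)"
    by (intro compact_continuous_image assms continuous_on_add continuous_on_const continuous_on_id)
  from not_infinitely_divisible[OF \<open>\<alpha> \<noteq> 0\<close> this]
  obtain m where m: "\<forall>z\<in>Z. b ^ m * (z + (- \<gamma>)) \<noteq> \<alpha>" by auto
  moreover have "b ^ m * (\<gamma> + inverse b ^ m * \<alpha> + (- \<gamma>)) = \<alpha>"
    using b_nonzero by (simp add: field_simps)
  ultimately show False using assms(2)[of m] by blast
qed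

text \<open>Provides a dominant entry, as if one of maximal absolute value were chosen. The compact
  set \<open>D\<close> of possible ratios depends neither on the index set nor on the family, which
  makes later choices of a pivot uniform.\<close>

lemma bounded_ratio:
  "\<exists>D. compact D \<and> (\<forall>I (f :: 'i \<Rightarrow> 'a). finite I \<longrightarrow> (\<exists>i\<in>I. f i \<noteq> 0) \<longrightarrow>
     (\<exists>p\<in>I. f p \<noteq> 0 \<and> (\<forall>l\<in>I. f l / f p \<in> D)))"
proof -
  let ?D = "{x * y | x y. x \<in> C \<and> y \<in> inverse ` S}"
  have "compact ?D"
    by (intro compact_mult_image compact_C compact_inverse_image compact_S zero_S)
  moreover have "\<exists>p\<in>I. f p \<noteq> 0 \<and> (\<forall>l\<in>I. f l / f p \<in> ?D)"
    if I: "finite I" "\<exists>i\<in>I. f i \<noteq> 0" for I and f :: "'i \<Rightarrow> 'a"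
  proof -
    have "\<exists>k::int. \<exists>s\<in>S. x = b powi k * s" if x: "x \<noteq> 0" for x
      using x
    proof (cases rule: annulus_decomposition)
      case (inside n s)
      then show ?thesis by (intro exI[of _ "int n"]) auto
    next
      case (outside n s)
      then have "x = b powi (- int n) * s"
        using b_nonzero by (auto simp: power_int_minus field_simps)
      then show ?thesis using outside by blast
    qed
    \<comment> \<open>\<open>k\<close> plays the role of a valuation. Exponents need not be unique,
      so one is fixed for each scalar; an entry of least exponent is dominant.\<close>
    then obtain k :: "'a \<Rightarrow> int" and s where ks: "\<And>x. x \<noteq> 0 \<Longrightarrow> s x \<in> S \<and> x = b powi k x * s x"
      by metis
    let ?J = "{i\<in>I. f i \<noteq> 0}"
    have "finite ((\<lambda>i. k (f i)) ` ?J)" "(\<lambda>i. k (f i)) ` ?J \<noteq> {}" using I by auto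
    then have "Min ((\<lambda>i. k (f i)) ` ?J) \<in> (\<lambda>i. k (f i)) ` ?J" by (rule Min_in)
    then obtain p where p: "p \<in> ?J" "k (f p) = Min ((\<lambda>i. k (f i)) ` ?J)" by auto
    have "f l / f p \<in> ?D" if l: "l \<in> I" for l
    proof (cases "f l = 0")
      case True
      then have "f l / f p = 0 * inverse (s (f p))" by simp
      then show ?thesis using zero_C ks p by blast
    next
      case False
      then have "k (f p) \<le> k (f l)" using p I l by auto
      then obtain m where m: "k (f l) = k (f p) + int m" using zle_iff_zadd by auto
      have "f l / f p = (b powi k (f l) * s (f l)) / (b powi k (f p) * s (f p))"
        using ks[of "f l"] ks[of "f p"] False p by auto
      also have "\<dots> = (b ^ m * s (f l)) * inverse (s (f p))"
        using b_nonzero by (simp add: m power_int_add divide_inverse)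
      finally show ?thesis using ks[of "f l"] ks[of "f p"] False p b_pow_C S_C by blast
    qed
    then show ?thesis using p by blast
  qed
  ultimately show ?thesis by blast
qed

end

lemma ambient_contraction:
  obtains b C V\<^sub>0 where "contraction (b::'a::local_field) C V\<^sub>0"
proof -
  have "\<exists>x\<in>UNIV. x \<noteq> 0 \<and> x \<in> V" if "open V" "0 \<in> V" for V :: "'a set"
  proof (rule ccontr)
    assume "\<not> ?thesis"
    then have "V = {0}" using that by auto
    then show False using that not_open_zero by auto
  qed
  then obtain b C V\<^sub>0 where "contraction (b::'a) C V\<^sub>0"
    by (rule ex_contraction)
  then show ?thesis by (rule that)
qed

text \<open>Inverses of nonzero elements of \<open>F\<close> stay out of \<open>V\<close>, so
  \<open>F\<close> is bounded. Differences of distinct elements also stay out of \<open>V\<close>,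
  so every point has a neighbourhood with at most one element of \<open>F\<close>; finitely many
  such neighbourhoods suffice.\<close>

lemma discrete_subfield_finite:
  fixes F :: "'a::local_field set"
  assumes F: "\<And>x. x \<in> F \<Longrightarrow> inverse x \<in> F" "\<And>x y. x \<in> F \<Longrightarrow> y \<in> F \<Longrightarrow> x - y \<in> F"
    and V: "open V" "0 \<in> V" "V \<inter> F \<subseteq> {0}"
  shows "finite F"
proof -
  obtain b :: 'a and C V\<^sub>0 where "contraction b C V\<^sub>0" by (rule ambient_contraction)
  then interpret contraction b C V\<^sub>0 .
  obtain D where D: "compact D" "\<And>x. inverse x \<notin> V \<Longrightarrow> x \<in> D" using inverse_nhd_bounded[OF V(1,2)] by blast
  have FD: "F \<subseteq> insert 0 D"
  proof
    fix x assume "x \<in> F"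
    have "inverse x \<notin> V" if "x \<noteq> 0"
      using V(3) F(1)[OF \<open>x \<in> F\<close>] that by auto
    then show "x \<in> insert 0 D" using D(2)[of x] by auto
  qed
  have "\<exists>N. open N \<and> y \<in> N \<and> finite (F \<inter> N)" for y
  proof -
    have "((\<lambda>p. fst p - snd p) \<longlongrightarrow> y - y) (nhds y \<times>\<^sub>F nhds y)"
      unfolding diff_conv_add_uminus
      by (intro tendsto_add tendsto_minus filterlim_fst filterlim_snd)
    then have "\<forall>\<^sub>F p in nhds y \<times>\<^sub>F nhds y. fst p - snd p \<in> V"
      using V by (simp add: tendsto_def)
    then obtain P where P: "eventually P (nhds y)" "\<And>u v. P u \<Longrightarrow> P v \<Longrightarrow> u - v \<in> V"
      unfolding eventually_prod_same by auto
    then obtain N where N: "open N" "y \<in> N" "\<And>u. u \<in> N \<Longrightarrow> P u"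
      by (auto simp: eventually_nhds)
    have eq: "u = v" if "u \<in> F \<inter> N" "v \<in> F \<inter> N" for u v
    proof -
      have "u - v \<in> V \<inter> F" using that P(2)[of u v] N(3) F(2)[of u v] by auto
      then show ?thesis using V(3) by auto
    qed
    have "finite (F \<inter> N)"
    proof (cases "F \<inter> N = {}")
      case False
      then obtain u where "u \<in> F \<inter> N" by blast
      then have "F \<inter> N \<subseteq> {u}" using eq by blast
      then show ?thesis by (rule finite_subset) simp
    qed simp
    then show ?thesis using N by blast
  qed
  then obtain N where N: "\<And>y. open (N y) \<and> y \<in> N y \<and> finite (F \<inter> N y)" by metis
  have "compact (insert 0 D)" using D by (rule_tac compact_insert)
  then obtain E where E: "finite E" "insert 0 D \<subseteq> (\<Union>y\<in>E. N y)"
    using compact_nhd_cover[of "insert 0 D" N] N by blast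
  have "F \<subseteq> (\<Union>y\<in>E. F \<inter> N y)"
  proof
    fix x assume "x \<in> F"
    then have "x \<in> (\<Union>y\<in>E. N y)" using FD E(2) by (meson subsetD)
    then show "x \<in> (\<Union>y\<in>E. F \<inter> N y)" using \<open>x \<in> F\<close> by simp
  qed
  moreover have "finite (\<Union>y\<in>E. F \<inter> N y)" using E(1) N by (intro finite_UN_I) blast+
  ultimately show ?thesis by (rule finite_subset)
qed

section \<open>Matrices over a subfield\<close>

text \<open>Closure under the type class operations, so that one set of matrix facts serves both
  \<open>F\<close> and its closure.\<close>

locale subfield_set =
  fixes K :: "'a::field set"
  assumes zero_closed [simp]: "0 \<in> K"
    and one_closed [simp]: "1 \<in> K"
    and add_closed [intro, simp]: "x \<in> K \<Longrightarrow> y \<in> K \<Longrightarrow> x + y \<in> K"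
    and uminus_closed [intro, simp]: "x \<in> K \<Longrightarrow> - x \<in> K"
    and mult_closed [intro, simp]: "x \<in> K \<Longrightarrow> y \<in> K \<Longrightarrow> x * y \<in> K"
    and inverse_closed [intro, simp]: "x \<in> K \<Longrightarrow> inverse x \<in> K"

lemma subfield_set_if_subfield:
  fixes F :: "'a::field set"
  assumes "subfield F (ring_of_type_algebra :: 'a ring)"
  shows "subfield_set F"
proof -
  let ?R = "ring_of_type_algebra :: 'a ring"
  interpret R: field ?R by (rule field_from_type_algebra)
  have sr: "subring F ?R" using subfieldE(1)[OF assms] .
  have ops: "x \<otimes>\<^bsub>?R\<^esub> y = x * y" "x \<oplus>\<^bsub>?R\<^esub> y = x + y" "\<one>\<^bsub>?R\<^esub> = 1" "\<zero>\<^bsub>?R\<^esub> = 0" for x y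
    by (auto simp: ring_of_type_algebra_def)
  have um: "\<ominus>\<^bsub>?R\<^esub> x = - x" for x
    by (rule R.minus_equality) (auto simp: ring_of_type_algebra_def)
  have inv: "inverse x \<in> F" if "x \<in> F" for x
  proof (cases "x = 0")
    case False
    then have "inv\<^bsub>?R\<^esub> x \<in> F" "x * inv\<^bsub>?R\<^esub> x = 1"
      using R.subfield_m_inv[OF assms, of x] that by (auto simp: ops)
    then show ?thesis using inverse_unique by metis
  qed (use that in simp)
  show ?thesis
    using subringE[OF sr] inv unfolding subfield_set_def by (auto simp: ops um)
qed

lemma subfield_set_closure:
  fixes F :: "'a::topological_field set"
  assumes "subfield_set F"
  shows "subfield_set (closure F)"
proof -
  interpret subfield_set F by fact
  have two: "(\<lambda>p. g (fst p) (snd p)) ` (closure F \<times> closure F) \<subseteq> closure F"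
    if "continuous_on UNIV (\<lambda>p. g (fst p) (snd p))" "\<And>x y. x \<in> F \<Longrightarrow> y \<in> F \<Longrightarrow> g x y \<in> F"
    for g :: "'a \<Rightarrow> 'a \<Rightarrow> 'a"
    unfolding closure_Times[symmetric]
    by (rule image_closure_subset)
      (use that closure_subset[of F] in \<open>auto intro: continuous_on_subset\<close>)
  have 1: "x + y \<in> closure F" if "x \<in> closure F" "y \<in> closure F" for x y
  proof -
    have "continuous_on UNIV (\<lambda>p::'a\<times>'a. fst p + snd p)"
      by (intro continuous_on_add continuous_on_fst continuous_on_snd continuous_on_id)
    from two[of "(+)", OF this] that show ?thesis by (auto simp: image_subset_iff)
  qed
  have 2: "x * y \<in> closure F" if "x \<in> closure F" "y \<in> closure F" for x y
  proof -
    have "continuous_on UNIV (\<lambda>p::'a\<times>'a. fst p * snd p)"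
      by (intro continuous_on_mult' continuous_on_fst continuous_on_snd continuous_on_id)
    from two[of "(*)", OF this] that show ?thesis by (auto simp: image_subset_iff)
  qed
  have 3: "- x \<in> closure F" if "x \<in> closure F" for x
  proof -
    have "uminus ` closure F \<subseteq> closure F"
      by (rule image_closure_subset)
        (use closure_subset[of F] in \<open>auto intro!: continuous_on_minus continuous_on_id\<close>)
    then show ?thesis using that by auto
  qed
  have 4: "inverse x \<in> closure F" if "x \<in> closure F" for x
  proof (cases "x = 0")
    case False
    \<comment> \<open>Continuity of \<open>inverse\<close> is available only at nonzero points, so
      the argument is local at \<open>x\<close> instead of using the image of a closure.\<close>
    have "\<exists>y\<in>F. y \<in> T" if T: "open T" "inverse x \<in> T" for T
    proof -
      have "(inverse \<longlongrightarrow> inverse x) (nhds x)" using False by (rule tendsto_inverse_nhds)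
      then have "\<forall>\<^sub>F y in nhds x. inverse y \<in> T" using T by (simp add: tendsto_def)
      then obtain N where N: "open N" "x \<in> N" "\<And>y. y \<in> N \<Longrightarrow> inverse y \<in> T"
        by (auto simp: eventually_nhds)
      then obtain y where "y \<in> F" "y \<in> N"
        using \<open>x \<in> closure F\<close> open_Int_closure_eq_empty[OF N(1), of F] by auto
      then show ?thesis using N(3)[of y] by auto
    qed
    then show ?thesis unfolding closure_iff_nhds_not_empty by (metis IntI empty_iff subsetD)
  qed (use that in simp)
  show ?thesis
    using 1 2 3 4 subsetD[OF closure_subset[of F] zero_closed] subsetD[OF closure_subset[of F] one_closed]
    by (auto simp: subfield_set_def)
qed

context subfield_set
begin

lemma diff_closed [intro, simp]: "x \<in> K \<Longrightarrow> y \<in> K \<Longrightarrow> x - y \<in> K"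
  using add_closed[of x "- y"] by simp

lemma divide_closed [intro, simp]: "x \<in> K \<Longrightarrow> y \<in> K \<Longrightarrow> x / y \<in> K"
  by (simp add: divide_inverse)

lemma power_closed [intro, simp]: "x \<in> K \<Longrightarrow> x ^ n \<in> K"
  by (induction n) auto

lemma sum_closed: "(\<And>i. i \<in> I \<Longrightarrow> f i \<in> K) \<Longrightarrow> sum f I \<in> K"
  by (induction I rule: infinite_finite_induct) auto

lemma prod_closed: "(\<And>i. i \<in> I \<Longrightarrow> f i \<in> K) \<Longrightarrow> prod f I \<in> K"
  by (induction I rule: infinite_finite_induct) auto

lemma det_closed: "(\<And>i j. A $ i $ j \<in> K) \<Longrightarrow> det A \<in> K"
  unfolding det_def by (intro sum_closed mult_closed prod_closed) (auto simp: sign_def)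

lemma matrix_mult_closed:
  "(\<And>i j. A $ i $ j \<in> K) \<Longrightarrow> (\<And>i j. B $ i $ j \<in> K) \<Longrightarrow> (A ** B) $ i $ j \<in> K"
  by (auto simp: matrix_matrix_mult_def intro: sum_closed)

end

text \<open>The entry at (k, j) is the Cramer determinant with column \<open>k\<close> replaced by
  the \<open>j\<close>-th unit vector. On determinant 1 this is the inverse, in a form polynomial in
  the entries: continuous everywhere and compatible with subfields.\<close>

definition adjugate :: "'a::field^'n^'n \<Rightarrow> 'a^'n^'n" where
  "adjugate A = (\<chi> k j. det (\<chi> i l. if l = k then (if i = j then 1 else 0) else A $ i $ l))"

lemma adjugate_right:
  fixes A :: "'a::field^'n^'n"
  assumes "det A = 1"
  shows "A ** adjugate A = mat 1"
proof -
  have "(A ** adjugate A) $ i $ j = (mat 1 :: 'a^'n^'n) $ i $ j" for i j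
  proof -
    have "A *v (\<chi> k. adjugate A $ k $ j) = axis j 1"
      by (subst cramer) (auto simp: assms adjugate_def axis_def vec_eq_iff intro!: arg_cong[where f = det])
    then have "(A *v (\<chi> k. adjugate A $ k $ j)) $ i = (axis j 1 :: 'a^'n) $ i" by simp
    then show ?thesis
      by (simp add: matrix_vector_mult_def matrix_matrix_mult_def mat_def axis_def)
  qed
  then show ?thesis by (simp add: vec_eq_iff)
qed

lemma adjugate_left:
  assumes "det A = 1"
  shows "adjugate A ** A = mat 1"
  using adjugate_right[OF assms] matrix_left_right_inverse by blast

lemma det_adjugate:
  assumes "det A = 1"
  shows "det (adjugate A) = 1"
  using adjugate_right[OF assms] det_mul[of A "adjugate A"] by (simp add: assms)

lemma continuous_on_adjugate:
  fixes f :: "'b::topological_space \<Rightarrow> 'a::topological_field^'n^'n"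
  assumes "continuous_on S f"
  shows "continuous_on S (\<lambda>x. adjugate (f x))"
proof -
  have "continuous_on S (\<lambda>x. if P then c else f x $ i $ l)" for P c i l
    by (cases P) (auto intro!: continuous_on_component assms)
  then show ?thesis
    unfolding adjugate_def
    by (intro continuous_on_vec_lambda continuous_on_det_field)
qed

lemma SL_carrier_iff: "A \<in> carrier (SL K) \<longleftrightarrow> (\<forall>i j. A $ i $ j \<in> K) \<and> det A = 1"
  by (simp add: SL_def)

lemma SL_simps [simp]: "A \<otimes>\<^bsub>SL K\<^esub> B = A ** B" "\<one>\<^bsub>SL K\<^esub> = mat 1"
  by (simp_all add: SL_def)

context subfield_set
begin

lemma adjugate_closed: "(\<And>i j. A $ i $ j \<in> K) \<Longrightarrow> adjugate A $ i $ j \<in> K"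
  by (auto simp: adjugate_def intro!: det_closed)

lemma mat_SL_iff: "(mat c :: 'a^'n^'n) \<in> carrier (SL K) \<longleftrightarrow> c \<in> roots_of_unity_in CARD('n) K"
proof -
  have "det (mat c :: 'a^'n^'n) = c ^ CARD('n)"
    by (subst det_diagonal) (auto simp: mat_def)
  moreover have "(\<forall>i j. (mat c :: 'a^'n^'n) $ i $ j \<in> K) \<longleftrightarrow> c \<in> K"
    by (auto simp: mat_def)
  ultimately show ?thesis by (simp add: SL_carrier_iff roots_of_unity_in_def)
qed

lemma one_SL: "mat 1 \<in> carrier (SL K)"
  by (simp add: mat_SL_iff roots_of_unity_in_def)

lemma mult_SL: "A \<in> carrier (SL K) \<Longrightarrow> B \<in> carrier (SL K) \<Longrightarrow> A ** B \<in> carrier (SL K)"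
  by (auto simp: SL_carrier_iff det_mul intro: matrix_mult_closed)

lemma adjugate_SL: "A \<in> carrier (SL K) \<Longrightarrow> adjugate A \<in> carrier (SL K)"
  by (auto simp: SL_carrier_iff det_adjugate intro: adjugate_closed)

lemma group_SL: "group (SL K :: ('a^'n^'n) monoid)"
proof (rule groupI)
  fix A :: "'a^'n^'n" assume "A \<in> carrier (SL K)"
  then show "\<exists>B\<in>carrier (SL K). B \<otimes>\<^bsub>SL K\<^esub> A = \<one>\<^bsub>SL K\<^esub>"
    by (intro bexI[of _ "adjugate A"]) (auto simp: adjugate_left SL_carrier_iff[of A] intro: adjugate_SL)
qed (auto simp: one_SL mult_SL matrix_mul_assoc)

lemma inv_SL: "A \<in> carrier (SL K) \<Longrightarrow> inv\<^bsub>SL K\<^esub> A = adjugate A"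
  using group.inv_equality[OF group_SL, of "adjugate A" A]
  by (auto simp: adjugate_left adjugate_SL SL_carrier_iff adjugate_closed det_adjugate)

end

section \<open>Elementary matrices, transvections and rank-one tori\<close>

definition rowmat :: "'n \<Rightarrow> ('n \<Rightarrow> 'a) \<Rightarrow> 'a::field^'n^'n" where
  "rowmat q d = (\<chi> i j. (if i = j then 1 else 0) + (if i = q then d j else 0))"

definition colmat :: "'n \<Rightarrow> ('n \<Rightarrow> 'a) \<Rightarrow> 'a::field^'n^'n" where
  "colmat p c = (\<chi> i j. (if i = j then 1 else 0) + (if j = p then c i else 0))"

definition transvection :: "'n \<Rightarrow> 'n \<Rightarrow> 'a \<Rightarrow> 'a::field^'n^'n" where
  "transvection p q x = (\<chi> i j. (if i = j then 1 else 0) + (if i = p \<and> j = q then x else 0))"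

definition torus :: "'n \<Rightarrow> 'n \<Rightarrow> 'a \<Rightarrow> 'a::field^'n^'n" where
  "torus p q s = (\<chi> i j. if i = j then (if i = p then s else if i = q then inverse s else 1) else 0)"

lemma sum_delta_times:
  "(\<Sum>k\<in>UNIV. (if i = k then 1 else 0) * f k) = (f i :: 'a::comm_ring_1)"
  "(\<Sum>k\<in>UNIV. f k * (if k = i then 1 else 0)) = f i"
  for i :: "'n::finite"
  by (simp_all add: if_distrib[of "\<lambda>x. x * _"] if_distrib[of "\<lambda>x. _ * x"] sum.delta sum.delta' cong: if_cong)

lemma mult_colmat: "(A ** colmat p c) $ i $ j = A $ i $ j + (if j = p then \<Sum>k\<in>UNIV. A $ i $ k * c k else 0)"
  by (simp add: colmat_def matrix_matrix_mult_def distrib_left sum.distrib sum_delta_times)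

lemma mult_rowmat: "(A ** rowmat q d) $ i $ j = A $ i $ j + A $ i $ q * d j"
proof -
  have "(\<Sum>k\<in>UNIV. A $ i $ k * (if k = q then d j else 0)) = A $ i $ q * d j"
    by (simp add: if_distrib[of "\<lambda>x. _ * x"] sum.delta cong: if_cong)
  then show ?thesis
    by (simp add: rowmat_def matrix_matrix_mult_def distrib_left sum.distrib sum_delta_times)
qed

lemma colmat_mult: "(colmat p c ** A) $ i $ j = A $ i $ j + c i * A $ p $ j"
proof -
  have "(\<Sum>k\<in>UNIV. (if k = p then c i else 0) * A $ k $ j) = c i * A $ p $ j"
    by (simp add: if_distrib[of "\<lambda>x. x * _"] sum.delta cong: if_cong)
  then show ?thesis
    by (simp add: colmat_def matrix_matrix_mult_def distrib_right sum.distrib sum_delta_times)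
qed

lemma transvection_mult: "(transvection p q x ** A) $ i $ j = A $ i $ j + (if i = p then x * A $ q $ j else 0)"
proof -
  have "transvection p q x = colmat q (\<lambda>i. if i = p then x else 0)"
    by (auto simp: transvection_def colmat_def vec_eq_iff)
  then show ?thesis by (simp add: colmat_mult)
qed

lemma mult_transvection: "(A ** transvection p q x) $ i $ j = A $ i $ j + (if j = q then A $ i $ p * x else 0)"
proof -
  have "transvection p q x = rowmat p (\<lambda>i. if i = q then x else 0)"
    by (auto simp: transvection_def rowmat_def vec_eq_iff)
  then show ?thesis by (simp add: mult_rowmat)
qed

lemma torus_mult:
  "(torus p q s ** A) $ i $ j = (if i = p then s else if i = q then inverse s else 1) * A $ i $ j"
  by (simp add: torus_def matrix_matrix_mult_def if_distrib[of "\<lambda>x. x * _"] sum.delta' sum.delta cong: if_cong)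

lemma mult_torus:
  "(A ** torus p q s) $ i $ j = A $ i $ j * (if j = p then s else if j = q then inverse s else 1)"
  by (simp add: torus_def matrix_matrix_mult_def if_distrib[of "\<lambda>x. _ * x"] sum.delta' sum.delta cong: if_cong)

lemma mat_mult_nth: "(mat c ** A) $ i $ j = c * A $ i $ j" "(A ** mat c) $ i $ j = A $ i $ j * c"
  for A :: "'a::comm_ring_1^'n^'n"
  by (simp_all add: mat_def matrix_matrix_mult_def if_distrib[of "\<lambda>x. x * _"] if_distrib[of "\<lambda>x. _ * x"] sum.delta' sum.delta cong: if_cong)

text \<open>Since \<open>d q = 0\<close>, the matrix arises from the identity by adding to row
  \<open>q\<close> a combination of the other rows, which preserves the determinant.\<close>

lemma det_rowmat:
  fixes d :: "'n::finite \<Rightarrow> 'a::field"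
  assumes "d q = 0"
  shows "det (rowmat q d) = 1"
proof -
  let ?v = "\<Sum>j\<in>UNIV - {q}. d j *s row j (mat 1 :: 'a^'n^'n)"
  have "?v \<in> vec.span {row j (mat 1 :: 'a^'n^'n) |j. j \<noteq> q}"
    by (intro vec.span_sum vec.span_scale vec.span_base) auto
  then have "det (\<chi> k. if k = q then row q (mat 1 :: 'a^'n^'n) + ?v else row k (mat 1)) = det (mat 1 :: 'a^'n^'n)"
    by (rule det_row_span)
  moreover have "(\<chi> k. if k = q then row q (mat 1 :: 'a^'n^'n) + ?v else row k (mat 1)) = rowmat q d"
  proof -
    have "(\<Sum>k\<in>UNIV - {q}. d k * (if k = j then 1 else 0)) = d j" for j
      using assms by (cases "j = q") (auto simp: if_distrib[of "\<lambda>x. _ * x"] sum.delta cong: if_cong)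
    then show ?thesis
      by (auto simp: vec_eq_iff rowmat_def row_def mat_def)
  qed
  ultimately show ?thesis by simp
qed

lemma det_colmat:
  fixes c :: "'n::finite \<Rightarrow> 'a::field"
  assumes "c p = 0"
  shows "det (colmat p c) = 1"
proof -
  have "colmat p c = transpose (rowmat p c)"
    by (auto simp: vec_eq_iff transpose_def rowmat_def colmat_def)
  then show ?thesis using det_rowmat[of c p] assms by (simp add: det_transpose)
qed

lemma transvection_rowmat: "transvection p q x = rowmat p (\<lambda>i. if i = q then x else 0)"
  by (auto simp: transvection_def rowmat_def vec_eq_iff)

lemma det_transvection: "p \<noteq> q \<Longrightarrow> det (transvection p q x) = 1"
  unfolding transvection_rowmat by (rule det_rowmat) auto

lemma det_torus:
  assumes "p \<noteq> q" "s \<noteq> 0"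
  shows "det (torus p q s) = 1"
proof -
  have "det (torus p q s) = (\<Prod>i\<in>UNIV. if i = p then s else if i = q then inverse s else 1)"
    by (subst det_diagonal) (auto simp: torus_def)
  also have "\<dots> = s * (inverse s * 1)"
    using assms by (subst prod.remove[of _ p]; simp)
  finally show ?thesis using assms by simp
qed

lemma transvection_zero: "transvection p q 0 = mat 1"
  by (auto simp: transvection_def mat_def vec_eq_iff)

lemma transvection_add: "p \<noteq> q \<Longrightarrow> transvection p q x ** transvection p q y = transvection p q (x + y)"
  by (auto simp: vec_eq_iff transvection_mult) (auto simp: transvection_def)

lemma conj_transvection:
  assumes "A ** B = mat 1"
  shows "(A ** transvection p q x ** B) $ i $ j = (if i = j then 1 else 0) + A $ i $ p * x * B $ q $ j"
proof -
  have "(A ** transvection p q x ** B) $ i $ j = (\<Sum>k\<in>UNIV. A $ i $ k * B $ k $ j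
      + (if k = q then A $ i $ p * x * B $ k $ j else 0))"
    by (subst matrix_matrix_mult_def)
      (auto simp: mult_transvection algebra_simps intro!: sum.cong)
  also have "\<dots> = (A ** B) $ i $ j + A $ i $ p * x * B $ q $ j"
    by (simp add: sum.distrib matrix_matrix_mult_def)
  finally show ?thesis by (simp add: assms mat_def)
qed

lemma torus_inverse:
  assumes "s \<noteq> 0" "p \<noteq> q"
  shows "adjugate (torus p q s) = torus p q (inverse s)"
proof -
  have "torus p q s ** torus p q (inverse s) = mat 1"
    using assms by (auto simp: vec_eq_iff torus_mult) (auto simp: torus_def mat_def)
  then have "adjugate (torus p q s) ** (torus p q s ** torus p q (inverse s)) = adjugate (torus p q s)"
    by simp
  then show ?thesis using adjugate_left[OF det_torus[OF assms(2,1)]] by (simp add: matrix_mul_assoc)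
qed

text \<open>The multiplier is a square; this is the origin of the differences of squares used for
  the root groups.\<close>

lemma torus_conj_transvection:
  assumes "s \<noteq> 0" "p \<noteq> q"
  shows "torus p q s ** transvection p q x ** adjugate (torus p q s) = transvection p q (s ^ 2 * x)"
  unfolding torus_inverse[OF assms]
  using assms by (auto simp: vec_eq_iff mult_torus torus_mult) (auto simp: transvection_def power2_eq_square)

lemma adjugate_transvection:
  assumes "p \<noteq> q"
  shows "adjugate (transvection p q x) = transvection p q (- x)"
proof -
  have "adjugate (transvection p q x) ** (transvection p q x ** transvection p q (- x)) = adjugate (transvection p q x)"
    using assms by (simp add: transvection_add transvection_zero)
  then show ?thesis using adjugate_left[OF det_transvection[OF assms], of x] by (simp add: matrix_mul_assoc)
qed

section \<open>The centre of SL and generation by transvections\<close>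

context subfield_set
begin

lemma transvection_SL: "p \<noteq> q \<Longrightarrow> x \<in> K \<Longrightarrow> transvection p q x \<in> carrier (SL K)"
  by (auto simp: SL_carrier_iff det_transvection) (auto simp: transvection_def)

lemma torus_SL: "p \<noteq> q \<Longrightarrow> s \<in> K \<Longrightarrow> s \<noteq> 0 \<Longrightarrow> torus p q s \<in> carrier (SL K)"
  by (auto simp: SL_carrier_iff det_torus) (auto simp: torus_def)

lemma rowmat_SL: "d q = 0 \<Longrightarrow> (\<And>i. d i \<in> K) \<Longrightarrow> rowmat q d \<in> carrier (SL K)"
  by (auto simp: SL_carrier_iff det_rowmat) (auto simp: rowmat_def)

lemma colmat_SL: "c p = 0 \<Longrightarrow> (\<And>i. c i \<in> K) \<Longrightarrow> colmat p c \<in> carrier (SL K)"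
  by (auto simp: SL_carrier_iff det_colmat) (auto simp: colmat_def)

text \<open>Comparing the entries at (p, p) kills the entry of \<open>z\<close> at (q, p); comparing
  those at (p, q) equates two diagonal entries.\<close>

lemma commuting_imp_scalar:
  fixes z :: "'a^'n^'n"
  assumes "\<And>p q. p \<noteq> q \<Longrightarrow> z ** transvection p q 1 = transvection p q 1 ** z"
  obtains c where "z = mat c"
proof -
  have e: "(z ** transvection p q 1) $ i $ j = (transvection p q 1 ** z) $ i $ j" if "p \<noteq> q" for p q i j
    using assms[OF that] by simp
  have off: "z $ q $ p = 0" if "p \<noteq> q" for p q
    using e[OF that, of p p] that by (simp add: transvection_mult mult_transvection)
  have on: "z $ q $ q = z $ p $ p" for p q
    using e[of p q p q] by (cases "p = q") (simp_all add: transvection_mult mult_transvection)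
  have "z = mat (z $ undefined $ undefined)"
    using off on by (auto simp: vec_eq_iff mat_def)
  then show ?thesis by (rule that)
qed

lemma center_SL: "center (SL K :: ('a^'n^'n) monoid) = mat ` roots_of_unity_in CARD('n) K"
proof
  show "center (SL K :: ('a^'n^'n) monoid) \<subseteq> mat ` roots_of_unity_in CARD('n) K"
  proof
    fix z :: "'a^'n^'n" assume z: "z \<in> center (SL K)"
    then have "z ** transvection p q 1 = transvection p q 1 ** z" if "p \<noteq> q" for p q
      using that by (auto simp: center_def transvection_SL)
    then obtain c where "z = mat c" by (rule commuting_imp_scalar)
    then show "z \<in> mat ` roots_of_unity_in CARD('n) K"
      using z by (auto simp: center_def mat_SL_iff)
  qed
qed (auto simp: center_def mat_SL_iff vec_eq_iff mat_mult_nth mult.commute)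

text \<open>Gaussian elimination by transvections alone. The set \<open>I\<close> of the invariant
  \<open>triv\<close> collects the indices whose row and column are already those of the identity,
  and the induction is on the number of remaining indices. When one index is left, the determinant
  forces the last diagonal entry to be 1.\<close>

lemma SL_generated:
  fixes M :: "('a^'n^'n) set"
  assumes one: "mat 1 \<in> M"
    and mult: "\<And>A B. A \<in> M \<Longrightarrow> B \<in> M \<Longrightarrow> A ** B \<in> M"
    and transvection: "\<And>p q x. p \<noteq> q \<Longrightarrow> x \<in> K \<Longrightarrow> transvection p q x \<in> M"
  shows "carrier (SL K) \<subseteq> M"
proof -
  have col: "colmat p c \<in> M" if "p \<notin> J" "\<And>i. i \<notin> J \<Longrightarrow> c i = 0" "\<And>i. c i \<in> K" "finite J" for p c J
    using that(4,1-3)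
  proof (induction J arbitrary: c)
    case empty
    then have "colmat p c = mat 1" by (auto simp: colmat_def mat_def vec_eq_iff)
    then show ?case using one by simp
  next
    case (insert i J)
    have "colmat p (c(i := 0)) \<in> M" using insert.prems insert.hyps by (intro insert.IH) auto
    moreover have "transvection i p (c i) \<in> M" using insert.prems by (intro transvection) auto
    moreover have "colmat p c = transvection i p (c i) ** colmat p (c(i := 0))"
      using insert.prems by (auto simp: vec_eq_iff transvection_mult) (auto simp: colmat_def)
    ultimately show ?case using mult by simp
  qed
  have row: "rowmat p c \<in> M" if "p \<notin> J" "\<And>i. i \<notin> J \<Longrightarrow> c i = 0" "\<And>i. c i \<in> K" "finite J" for p c J
    using that(4,1-3)
  proof (induction J arbitrary: c)
    case empty
    then have "rowmat p c = mat 1" by (auto simp: rowmat_def mat_def vec_eq_iff)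
    then show ?case using one by simp
  next
    case (insert i J)
    have "rowmat p (c(i := 0)) \<in> M" using insert.prems insert.hyps by (intro insert.IH) auto
    moreover have "transvection p i (c i) \<in> M" using insert.prems by (intro transvection) auto
    moreover have "rowmat p c = rowmat p (c(i := 0)) ** transvection p i (c i)"
      using insert.prems by (auto simp: vec_eq_iff mult_transvection) (auto simp: rowmat_def)
    ultimately show ?case using mult by simp
  qed
  have row': "rowmat p c \<in> M" if "c p = 0" "\<And>i. c i \<in> K" for p c
    using that row[of p "- {p}" c] by auto
  have col': "colmat p c \<in> M" if "c p = 0" "\<And>i. c i \<in> K" for p c
    using that col[of p "- {p}" c] by auto
  have cancel: "g \<in> M" if "transvection p q x ** g \<in> M" "p \<noteq> q" "x \<in> K" for p q x g
  proof -
    have "g = transvection p q (- x) ** (transvection p q x ** g)"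
      using that by (simp add: matrix_mul_assoc transvection_add transvection_zero)
    then show ?thesis using mult[OF transvection that(1)] that by (metis uminus_closed)
  qed
  define triv :: "'n set \<Rightarrow> 'a^'n^'n \<Rightarrow> bool" where
    "triv I g \<longleftrightarrow> (\<forall>i\<in>I. \<forall>j. g $ i $ j = (if i = j then 1 else 0) \<and> g $ j $ i = (if i = j then 1 else 0))" for I g
  have main: "g \<in> M" if "triv I g" "g \<in> carrier (SL K)" "card (- I) = n" for I g n
    using that
  proof (induction n arbitrary: I g)
    case 0
    then have "I = UNIV" by auto
    then have "g = mat 1" using 0 by (auto simp: triv_def mat_def vec_eq_iff)
    then show ?case using one by simp
  next
    case (Suc n)
    have gK: "g $ i $ j \<in> K" for i j using Suc.prems by (simp add: SL_carrier_iff)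
    obtain p where p: "p \<notin> I" using Suc.prems(3) by (metis Compl_iff card.empty ex_in_conv nat.distinct(1))
    show ?case
    proof (cases "- I = {p}")
      case True
      have diag: "g $ i $ j = 0" if "i \<noteq> j" for i j
        using that True Suc.prems(1) unfolding triv_def by (metis ComplI singletonD)
      have "det g = (\<Prod>i\<in>UNIV. g $ i $ i)" by (rule det_diagonal) (use diag in auto)
      also have "\<dots> = g $ p $ p * (\<Prod>i\<in>UNIV - {p}. g $ i $ i)" by (rule prod.remove) auto
      also have "(\<Prod>i\<in>UNIV - {p}. g $ i $ i) = 1"
        by (rule prod.neutral) (use True Suc.prems(1) in \<open>auto simp: triv_def\<close>)
      finally have "g $ p $ p = 1" using Suc.prems(2) by (simp add: SL_carrier_iff)
      moreover have "g $ i $ i = 1" if "i \<noteq> p" for i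
        using that True Suc.prems(1) unfolding triv_def by (metis ComplI singletonD)
      ultimately have "g = mat 1" using diag by (auto simp: vec_eq_iff mat_def) metis
      then show ?thesis using one by simp
    next
      case False
      then obtain q where q: "q \<notin> I" "q \<noteq> p" using p by blast
      have step3: "h \<in> M" if h: "triv I h" "h \<in> carrier (SL K)" "h $ p $ p = 1" for h
      proof -
        have hK: "h $ i $ j \<in> K" for i j using h by (simp add: SL_carrier_iff)
        define c where "c i = (if i = p then 0 else - h $ i $ p)" for i
        define d where "d j = (if j = p then 0 else - h $ p $ j)" for j
        define h' where "h' = colmat p c ** h ** rowmat p d"
        have cd: "colmat p c \<in> carrier (SL K)" "rowmat p d \<in> carrier (SL K)"
          using hK by (auto intro!: colmat_SL rowmat_SL simp: c_def d_def)
        have "h' \<in> carrier (SL K)" unfolding h'_def using cd h by (auto intro: mult_SL)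
        have h': "h' $ i $ j = h $ i $ j + c i * h $ p $ j + (h $ i $ p + c i * h $ p $ p) * d j" for i j
          by (simp add: h'_def mult_rowmat colmat_mult)
        have "triv (insert p I) h'"
          unfolding triv_def
        proof (intro ballI allI)
          fix i j assume i: "i \<in> insert p I"
          show "h' $ i $ j = (if i = j then 1 else 0) \<and> h' $ j $ i = (if i = j then 1 else 0)"
          proof (cases "i = p")
            case True
            then show ?thesis using h(3) by (auto simp: h' c_def d_def)
          next
            case False
            then have "i \<in> I" using i by simp
            then have "h $ i $ j = (if i = j then 1 else 0)" "h $ j $ i = (if i = j then 1 else 0)"
              "h $ i $ p = 0" "h $ p $ i = 0"
              using h(1) False by (simp_all add: triv_def)
            then show ?thesis using False by (simp add: h' c_def d_def)
          qed
        qed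
        moreover have "card (- insert p I) = n"
        proof -
          have "- insert p I = - I - {p}" by auto
          then show ?thesis using Suc.prems(3) p by simp
        qed
        ultimately have "h' \<in> M" using Suc.IH \<open>h' \<in> carrier (SL K)\<close> by blast
        moreover have "h = colmat p (\<lambda>i. - c i) ** h' ** rowmat p (\<lambda>i. - d i)"
          by (auto simp: vec_eq_iff mult_rowmat colmat_mult h' c_def d_def algebra_simps h(3))
        moreover have "colmat p (\<lambda>i. - c i) \<in> M" "rowmat p (\<lambda>i. - d i) \<in> M"
          using hK by (auto intro!: col' row' simp: c_def d_def)
        ultimately show ?thesis using mult by metis
      qed
      have triv_transvection: "triv I (transvection k l x ** h)" if "triv I h" "k \<notin> I" "l \<notin> I" "k \<noteq> l" for k l x h
        using that unfolding triv_def by (auto simp: transvection_mult)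
      have step2: "h \<in> M" if h: "triv I h" "h \<in> carrier (SL K)" "l \<notin> I" "l \<noteq> p" "h $ l $ p \<noteq> 0" for h l
      proof -
        \<comment> \<open>The multiple of row \<open>l\<close> that, added to row \<open>p\<close>,
          turns the pivot into 1.\<close>
        let ?x = "(1 - h $ p $ p) / h $ l $ p"
        have x: "?x \<in> K" using h by (auto simp: SL_carrier_iff)
        have "transvection p l ?x ** h \<in> M"
          by (rule step3) (use h p x in \<open>auto intro!: triv_transvection mult_SL transvection_SL simp: transvection_mult\<close>)
        then show ?thesis using cancel x h by metis
      qed
      show ?thesis
      proof (cases "\<exists>l. l \<notin> I \<and> l \<noteq> p \<and> g $ l $ p \<noteq> 0")
        case True
        then show ?thesis using step2 Suc.prems by blast
      next
        case F: False
        have "g $ p $ p \<noteq> 0"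
        proof
          assume "g $ p $ p = 0"
          then have "g $ l $ p = 0" for l
            using F Suc.prems(1) p unfolding triv_def by (cases "l \<in> I") auto
          then have "(adjugate g ** g) $ p $ p = 0" by (simp add: matrix_matrix_mult_def)
          then show False using Suc.prems(2) by (simp add: adjugate_left SL_carrier_iff mat_def)
        qed
        \<comment> \<open>The pivot is the only nonzero entry of its column, so it is copied into
          row \<open>q\<close> to create the off-diagonal entry that \<open>step2\<close>
          requires.\<close>
        then have "transvection q p 1 ** g \<in> M"
          using F q p Suc.prems
          by (intro step2[of _ q] triv_transvection mult_SL transvection_SL) (auto simp: transvection_mult)
        then show ?thesis using cancel q by auto
      qed
    qed
  qed
  show ?thesis using main[of "{}"] by (auto simp: triv_def)
qed

end

lemma adjugate_unique:
  assumes "det A = 1" "A ** B = mat 1"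
  shows "adjugate A = B"
proof -
  have "adjugate A = adjugate A ** (A ** B)" by (simp add: assms)
  also have "\<dots> = B" using adjugate_left[OF assms(1)] by (simp add: matrix_mul_assoc)
  finally show ?thesis .
qed

lemma adjugate_mult:
  assumes "det A = 1" "det B = 1"
  shows "adjugate (A ** B) = adjugate B ** adjugate A"
proof (rule adjugate_unique)
  have "A ** B ** (adjugate B ** adjugate A) = A ** (B ** adjugate B) ** adjugate A"
    by (simp add: matrix_mul_assoc)
  then show "A ** B ** (adjugate B ** adjugate A) = mat 1" by (simp add: adjugate_right assms)
qed (simp add: det_mul assms)

lemma adjugate_adjugate: "det A = 1 \<Longrightarrow> adjugate (adjugate A) = A"
  by (intro adjugate_unique det_adjugate adjugate_left)

lemma continuous_on_transvection:
  fixes f :: "'b::topological_space \<Rightarrow> 'a::topological_field"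
  assumes "continuous_on S f"
  shows "continuous_on S (\<lambda>x. transvection p q (f x))"
proof -
  have "continuous_on S (\<lambda>x. if P then f x else 0)" for P
    by (cases P) (auto intro: assms)
  then show ?thesis
    unfolding transvection_def by (intro continuous_on_vec_lambda continuous_on_add continuous_on_const)
qed

lemma closed_carrier_SL:
  fixes K :: "'a::topological_field set"
  assumes "closed K"
  shows "closed (carrier (SL K :: ('a^'n^'n) monoid))"
proof -
  have "carrier (SL K :: ('a^'n^'n) monoid) = {A. \<forall>i. A $ i \<in> {x. \<forall>j. x $ j \<in> K}} \<inter> det -` {1}"
    by (auto simp: SL_def)
  moreover have "closed {A::'a^'n^'n. \<forall>i. A $ i \<in> {x. \<forall>j. x $ j \<in> K}}"
    by (intro closed_vector_box allI assms)
  moreover have "closed (det -` {1} :: ('a^'n^'n) set)"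
    by (intro closed_vimage continuous_on_det_field continuous_on_id) simp
  ultimately show ?thesis by (simp only:) (rule closed_Int)
qed

section \<open>Group topologies coarser than the topology of SL(n, K)\<close>

text \<open>The axioms of a base of identity neighbourhoods for a group topology on SL(n, K) coarser
  than the entrywise one. The topology may fail to be Hausdorff. That the members are closed
  entrywise is what makes compactness arguments interact with them.\<close>

locale SL_nhd_base = subfield_set K for K :: "'a::local_field set" +
  fixes \<U> :: "('a^'n^'n) set set"
  assumes closed_K: "closed K"
    and nondiscrete: "open N \<Longrightarrow> 0 \<in> N \<Longrightarrow> \<exists>x\<in>K. x \<noteq> 0 \<and> x \<in> N"
    and two_indices: "\<exists>p q :: 'n. p \<noteq> q"
    and base_subset: "U \<in> \<U> \<Longrightarrow> U \<subseteq> carrier (SL K)"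
    and base_closed: "U \<in> \<U> \<Longrightarrow> closed U"
    and base_nonempty: "\<U> \<noteq> {}"
    and base_directed: "U \<in> \<U> \<Longrightarrow> V \<in> \<U> \<Longrightarrow> \<exists>W\<in>\<U>. W \<subseteq> U \<inter> V"
    and base_nhd: "U \<in> \<U> \<Longrightarrow> \<exists>N. open N \<and> mat 1 \<in> N \<and> N \<inter> carrier (SL K) \<subseteq> U"
    and base_div: "U \<in> \<U> \<Longrightarrow> \<exists>V\<in>\<U>. \<forall>x\<in>V. \<forall>y\<in>V. x ** adjugate y \<in> U"
    and base_conj: "U \<in> \<U> \<Longrightarrow> g \<in> carrier (SL K) \<Longrightarrow> \<exists>V\<in>\<U>. \<forall>x\<in>V. g ** x ** adjugate g \<in> U"
begin

abbreviation "G \<equiv> carrier (SL K :: ('a^'n^'n) monoid)"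

text \<open>The closure of the identity in the topology given by the base.\<close>

definition "M = \<Inter>\<U>"

lemma det_G: "g \<in> G \<Longrightarrow> det g = 1"
  by (simp add: SL_carrier_iff)

lemma base_one: "U \<in> \<U> \<Longrightarrow> mat 1 \<in> U"
  using base_nhd[of U] one_SL by blast

lemma base_lower_bound:
  assumes "finite I" "\<And>i. i \<in> I \<Longrightarrow> f i \<in> \<U>"
  shows "\<exists>W\<in>\<U>. \<forall>i\<in>I. W \<subseteq> f i"
  using assms
proof (induction I)
  case empty
  then show ?case using base_nonempty by auto
next
  case (insert i I)
  then obtain W where W: "W \<in> \<U>" "\<forall>j\<in>I. W \<subseteq> f j" by auto
  obtain W' where "W' \<in> \<U>" "W' \<subseteq> f i \<inter> W" using base_directed[of "f i" W] insert.prems W by auto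
  then show ?case using W by (intro bexI[of _ W']) auto
qed

lemma base_mult:
  assumes "U \<in> \<U>"
  shows "\<exists>V\<in>\<U>. V \<subseteq> U \<and> (\<forall>x\<in>V. \<forall>y\<in>V. x ** y \<in> U)"
proof -
  obtain V1 where V1: "V1 \<in> \<U>" "\<forall>x\<in>V1. \<forall>y\<in>V1. x ** adjugate y \<in> U" using base_div[OF assms] by blast
  obtain V2 where V2: "V2 \<in> \<U>" "\<forall>x\<in>V2. \<forall>y\<in>V2. x ** adjugate y \<in> V1" using base_div[OF V1(1)] by blast
  obtain V3 where V3: "V3 \<in> \<U>" "V3 \<subseteq> V1 \<inter> V2" using base_directed V1 V2 by blast
  obtain V where V: "V \<in> \<U>" "V \<subseteq> V3 \<inter> U" using base_directed V3 assms by blast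
  have "x ** y \<in> U" if "x \<in> V" "y \<in> V" for x y
  proof -
    have "mat 1 ** adjugate y \<in> V1" using V2 V V3 that base_one[OF V2(1)] by blast
    then have "adjugate y \<in> V1" by simp
    then have "x ** adjugate (adjugate y) \<in> U" using V1 V V3 that by blast
    then show ?thesis using that(2) V base_subset[OF V(1)] by (metis adjugate_adjugate det_G subsetD)
  qed
  then show ?thesis using V by blast
qed

lemma base_conj_small:
  assumes "U \<in> \<U>"
  shows "\<exists>V\<in>\<U>. \<forall>x\<in>V. \<forall>y\<in>V. x ** y ** adjugate x \<in> U"
proof -
  obtain W where W: "W \<in> \<U>" "\<forall>x\<in>W. \<forall>y\<in>W. x ** adjugate y \<in> U" using base_div[OF assms] by blast
  obtain V where V: "V \<in> \<U>" "V \<subseteq> W" "\<forall>x\<in>V. \<forall>y\<in>V. x ** y \<in> W" using base_mult[OF W(1)] by blast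
  then show ?thesis using W by blast
qed

lemma M_subset: "U \<in> \<U> \<Longrightarrow> M \<subseteq> U"
  by (auto simp: M_def)

lemma M_G: "M \<subseteq> G"
  using base_nonempty base_subset M_subset by blast

lemma M_one: "mat 1 \<in> M"
  using base_one by (auto simp: M_def)

lemma M_div: "x \<in> M \<Longrightarrow> y \<in> M \<Longrightarrow> x ** adjugate y \<in> M"
  unfolding M_def using base_div by (meson InterE InterI)

lemma M_adjugate: "x \<in> M \<Longrightarrow> adjugate x \<in> M"
  using M_div[OF M_one] by simp

lemma M_mult: "x \<in> M \<Longrightarrow> y \<in> M \<Longrightarrow> x ** y \<in> M"
  using M_div[of x "adjugate y"] M_adjugate[of y] M_G by (metis adjugate_adjugate det_G subsetD)

lemma M_conj: "x \<in> M \<Longrightarrow> g \<in> G \<Longrightarrow> g ** x ** adjugate g \<in> M"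
  unfolding M_def using base_conj by (meson InterE InterI)

text \<open>Near \<open>b\<close> an element has the form \<open>b ** k\<close> with
  \<open>k\<close> close to the identity. Conjugation by \<open>k\<close> is controlled by joint
  continuity at the identity, conjugation by \<open>b\<close> by \<open>base_conj\<close>; finitely
  many centres \<open>b\<close> cover \<open>B\<close>.\<close>

lemma conj_compact:
  assumes B: "compact B" "B \<subseteq> G" and U: "U \<in> \<U>"
  shows "\<exists>V\<in>\<U>. \<forall>b\<in>B. \<forall>x\<in>V. b ** x ** adjugate b \<in> U"
proof -
  have "\<exists>N V. open N \<and> b \<in> N \<and> V \<in> \<U> \<and> (\<forall>c\<in>N \<inter> G. \<forall>x\<in>V. c ** x ** adjugate c \<in> U)" if b: "b \<in> B" for b
  proof -
    have bG: "b \<in> G" using b B by blast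
    obtain U1 where U1: "U1 \<in> \<U>" "\<forall>x\<in>U1. b ** x ** adjugate b \<in> U"
      using base_conj[OF U bG] by blast
    obtain V where V: "V \<in> \<U>" "\<forall>x\<in>V. \<forall>y\<in>V. x ** y ** adjugate x \<in> U1"
      using base_conj_small[OF U1(1)] by blast
    obtain N where N: "open N" "mat 1 \<in> N" "N \<inter> G \<subseteq> V" using base_nhd[OF V(1)] by blast
    let ?N = "(\<lambda>c. adjugate b ** c) -` N"
    have "open ?N"
      by (intro open_vimage N continuous_on_matrix_mult continuous_on_const continuous_on_id)
    moreover have "b \<in> ?N" using N bG by (simp add: adjugate_left det_G)
    moreover have "c ** x ** adjugate c \<in> U" if c: "c \<in> ?N \<inter> G" and x: "x \<in> V" for c x
    proof -
      let ?k = "adjugate b ** c"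
      have "?k \<in> V" using c N bG by (auto intro: mult_SL adjugate_SL)
      then have "b ** (?k ** x ** adjugate ?k) ** adjugate b \<in> U" using V U1 x by blast
      also have "adjugate ?k = adjugate c ** b"
        using bG c by (simp add: adjugate_mult det_adjugate det_G adjugate_adjugate)
      also have "b ** (?k ** x ** (adjugate c ** b)) ** adjugate b
          = (b ** adjugate b) ** c ** x ** adjugate c ** (b ** adjugate b)"
        by (simp add: matrix_mul_assoc)
      finally show ?thesis using bG by (simp add: adjugate_right det_G)
    qed
    ultimately show ?thesis using V(1) by blast
  qed
  then obtain N V where NV: "\<And>b. b \<in> B \<Longrightarrow> open (N b) \<and> b \<in> N b \<and> V b \<in> \<U> \<and>
      (\<forall>c\<in>N b \<inter> G. \<forall>x\<in>V b. c ** x ** adjugate c \<in> U)" by metis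
  then obtain D where D: "D \<subseteq> B" "finite D" "B \<subseteq> (\<Union>b\<in>D. N b)"
    using compact_nhd_cover[OF B(1), of N] by blast
  then obtain W where W: "W \<in> \<U>" "\<forall>b\<in>D. W \<subseteq> V b"
    using base_lower_bound[of D V] NV by (meson subsetD)
  have "c ** x ** adjugate c \<in> U" if c: "c \<in> B" and x: "x \<in> W" for c x
  proof -
    obtain b where b: "b \<in> D" "c \<in> N b" using subsetD[OF D(3) c] by (elim UN_E)
    then have "c \<in> N b \<inter> G" "x \<in> V b" "b \<in> B" using c x W(2) B(2) D(1) by auto
    then show ?thesis using NV[of b] by blast
  qed
  then show ?thesis using W by blast
qed

section \<open>Boundedness of root groups and of small neighbourhoods\<close>

lemma separate_compact:
  assumes "compact Q" "Q \<inter> M = {}"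
  shows "\<exists>U\<in>\<U>. U \<inter> Q = {}"
proof -
  have "\<forall>q\<in>Q. \<exists>U\<in>\<U>. q \<notin> U" using assms(2) by (auto simp: M_def)
  then obtain U where U: "\<And>q. q \<in> Q \<Longrightarrow> U q \<in> \<U> \<and> q \<notin> U q" by metis
  \<comment> \<open>The complements of closed members of the base cover \<open>Q\<close>;
    directedness then merges a finite subcover into one member.\<close>
  then have "\<And>q. q \<in> Q \<Longrightarrow> open (- U q) \<and> q \<in> - U q" using base_closed by auto
  then obtain D where D: "D \<subseteq> Q" "finite D" "Q \<subseteq> (\<Union>q\<in>D. - U q)"
    using compact_nhd_cover[OF assms(1), of "\<lambda>q. - U q"] by blast
  then obtain W where W: "W \<in> \<U>" "\<forall>q\<in>D. W \<subseteq> U q"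
    using base_lower_bound[of D U] U by (metis subsetD)
  have "x \<notin> W" if x: "x \<in> Q" for x
  proof -
    obtain q where "q \<in> D" "x \<in> - U q" using subsetD[OF D(3) x] by (elim UN_E)
    then show ?thesis using W(2) by blast
  qed
  then show ?thesis using W(1) by (meson disjoint_iff)
qed

text \<open>In characteristic 2 use (1 + x)^2 - 1 = x^2 with \<open>x = a ^ n\<close>; otherwise (1
  + u)^2 - (1 - u)^2 = 4u with u = x^2 / 4.\<close>

lemma square_differences:
  assumes "a \<in> K" "(\<lambda>n. a ^ n) \<longlonglongrightarrow> 0"
  obtains s t where "\<And>n. s n \<in> K" "\<And>n. t n \<in> K" "s \<longlonglongrightarrow> 1" "t \<longlonglongrightarrow> 1"
    "\<And>n. s n ^ 2 - t n ^ 2 = (a ^ 2) ^ n"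
proof (cases "(2::'a) = 0")
  case True
  let ?s = "\<lambda>n. 1 + a ^ n"
  have "?s \<longlonglongrightarrow> 1 + 0" by (intro tendsto_add tendsto_const assms)
  moreover have "?s n ^ 2 - 1 ^ 2 = (a ^ 2) ^ n" for n
  proof -
    have "?s n ^ 2 - 1 ^ 2 = 2 * a ^ n + (a ^ n) ^ 2" by (simp add: power2_eq_square algebra_simps)
    then show ?thesis by (simp add: True power_mult[symmetric] mult.commute)
  qed
  ultimately show ?thesis
    using assms(1) by (intro that[of ?s "\<lambda>_. 1"]) (simp_all del: one_power2)
next
  case False
  let ?u = "\<lambda>n. (a ^ n * a ^ n) * inverse (2 * 2)"
  have u: "?u \<longlonglongrightarrow> 0 * 0 * inverse (2 * 2)" by (intro tendsto_mult tendsto_const assms)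
  have two: "(2::'a) \<in> K" using add_closed[OF one_closed one_closed] by simp
  have "(\<lambda>n. 1 + ?u n) \<longlonglongrightarrow> 1 + 0 * 0 * inverse (2 * 2)" by (intro tendsto_add tendsto_const u)
  moreover have "(\<lambda>n. 1 + - ?u n) \<longlonglongrightarrow> 1 + - (0 * 0 * inverse (2 * 2))"
    by (intro tendsto_add tendsto_minus tendsto_const u)
  moreover have "(1 + ?u n) ^ 2 - (1 + - ?u n) ^ 2 = (a ^ 2) ^ n" for n
  proof -
    have "(1 + x) ^ 2 - (1 + - x) ^ 2 = 2 * 2 * x" for x :: 'a
      by (simp add: power2_eq_square algebra_simps)
    then have "(1 + ?u n) ^ 2 - (1 + - ?u n) ^ 2 = (2 * 2 * inverse (2 * 2)) * (a ^ n * a ^ n)"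
      by (simp only: mult_ac)
    also have "2 * 2 * inverse (2 * 2) = (1::'a)" using False by (intro right_inverse) (simp del: mult_numeral_1 mult_2 numeral_times_numeral)
    finally show ?thesis by (simp add: power2_eq_square power_mult_distrib)
  qed
  moreover have "1 + ?u n \<in> K" "1 + - ?u n \<in> K" for n
    by (intro add_closed uminus_closed mult_closed inverse_closed power_closed one_closed assms(1) two)+
  ultimately show ?thesis
    by (intro that[of "\<lambda>n. 1 + ?u n" "\<lambda>n. 1 + - ?u n"]) simp_all
qed

lemma tendsto_torus:
  fixes s :: "nat \<Rightarrow> 'a"
  assumes "s \<longlonglongrightarrow> 1"
  shows "(\<lambda>n. torus p q (s n) :: 'a^'n^'n) \<longlonglongrightarrow> mat 1"
proof -
  have 1: "(\<lambda>n. if i = p then s n else if i = q then inverse (s n) else 1) \<longlonglongrightarrow> 1" for i :: 'n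
    using assms tendsto_inverse_field[OF assms] by (cases "i = p"; cases "i = q") simp_all
  have 2: "(\<lambda>n. if P then f n else 0) \<longlonglongrightarrow> (if P then 1 else 0)" if "f \<longlonglongrightarrow> 1" for P and f :: "nat \<Rightarrow> 'a"
    using that by auto
  show ?thesis
    unfolding torus_def mat_def by (intro tendsto_vec_lambda 2 1)
qed

text \<open>Choose \<open>P\<close> in the base avoiding the transvections with parameter in the
  annulus. If the parameter \<open>x\<close> gives an element of a small \<open>V\<close>,
  conjugating by two tori close to the identity and dividing the results puts the parameter
  \<open>b ^ n * x\<close> into \<open>P\<close> for every \<open>n \<ge> m\<close>. Hence
  \<open>x\<close> must enter the annulus before step \<open>m\<close>.\<close>

lemma root_group_bounded:
  assumes nM: "\<forall>x\<in>K. transvection p q x \<in> M \<longrightarrow> x = 0" and pq: "p \<noteq> q"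
  shows "\<exists>W\<in>\<U>. \<exists>B. compact B \<and> (\<forall>x\<in>K. transvection p q x \<in> W \<longrightarrow> x \<in> B)"
proof -
  obtain a C V\<^sub>0 where aK: "a \<in> K" and "contraction a C V\<^sub>0"
    using ex_contraction[of K] nondiscrete by metis
  then interpret A: contraction a C V\<^sub>0 by simp
  \<comment> \<open>The differences of squares obtained from \<open>a\<close> are the powers of
    \<open>a ^ 2\<close>, so the annulus is formed with respect to this contraction.\<close>
  define b where "b = a ^ 2"
  have bK: "b \<in> K" using aK by (simp add: b_def)
  have "(\<lambda>n. a ^ n * a ^ n) \<longlonglongrightarrow> 0 * 0" by (intro tendsto_mult A.b_powers)
  then have "(\<lambda>n. b ^ n) \<longlonglongrightarrow> 0"
    by (simp add: b_def power2_eq_square power_mult_distrib)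
  moreover have "b * c \<in> C" if "c \<in> C" for c
    using A.b_pow_C[OF that, of 2] by (simp add: b_def)
  ultimately interpret contraction b C V\<^sub>0
    using A.compact_C A.open_V0 A.b_nonzero by unfold_locales (auto simp: b_def)
  have "compact (transvection p q ` (S \<inter> K) :: ('a^'n^'n) set)"
    by (intro compact_continuous_image continuous_on_transvection continuous_on_id compact_Int_closed compact_S closed_K)
  moreover have "transvection p q ` (S \<inter> K) \<inter> M = {}" using nM zero_S by auto
  ultimately obtain P where P: "P \<in> \<U>" "P \<inter> transvection p q ` (S \<inter> K) = {}"
    using separate_compact by blast
  obtain P' where P': "P' \<in> \<U>" "\<forall>x\<in>P'. \<forall>y\<in>P'. x ** adjugate y \<in> P" using base_div[OF P(1)] by blast
  obtain V where V: "V \<in> \<U>" "\<forall>x\<in>V. \<forall>y\<in>V. x ** y ** adjugate x \<in> P'" using base_conj_small[OF P'(1)] by blast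
  obtain N where N: "open N" "mat 1 \<in> N" "N \<inter> G \<subseteq> V" using base_nhd[OF V(1)] by blast
  obtain s t where st: "\<And>n. s n \<in> K" "\<And>n. t n \<in> K" "s \<longlonglongrightarrow> 1" "t \<longlonglongrightarrow> 1"
    "\<And>n. s n ^ 2 - t n ^ 2 = b ^ n"
    using square_differences[OF aK A.b_powers] unfolding b_def by metis
  have ev: "\<forall>\<^sub>F n in sequentially. torus p q (r n) \<in> N \<and> r n \<noteq> 0" if "r \<longlonglongrightarrow> 1" for r
  proof -
    have "\<forall>\<^sub>F n in sequentially. r n \<in> - {0}" using that by (rule topological_tendstoD) auto
    then show ?thesis
      using topological_tendstoD[OF tendsto_torus[OF that] N(1,2), of p q] by eventually_elim auto
  qed
  obtain m where m: "\<And>n. n \<ge> m \<Longrightarrow> torus p q (s n) \<in> N \<and> s n \<noteq> 0 \<and> torus p q (t n) \<in> N \<and> t n \<noteq> 0"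
    using eventually_conj[OF ev[OF st(3)] ev[OF st(4)]] unfolding eventually_sequentially by blast
  have key: "transvection p q (b ^ n * x) \<in> P" if x: "x \<in> K" "transvection p q x \<in> V" and n: "n \<ge> m" for n x
  proof -
    have sq: "transvection p q (r ^ 2 * x) \<in> P'" if "r \<in> K" "r \<noteq> 0" "torus p q r \<in> N" for r
    proof -
      have "torus p q r \<in> V" using N torus_SL[OF pq that(1,2)] that by blast
      then have "torus p q r ** transvection p q x ** adjugate (torus p q r) \<in> P'" using V x by blast
      then show ?thesis by (simp add: torus_conj_transvection pq that)
    qed
    have "transvection p q (s n ^ 2 * x) ** adjugate (transvection p q (t n ^ 2 * x)) \<in> P"
      using P' sq m[OF n] st by blast
    also have "transvection p q (s n ^ 2 * x) ** adjugate (transvection p q (t n ^ 2 * x)) = transvection p q (b ^ n * x)"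
      using pq by (simp add: adjugate_transvection transvection_add st(5)[symmetric] algebra_simps)
    finally show ?thesis .
  qed
  have "b ^ m * x \<in> C" if x: "x \<in> K" "transvection p q x \<in> V" for x
  proof (cases "x = 0")
    case False
    then show ?thesis
    proof (cases rule: annulus_decomposition)
      case (inside n s)
      then have "b ^ 0 * x \<in> C" using b_pow_C S_C by auto
      then show ?thesis using scaled_C_mono[of 0 x m] by simp
    next
      case (outside n s)
      have "b ^ n * x \<in> K" using bK x by auto
      then have "transvection p q (b ^ n * x) \<notin> P" using P(2) outside by blast
      then have "n < m" using key[OF x, of n] by fastforce
      then show ?thesis using scaled_C_mono[of n x m] outside S_C by auto
    qed
  qed (simp add: zero_C)
  then show ?thesis using V(1) compact_scaled_C[of m] by blast
qed

lemma root_groups_bounded: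
  assumes nM: "\<forall>p q. p \<noteq> q \<longrightarrow> (\<forall>x\<in>K. transvection p q x \<in> M \<longrightarrow> x = 0)"
  shows "\<exists>W\<in>\<U>. \<exists>B. compact B \<and> (\<forall>p q. p \<noteq> q \<longrightarrow> (\<forall>x\<in>K. transvection p q x \<in> W \<longrightarrow> x \<in> B))"
proof -
  let ?I = "{r :: 'n \<times> 'n. fst r \<noteq> snd r}"
  have "\<exists>W B. W \<in> \<U> \<and> compact B \<and> (\<forall>x\<in>K. transvection (fst r) (snd r) x \<in> W \<longrightarrow> x \<in> B)" if "r \<in> ?I" for r
  proof -
    have ne: "fst r \<noteq> snd r" using that by simp
    show ?thesis using root_group_bounded[OF spec[OF spec[OF nM], THEN mp, OF ne] ne] by blast
  qed
  then obtain W B where WB: "\<And>r. r \<in> ?I \<Longrightarrow> W r \<in> \<U> \<and> compact (B r) \<and>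
      (\<forall>x\<in>K. transvection (fst r) (snd r) x \<in> W r \<longrightarrow> x \<in> B r)" by metis
  obtain W' where W': "W' \<in> \<U>" "\<forall>r\<in>?I. W' \<subseteq> W r"
    using base_lower_bound[of ?I W] WB by auto
  have "compact (\<Union>r\<in>?I. B r)" using WB by (intro compact_UN) auto
  moreover have "x \<in> (\<Union>r\<in>?I. B r)" if h: "p \<noteq> q" "x \<in> K" "transvection p q x \<in> W'" for p q x
  proof -
    have "(p, q) \<in> ?I" using h(1) by simp
    then have "x \<in> B (p, q)" using WB[of "(p, q)"] W'(2) h by fastforce
    then show ?thesis using \<open>(p, q) \<in> ?I\<close> by blast
  qed
  ultimately show ?thesis using W'(1) by blast
qed

lemma compact_SL_box:
  assumes "compact D"
  shows "compact {A \<in> G. \<forall>i j. A $ i $ j \<in> D}"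
proof -
  have "{A \<in> G. \<forall>i j. A $ i $ j \<in> D} = {A. \<forall>i j. A $ i $ j \<in> D} \<inter> G" by auto
  then show ?thesis
    using compact_Int_closed[OF compact_matrix_box[OF assms] closed_carrier_SL[OF closed_K]] by simp
qed

text \<open>Every rank-one nilpotent \<open>v \<otimes> f\<close> is a multiple of a matrix unit conjugated by \<open>L R\<^sup>-\<^sup>1\<close>,
  where \<open>L\<close> and \<open>R\<close> are unipotent with entries \<open>v l / v p\<close> and \<open>f l / f q\<close>. Choosing \<open>p\<close> and \<open>q\<close>
  as positions of dominant entries keeps the conjugator in a fixed compact set.\<close>

lemma transvection_conj_compact:
  obtains Q where "compact Q" "Q \<subseteq> G"
    "\<And>v f :: 'n \<Rightarrow> 'a. (\<And>i. v i \<in> K) \<Longrightarrow> (\<And>i. f i \<in> K) \<Longrightarrow> \<exists>i. v i \<noteq> 0 \<Longrightarrow> \<exists>i. f i \<noteq> 0 \<Longrightarrow>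
      (\<Sum>i\<in>UNIV. f i * v i) = 0 \<Longrightarrow>
      \<exists>k\<in>Q. \<exists>p q. p \<noteq> q \<and> (\<forall>x i j. (k ** transvection p q (x * v p * f q) ** adjugate k) $ i $ j
         = (if i = j then 1 else 0) + x * v i * f j)"
proof -
  obtain b :: 'a and C V\<^sub>0 where "contraction b C V\<^sub>0" by (rule ambient_contraction)
  then interpret contraction b C V\<^sub>0 .
  obtain D where D: "compact D" and ratio: "\<And>I (f :: 'n \<Rightarrow> 'a). finite I \<Longrightarrow> \<exists>i\<in>I. f i \<noteq> 0 \<Longrightarrow>
      \<exists>p\<in>I. f p \<noteq> 0 \<and> (\<forall>l\<in>I. f l / f p \<in> D)"
    using bounded_ratio by blast
  \<comment> \<open>Contains all possible entries of the two unipotent factors: 0, 1, and the ratios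
    up to sign.\<close>
  define D0 where "D0 = insert 0 (insert 1 (D \<union> uminus ` D))"
  have "compact (uminus ` D)"
    by (intro compact_continuous_image D continuous_on_minus continuous_on_id)
  then have D0: "compact D0" unfolding D0_def by (intro compact_insert compact_Un D)
  let ?Box = "{A \<in> G. \<forall>i j. A $ i $ j \<in> D0}"
  define Q where "Q = (\<lambda>p. fst p ** snd p) ` (?Box \<times> ?Box)"
  have "compact Q" unfolding Q_def
    by (intro compact_continuous_image compact_Times compact_SL_box D0 continuous_on_matrix_mult
        continuous_on_fst continuous_on_snd continuous_on_id)
  moreover have "Q \<subseteq> G" unfolding Q_def by (auto intro: mult_SL)
  moreover have "\<exists>k\<in>Q. \<exists>p q. p \<noteq> q \<and> (\<forall>x i j. (k ** transvection p q (x * v p * f q) ** adjugate k) $ i $ j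
         = (if i = j then 1 else 0) + x * v i * f j)"
    if vK: "\<And>i. v i \<in> K" and fK: "\<And>i. f i \<in> K" and v0: "\<exists>i. v i \<noteq> 0" and f0: "\<exists>i. f i \<noteq> 0"
      and fv: "(\<Sum>i\<in>UNIV. f i * v i) = 0" for v f :: "'n \<Rightarrow> 'a"
  proof -
    obtain p where p: "v p \<noteq> 0" "\<And>l. v l / v p \<in> D"
      using ratio[of UNIV v] v0 by auto
    have sum_p: "f p * v p + (\<Sum>i\<in>UNIV - {p}. f i * v i) = 0"
      using fv by (simp add: sum.remove[of UNIV p])
    \<comment> \<open>If \<open>f\<close> were supported at \<open>p\<close> alone, orthogonality to
      \<open>v\<close> and \<open>v p \<noteq> 0\<close> would make it vanish. So a dominant entry
      of \<open>f\<close> can be taken at some \<open>q \<noteq> p\<close>.\<close>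
    have "\<exists>i\<in>- {p}. f i \<noteq> 0"
    proof (rule ccontr)
      assume c: "\<not> ?thesis"
      then have "(\<Sum>i\<in>UNIV - {p}. f i * v i) = 0" by (intro sum.neutral) auto
      then have "f p = 0" using sum_p p(1) by simp
      then show False using c f0 by (metis ComplI singletonD)
    qed
    then obtain q where q: "q \<noteq> p" "f q \<noteq> 0" "\<And>l. l \<noteq> p \<Longrightarrow> f l / f q \<in> D"
      using ratio[of "- {p}" f] by auto
    define c where "c i = (if i = p then 0 else v i / v p)" for i
    \<comment> \<open>The entry at \<open>p\<close> is left out, since only the ratios
      \<open>f l / f q\<close> with \<open>l \<noteq> p\<close> are known to be bounded.\<close>
    define d where "d i = (if i = p \<or> i = q then 0 else f i / f q)" for i
    let ?L = "colmat p c" and ?R' = "rowmat q (\<lambda>i. - d i)"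
    let ?L' = "colmat p (\<lambda>i. - c i)" and ?R = "rowmat q d"
    define k where "k = ?L ** ?R'"
    have entries: "c i \<in> D0" "- d i \<in> D0" for i
      using p q unfolding c_def d_def D0_def by auto
    have "?L $ i $ j \<in> D0" for i j
      using entries(1)[of i] by (cases "j = p"; cases "i = p") (auto simp: colmat_def D0_def c_def)
    moreover have "?R' $ i $ j \<in> D0" for i j
      using entries(2)[of j] by (cases "i = q"; cases "j = q") (auto simp: rowmat_def D0_def d_def)
    moreover have L: "?L \<in> G" by (intro colmat_SL) (auto simp: c_def vK)
    moreover have R': "?R' \<in> G" by (intro rowmat_SL) (auto simp: d_def fK)
    ultimately have "k \<in> Q" unfolding Q_def k_def by force
    have LL: "?L ** ?L' = mat 1"
      by (auto simp: vec_eq_iff colmat_mult) (auto simp: colmat_def mat_def c_def)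
    have RR: "?R' ** ?R = mat 1"
      by (auto simp: vec_eq_iff mult_rowmat) (auto simp: rowmat_def mat_def d_def)
    have "k ** (?R ** ?L') = ?L ** (?R' ** ?R) ** ?L'" by (simp add: k_def matrix_mul_assoc)
    then have kinv: "k ** (?R ** ?L') = mat 1" by (simp add: RR LL)
    have detk: "det k = 1" using L R' by (simp add: k_def det_mul SL_carrier_iff)
    have adj: "adjugate k = ?R ** ?L'" by (rule adjugate_unique[OF detk kinv])
    have kp: "k $ i $ p = v i / v p" for i
      using p(1) q(1) by (auto simp: k_def mult_rowmat d_def colmat_def c_def)
    have adjq: "adjugate k $ q $ j = f j / f q" for j
    proof (cases "j = p")
      case True
      \<comment> \<open>The omitted entry is recovered from orthogonality: the remaining products
        \<open>f l * v l\<close> sum to \<open>- (f p * v p)\<close>.\<close>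
      have e: "adjugate k $ q $ p = ?R $ q $ p + (\<Sum>l\<in>UNIV. ?R $ q $ l * - c l)"
        unfolding adj by (simp add: mult_colmat)
      have "?R $ q $ l * - c l = - (f l * v l) / (f q * v p)" if "l \<noteq> p" for l
        using that q by (auto simp: rowmat_def c_def d_def)
      then have "(\<Sum>l\<in>UNIV - {p}. ?R $ q $ l * - c l) = (\<Sum>l\<in>UNIV - {p}. - (f l * v l) / (f q * v p))"
        by (intro sum.cong) auto
      also have "\<dots> = - (\<Sum>l\<in>UNIV - {p}. f l * v l) / (f q * v p)"
        by (simp add: sum_divide_distrib[symmetric] sum_negf)
      also have "\<dots> = (f p * v p) / (f q * v p)"
      proof -
        have "(\<Sum>l\<in>UNIV - {p}. f l * v l) = - (f p * v p)"
          using sum_p by (simp add: eq_neg_iff_add_eq_0 add.commute)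
        then show ?thesis by simp
      qed
      finally have "(\<Sum>l\<in>UNIV - {p}. ?R $ q $ l * - c l) = f p / f q" using p by simp
      moreover have "(\<Sum>l\<in>UNIV. ?R $ q $ l * - c l) = ?R $ q $ p * - c p + (\<Sum>l\<in>UNIV - {p}. ?R $ q $ l * - c l)"
        by (rule sum.remove) auto
      ultimately show ?thesis using True e q by (simp add: rowmat_def d_def c_def)
    next
      case False
      then show ?thesis using q
        unfolding adj by (auto simp: mult_colmat) (auto simp: rowmat_def d_def)
    qed
    have "\<forall>x i j. (k ** transvection p q (x * v p * f q) ** adjugate k) $ i $ j = (if i = j then 1 else 0) + x * v i * f j"
      using p q by (subst conj_transvection[OF adjugate_right[OF detk]]) (simp add: kp adjq)
    then show ?thesis using \<open>k \<in> Q\<close> q(1) by metis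
  qed
  ultimately show ?thesis by (rule that)
qed

text \<open>The products are the entries of \<open>g\<close> E(i, j) \<open>g\<close>^-1. For
  \<open>g\<close> near the identity, the conjugate by \<open>g\<close> of a fixed small
  transvection is small and equals the conjugate by some \<open>k\<close> in a compact set
  \<open>Q\<close> of a transvection with parameter \<open>x\<close>. Undoing the conjugation by
  \<open>k\<close> costs only a smaller neighbourhood, by uniformity over \<open>Q\<close>; hence
  \<open>x\<close>, and with it the conjugate, is bounded.\<close>

lemma conj_units_bounded:
  assumes nM: "\<forall>p q. p \<noteq> q \<longrightarrow> (\<forall>x\<in>K. transvection p q x \<in> M \<longrightarrow> x = 0)"
  shows "\<exists>W\<in>\<U>. \<exists>Z. compact Z \<and> (\<forall>g\<in>W. \<forall>i j l m. i \<noteq> j \<longrightarrow> g $ l $ i * adjugate g $ j $ m \<in> Z)"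
proof -
  obtain W B where W: "W \<in> \<U>" and B: "compact B"
    and WB': "\<forall>p q. p \<noteq> q \<longrightarrow> (\<forall>x\<in>K. transvection p q x \<in> W \<longrightarrow> x \<in> B)"
    using root_groups_bounded[OF nM] by (elim bexE exE conjE)
  note WB = WB'[rule_format]
  obtain Q where Q: "compact Q" "Q \<subseteq> G" and transv: "\<And>v f :: 'n \<Rightarrow> 'a. (\<And>i. v i \<in> K) \<Longrightarrow>
      (\<And>i. f i \<in> K) \<Longrightarrow> \<exists>i. v i \<noteq> 0 \<Longrightarrow> \<exists>i. f i \<noteq> 0 \<Longrightarrow> (\<Sum>i\<in>UNIV. f i * v i) = 0 \<Longrightarrow>
      \<exists>k\<in>Q. \<exists>p q. p \<noteq> q \<and> (\<forall>x i j. (k ** transvection p q (x * v p * f q) ** adjugate k) $ i $ j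
         = (if i = j then 1 else 0) + x * v i * f j)"
    by (rule transvection_conj_compact) blast
  have "compact (adjugate ` Q)" "adjugate ` Q \<subseteq> G"
    using Q by (auto intro!: compact_continuous_image continuous_on_adjugate continuous_on_id adjugate_SL)
  then obtain V where V: "V \<in> \<U>" "\<And>b x. b \<in> adjugate ` Q \<Longrightarrow> x \<in> V \<Longrightarrow> b ** x ** adjugate b \<in> W"
    using conj_compact[OF _ _ W] by meson
  obtain V' where V': "V' \<in> \<U>" "\<And>x y. x \<in> V' \<Longrightarrow> y \<in> V' \<Longrightarrow> x ** y ** adjugate x \<in> V"
    using base_conj_small[OF V(1)] by blast
  obtain N where N: "open N" "mat 1 \<in> N" "N \<inter> G \<subseteq> V'" using base_nhd[OF V'(1)] by blast
  \<comment> \<open>One nonzero \<open>y\<close> serves all index pairs; being fixed, it can be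
    divided out at the end without losing boundedness.\<close>
  obtain y where y: "y \<in> K" "y \<noteq> 0" "\<And>i j :: 'n. transvection i j y \<in> N"
  proof -
    have "open (\<Inter>r\<in>UNIV. (\<lambda>y. transvection (fst r) (snd r) y) -` N :: 'a set)"
      by (intro open_INT finite open_vimage N ballI continuous_on_transvection continuous_on_id)
    moreover have "0 \<in> (\<Inter>r\<in>UNIV. (\<lambda>y. transvection (fst r) (snd r) y) -` N :: 'a set)"
      using N(2) by (simp add: transvection_zero)
    ultimately obtain y where "y \<in> K" "y \<noteq> 0" "y \<in> (\<Inter>r\<in>UNIV. (\<lambda>y. transvection (fst r) (snd r) y) -` N)"
      using nondiscrete by blast
    then show ?thesis by (intro that[of y]) (auto dest: spec[of _ "(_, _)"])
  qed
  define Zf :: "'n \<times> 'n \<times> 'n \<times> 'n \<Rightarrow> 'a set" where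
    "Zf = (\<lambda>(p, q, l, m). (\<lambda>r. ((fst r ** transvection p q (snd r) ** adjugate (fst r)) $ l $ m
       - (if l = m then 1 else 0)) * inverse y) ` (Q \<times> B))"
  have "compact (Zf r)" for r
  proof -
    have "compact ((\<lambda>r. ((fst r ** transvection p q (snd r) ** adjugate (fst r)) $ l $ m
       + (- (if l = m then 1 else 0))) * inverse y) ` (Q \<times> B))" for p q l m
      by (intro compact_continuous_image compact_Times Q B continuous_on_mult' continuous_on_add
          continuous_on_component continuous_on_matrix_mult continuous_on_transvection continuous_on_adjugate
          continuous_on_fst continuous_on_snd continuous_on_id continuous_on_const)
    then show ?thesis unfolding Zf_def by (cases r) (simp only: prod.case diff_conv_add_uminus)
  qed
  then have Z: "compact (\<Union>r\<in>UNIV. Zf r)" by (intro compact_UN) auto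
  have "g $ l $ i * adjugate g $ j $ m \<in> (\<Union>r\<in>UNIV. Zf r)"
    if g: "g \<in> V'" and ij: "i \<noteq> j" for g i j l m
  proof -
    have gG: "g \<in> G" using g V' base_subset by blast
    have dg: "det g = 1" using gG by (rule det_G)
    have gK: "g $ r $ s \<in> K" "adjugate g $ r $ s \<in> K" for r s
      using gG adjugate_SL[OF gG] by (auto simp: SL_carrier_iff)
    have orth: "(\<Sum>r\<in>UNIV. adjugate g $ j $ r * g $ r $ i) = 0"
    proof -
      have "(adjugate g ** g) $ j $ i = 0" using ij by (simp add: adjugate_left dg mat_def)
      then show ?thesis by (simp add: matrix_matrix_mult_def)
    qed
    have n1: "\<exists>r. g $ r $ i \<noteq> 0"
    proof (rule ccontr)
      assume "\<not> ?thesis"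
      then have "(adjugate g ** g) $ i $ i = 0" by (simp add: matrix_matrix_mult_def)
      then show False by (simp add: adjugate_left dg mat_def)
    qed
    have n2: "\<exists>r. adjugate g $ j $ r \<noteq> 0"
    proof (rule ccontr)
      assume "\<not> ?thesis"
      then have "(adjugate g ** g) $ j $ j = 0" by (simp add: matrix_matrix_mult_def)
      then show False by (simp add: adjugate_left dg mat_def)
    qed
    obtain k p q where k: "k \<in> Q" "p \<noteq> q" and kpq: "\<And>x r s.
        (k ** transvection p q (x * g $ p $ i * adjugate g $ j $ q) ** adjugate k) $ r $ s
         = (if r = s then 1 else 0) + x * g $ r $ i * adjugate g $ j $ s"
      using transv[of "\<lambda>r. g $ r $ i" "\<lambda>r. adjugate g $ j $ r", OF gK n1 n2 orth] by blast
    define x where "x = y * g $ p $ i * adjugate g $ j $ q"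
    have xK: "x \<in> K" using y gK by (auto simp: x_def)
    have same: "g ** transvection i j y ** adjugate g = k ** transvection p q x ** adjugate k"
      unfolding vec_eq_iff x_def kpq conj_transvection[OF adjugate_right[OF dg]] by (simp add: mult_ac)
    have kG: "k \<in> G" using k Q by blast
    have "transvection i j y \<in> V'" using N y transvection_SL[OF ij, of y] by blast
    then have "g ** transvection i j y ** adjugate g \<in> V" using V' g by blast
    then have "adjugate k ** (k ** transvection p q x ** adjugate k) ** adjugate (adjugate k) \<in> W"
      using V(2) k(1) by (simp add: same)
    also have "adjugate k ** (k ** transvection p q x ** adjugate k) ** adjugate (adjugate k)
        = (adjugate k ** k) ** transvection p q x ** (adjugate k ** k)"
      using kG by (simp add: matrix_mul_assoc adjugate_adjugate det_G)
    finally have "transvection p q x \<in> W" using kG by (simp add: adjugate_left det_G)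
    then have "x \<in> B" using WB k(2) xK by blast
    have "g $ l $ i * adjugate g $ j $ m
        = ((k ** transvection p q x ** adjugate k) $ l $ m - (if l = m then 1 else 0)) * inverse y"
      using y(2) by (simp add: x_def kpq)
    then have "g $ l $ i * adjugate g $ j $ m \<in> Zf (p, q, l, m)"
      unfolding Zf_def using k(1) \<open>x \<in> B\<close> by force
    then show ?thesis by blast
  qed
  then show ?thesis
    by (intro bexI[OF _ V'(1)] exI[of _ "\<Union>r\<in>UNIV. Zf r"] conjI ballI allI impI Z)
qed

text \<open>For an entry \<open>x\<close> of \<open>g\<close>, the matrix \<open>x g\<^sup>-\<^sup>1\<close> is bounded and has determinant \<open>x\<^sup>n\<close>.\<close>

lemma base_bounded:
  assumes nM: "\<forall>p q. p \<noteq> q \<longrightarrow> (\<forall>x\<in>K. transvection p q x \<in> M \<longrightarrow> x = 0)"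
  shows "\<exists>W\<in>\<U>. \<exists>Z. compact Z \<and> (\<forall>g\<in>W. \<forall>i j. g $ i $ j \<in> Z)"
proof -
  obtain W Z where W: "W \<in> \<U>" and Z: "compact Z"
    and WZ': "\<forall>g\<in>W. \<forall>i j l m. i \<noteq> j \<longrightarrow> g $ l $ i * adjugate g $ j $ m \<in> Z"
    using conj_units_bounded[OF nM] by (elim bexE exE conjE)
  note WZ = WZ'[rule_format]
  let ?Box = "\<lambda>Z. {A::'a^'n^'n. \<forall>i j. A $ i $ j \<in> Z}"
  define Zf where "Zf = (\<lambda>r :: 'n \<times> 'n. (\<lambda>r'. (fst r' ** snd r') $ fst r $ snd r) ` (?Box Z \<times> ?Box Z))"
  have "compact (Zf r)" for r
    unfolding Zf_def
    by (intro compact_continuous_image compact_Times compact_matrix_box Z continuous_on_matrix_mult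
        continuous_on_component continuous_on_fst continuous_on_snd continuous_on_id)
  then have Z3: "compact (Z \<union> (\<Union>r\<in>UNIV. Zf r))" by (intro compact_UN compact_Un Z) auto
  let ?Z3 = "Z \<union> (\<Union>r\<in>UNIV. Zf r)"
  have all: "g $ l $ i * adjugate g $ j $ m \<in> ?Z3" if g: "g \<in> W" for g i j l m
  proof (cases "i = j")
    case False
    then show ?thesis using WZ[OF g False] by blast
  next
    case True
    obtain k where k: "k \<noteq> i" using two_indices by metis
    have dg: "det g = 1" using g W base_subset det_G by blast
    \<comment> \<open>With E the matrix units, \<open>X1\<close> is \<open>g\<close> E(i, k)
      \<open>g\<close>^-1 and \<open>X2\<close> is \<open>g\<close> E(k, i) \<open>g\<close>^-1.
      Their product is \<open>g\<close> E(i, i) \<open>g\<close>^-1, which bounds the diagonal units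
      through the off-diagonal ones.\<close>
    define X1 :: "'a^'n^'n" where "X1 = (\<chi> r s. g $ r $ i * adjugate g $ k $ s)"
    define X2 :: "'a^'n^'n" where "X2 = (\<chi> r s. g $ r $ k * adjugate g $ i $ s)"
    have "X1 \<in> ?Box Z" "X2 \<in> ?Box Z" using WZ[OF g] k by (auto simp: X1_def X2_def)
    moreover have "(X1 ** X2) $ l $ m = g $ l $ i * adjugate g $ i $ m"
    proof -
      have "(adjugate g ** g) $ k $ k = 1" by (simp add: adjugate_left dg mat_def)
      then have 1: "(\<Sum>r\<in>UNIV. adjugate g $ k $ r * g $ r $ k) = 1" by (simp add: matrix_matrix_mult_def)
      have "(X1 ** X2) $ l $ m = (\<Sum>r\<in>UNIV. (g $ l $ i * adjugate g $ i $ m) * (adjugate g $ k $ r * g $ r $ k))"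
        by (simp add: matrix_matrix_mult_def X1_def X2_def mult_ac)
      also have "\<dots> = g $ l $ i * adjugate g $ i $ m" by (simp only: sum_distrib_left[symmetric] 1) simp
      finally show ?thesis .
    qed
    ultimately have "g $ l $ i * adjugate g $ i $ m \<in> Zf (l, m)"
      unfolding Zf_def by (intro image_eqI[of _ _ "(X1, X2)"]) auto
    then show ?thesis using True by blast
  qed
  have Z4: "compact (det ` ?Box ?Z3)"
    by (intro compact_continuous_image continuous_on_det_field continuous_on_id compact_matrix_box Z3)
  obtain b :: 'a and C V\<^sub>0 where "contraction b C V\<^sub>0" by (rule ambient_contraction)
  then interpret contraction b C V\<^sub>0 .
  obtain Z5 where Z5: "compact Z5" "\<And>x. x ^ CARD('n) \<in> det ` ?Box ?Z3 \<Longrightarrow> x \<in> Z5"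
    using bounded_root[OF Z4, of "CARD('n)"] by auto
  have "g $ l $ i \<in> Z5" if g: "g \<in> W" for g l i
  proof (rule Z5(2))
    let ?x = "g $ l $ i"
    have dg: "det g = 1" using g W base_subset det_G by blast
    have "det (mat ?x ** adjugate g) = ?x ^ CARD('n)"
      by (simp add: det_mul det_adjugate[OF dg] det_diagonal mat_def)
    moreover have "mat ?x ** adjugate g \<in> ?Box ?Z3" using all[OF g] by (simp add: mat_mult_nth)
    ultimately show "?x ^ CARD('n) \<in> det ` ?Box ?Z3" by (intro image_eqI[of _ _ "mat ?x ** adjugate g"]) simp_all
  qed
  then show ?thesis by (intro bexI[OF _ W] exI[of _ Z5] conjI ballI allI Z5(1))
qed

text \<open>\<open>M\<close> is normal and bounded. Conjugating \<open>m\<close> by the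
  transvections with parameters \<open>inverse b ^ n\<close> gives entries polynomial in an
  unbounded parameter, whose nonconstant coefficients must therefore vanish.\<close>

lemma M_scalar:
  assumes nM: "\<forall>p q. p \<noteq> q \<longrightarrow> (\<forall>x\<in>K. transvection p q x \<in> M \<longrightarrow> x = 0)" and m: "m \<in> M"
  shows "\<exists>c. m = mat c"
proof -
  obtain W Z where W: "W \<in> \<U>" and Z: "compact Z" and WZ': "\<forall>g\<in>W. \<forall>i j. g $ i $ j \<in> Z"
    using base_bounded[OF nM] by (elim bexE exE conjE)
  note WZ = WZ'[rule_format]
  obtain b C V\<^sub>0 where bK: "b \<in> K" and "contraction b C V\<^sub>0"
    using ex_contraction[of K] nondiscrete by metis
  then interpret contraction b C V\<^sub>0 by simp
  have bd: "(transvection p q x ** m ** transvection p q (- x)) $ i $ j \<in> Z" if pq: "p \<noteq> q" and x: "x \<in> K" for p q x i j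
  proof -
    have "transvection p q x ** m ** adjugate (transvection p q x) \<in> M" by (intro M_conj m transvection_SL pq x)
    then show ?thesis using M_subset[OF W] WZ pq by (auto simp: adjugate_transvection)
  qed
  have bK': "inverse b ^ n \<in> K" for n using bK by auto
  have off: "m $ q $ p = 0" if pq: "p \<noteq> q" for p q
  proof (rule bounded_linear_imp_constant[OF Z])
    fix n show "m $ p $ p + inverse b ^ n * m $ q $ p \<in> Z"
      using bd[OF pq bK'[of n], of p p] pq by (simp add: transvection_mult mult_transvection)
  qed
  have on: "m $ q $ q = m $ p $ p" if pq: "p \<noteq> q" for p q
  proof -
    have "m $ q $ q - m $ p $ p = 0"
    proof (rule bounded_linear_imp_constant[OF Z])
      \<comment> \<open>The entry at (p, q) also has a quadratic term, with coefficient the entry of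
        \<open>m\<close> at (q, p); it vanishes by \<open>off\<close>, as does the constant
        term.\<close>
      fix n show "0 + inverse b ^ n * (m $ q $ q - m $ p $ p) \<in> Z"
        using bd[OF pq bK'[of n], of p q] pq off[OF pq] off[of q p]
        by (simp add: transvection_mult mult_transvection algebra_simps)
    qed
    then show ?thesis by simp
  qed
  have "m = mat (m $ undefined $ undefined)"
    using off on by (auto simp: vec_eq_iff mat_def) metis
  then show ?thesis by blast
qed

text \<open>The bounded part of the group outside the open set \<open>Y\<close>, the union of the
  translates of \<open>N\<close> by elements of \<open>M\<close>, is compact and misses
  \<open>M\<close>. A member of the base avoids it and so lies in \<open>Y\<close> once it is also
  bounded.\<close>

lemma base_fine:
  assumes nM: "\<forall>p q. p \<noteq> q \<longrightarrow> (\<forall>x\<in>K. transvection p q x \<in> M \<longrightarrow> x = 0)"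
    and N: "open N" "mat 1 \<in> N"
  shows "\<exists>U\<in>\<U>. \<forall>u\<in>U. \<exists>m\<in>M. adjugate m ** u \<in> N"
proof -
  obtain W Z where W: "W \<in> \<U>" and Z: "compact Z" and WZ': "\<forall>g\<in>W. \<forall>i j. g $ i $ j \<in> Z"
    using base_bounded[OF nM] by (elim bexE exE conjE)
  note WZ = WZ'[rule_format]
  define Y where "Y = (\<Union>m\<in>M. (\<lambda>g. adjugate m ** g) -` N)"
  have "open Y" unfolding Y_def
    by (intro open_UN ballI open_vimage N continuous_on_matrix_mult continuous_on_const continuous_on_id)
  then have "compact ({A \<in> G. \<forall>i j. A $ i $ j \<in> Z} - Y)"
    by (intro compact_diff compact_SL_box Z)
  moreover have "({A \<in> G. \<forall>i j. A $ i $ j \<in> Z} - Y) \<inter> M = {}"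
  proof -
    have "g \<in> Y" if g: "g \<in> M" for g
      using g N M_G unfolding Y_def by (intro UN_I[of g]) (auto simp: adjugate_left det_G)
    then show ?thesis by blast
  qed
  ultimately obtain U where U: "U \<in> \<U>" "U \<inter> ({A \<in> G. \<forall>i j. A $ i $ j \<in> Z} - Y) = {}"
    using separate_compact by meson
  obtain U' where U': "U' \<in> \<U>" "U' \<subseteq> U \<inter> W" using base_directed[OF U(1) W] by blast
  have "\<exists>m\<in>M. adjugate m ** u \<in> N" if u: "u \<in> U'" for u
  proof -
    have "u \<in> {A \<in> G. \<forall>i j. A $ i $ j \<in> Z}" using u U' WZ base_subset[OF U'(1)] by auto
    then have "u \<in> Y" using u U' U(2) by blast
    then show ?thesis unfolding Y_def by simp
  qed
  then show ?thesis using U'(1) by blast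
qed

section \<open>The case of a transvection in \<open>M\<close>: Weyl elements and commutators\<close>

definition weyl :: "'n \<Rightarrow> 'n \<Rightarrow> 'a \<Rightarrow> 'a^'n^'n" where
  "weyl p q s = transvection p q s ** transvection q p (- inverse s) ** transvection p q s"

text \<open>\<open>weyl p q s\<close> is monomial, exchanging \<open>p\<close> and \<open>q\<close>
  with entries \<open>s\<close> and \<open>- inverse s\<close>, so it swaps the two opposite root
  groups. The identity is checked as an intertwining relation, which needs no explicit
  inverse.\<close>

lemma weyl_conj:
  assumes pq: "p \<noteq> q" and s: "s \<noteq> 0"
  shows "weyl p q s ** transvection p q x ** adjugate (weyl p q s) = transvection q p (- (x * inverse s ^ 2))"
proof -
  have d: "det (weyl p q s) = 1" using pq by (simp add: weyl_def det_mul det_transvection)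
  have w: "weyl p q s $ i $ j = (if i = p then (if j = q then s else 0)
      else if i = q then (if j = p then - inverse s else 0) else if i = j then 1 else 0)" for i j
    using pq s by (simp add: weyl_def mult_transvection) (auto simp: transvection_def)
  have "weyl p q s ** transvection p q x = transvection q p (- (x * inverse s ^ 2)) ** weyl p q s"
    using pq s by (auto simp: vec_eq_iff transvection_mult mult_transvection w power2_eq_square)
  then show ?thesis
    using adjugate_right[OF d] by (simp add: matrix_mul_assoc[symmetric])
qed

lemma weyl_G: "p \<noteq> q \<Longrightarrow> s \<in> K \<Longrightarrow> weyl p q s \<in> G"
  unfolding weyl_def by (intro mult_SL transvection_SL) auto

lemma M_transvection_imp_root_group:
  assumes pq: "p \<noteq> q" and x: "x \<in> K" "x \<noteq> 0" "transvection p q x \<in> M" and y: "y \<in> K"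
  shows "transvection q p y \<in> M"
proof -
  have sq: "transvection p q (s ^ 2 * z) \<in> M" if "transvection p q z \<in> M" "s \<in> K" "s \<noteq> 0" for s z
    using M_conj[OF that(1) torus_SL[OF pq that(2,3)]] by (simp add: torus_conj_transvection pq that)
  \<comment> \<open>The torus at \<open>inverse x\<close> turns the parameter \<open>x\<close> into
    \<open>inverse x\<close>, and the Weyl element at 1 moves it to the opposite root group with a
    sign. These are the factors of \<open>weyl p q x\<close>, which therefore lies in
    \<open>M\<close>.\<close>
  have "inverse x ^ 2 * x = inverse x" using x by (simp add: power2_eq_square)
  then have "transvection p q (inverse x) \<in> M" using sq[OF x(3), of "inverse x"] x by auto
  then have "weyl p q 1 ** transvection p q (inverse x) ** adjugate (weyl p q 1) \<in> M"
    by (intro M_conj weyl_G pq) auto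
  then have "transvection q p (- inverse x) \<in> M" by (simp add: weyl_conj pq)
  then have wM: "weyl p q x \<in> M" unfolding weyl_def by (intro M_mult x)
  text \<open>Hence modulo \<open>M\<close> conjugation by \<open>weyl p q x\<close> is trivial, which identifies the two opposite
    root groups; comparing this identification before and after conjugation by the torus shows that
    they are trivial modulo \<open>M\<close>.\<close>
  have id: "transvection q p (- (z * inverse x ^ 2)) ** transvection p q (- z) \<in> M" if z: "z \<in> K" for z
  proof -
    let ?e = "transvection p q z" and ?w = "weyl p q x"
    \<comment> \<open>The commutator of \<open>?w\<close> and \<open>?e\<close>, in \<open>M\<close>
      because \<open>?w\<close> is in \<open>M\<close> and \<open>M\<close> is normal.\<close>
    have "?w ** (?e ** adjugate ?w ** adjugate ?e) \<in> M"
      by (intro M_mult wM M_conj M_adjugate transvection_SL pq z)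
    then show ?thesis
      using weyl_conj[OF pq x(2), of z] pq by (simp add: matrix_mul_assoc adjugate_transvection)
  qed
  \<comment> \<open>\<open>t ^ 4 \<noteq> 1\<close> says that \<open>inverse t ^ 2\<close> and
    \<open>t ^ 2\<close> differ; these are the factors by which the torus scales the two opposite
    root groups.\<close>
  obtain t where t: "t \<in> K" "t \<noteq> 0" "t ^ 4 \<noteq> 1"
  proof -
    obtain b C V\<^sub>0 where bK: "b \<in> K" and "contraction b C V\<^sub>0"
      using ex_contraction[of K] nondiscrete by metis
    then interpret contraction b C V\<^sub>0 by simp
    obtain m where "\<forall>n\<ge>m. b ^ n * 1 \<noteq> 1" using not_infinitely_divisible[of 1 "{1}"] by auto
    then have "b ^ (4 * m) \<noteq> 1" by simp
    then have "b ^ 4 \<noteq> 1" by (metis power_mult power_one)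
    then show ?thesis using bK b_nonzero that by blast
  qed
  let ?c = "inverse x ^ 2 * (inverse t ^ 2 - t ^ 2)"
  have "?c \<noteq> 0"
  proof
    assume "?c = 0"
    then have "inverse t ^ 2 = t ^ 2" using x by simp
    then have "inverse t ^ 2 * t ^ 2 = t ^ 2 * t ^ 2" by simp
    moreover have "inverse t ^ 2 * t ^ 2 = 1" using t by (simp add: power_mult_distrib[symmetric])
    ultimately show False using t(3) by (simp add: power_add[symmetric])
  qed
  \<comment> \<open>Chosen so that the parameter \<open>- (z * ?c)\<close> left after the comparison
    is the prescribed \<open>y\<close>.\<close>
  define z where "z = - y / ?c"
  have zK: "z \<in> K" using y x t by (auto simp: z_def)
  let ?T = "torus p q t"
  have T: "?T \<in> G" "det ?T = 1" using torus_SL[OF pq t(1,2)] by (auto simp: det_G)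
  have Tinv: "torus p q t = torus q p (inverse t)"
    using pq by (auto simp: torus_def vec_eq_iff)
  have qp: "q \<noteq> p" "inverse t \<noteq> 0" using pq t by auto
  have "?T ** (transvection q p (- (z * inverse x ^ 2)) ** transvection p q (- z)) ** adjugate ?T \<in> M"
    by (intro M_conj id zK T)
  also have "?T ** (transvection q p (- (z * inverse x ^ 2)) ** transvection p q (- z)) ** adjugate ?T
      = (?T ** transvection q p (- (z * inverse x ^ 2)) ** adjugate ?T) ** (?T ** transvection p q (- z) ** adjugate ?T)"
  proof -
    have "?T ** A ** adjugate ?T ** (?T ** B ** adjugate ?T) = ?T ** A ** (adjugate ?T ** ?T) ** B ** adjugate ?T" for A B
      by (simp add: matrix_mul_assoc)
    then show ?thesis using T(2) by (simp add: adjugate_left matrix_mul_assoc)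
  qed
  also have "?T ** transvection p q (- z) ** adjugate ?T = transvection p q (- (t ^ 2 * z))"
    using torus_conj_transvection[OF t(2) pq, of "- z"] by simp
  also have "?T ** transvection q p (- (z * inverse x ^ 2)) ** adjugate ?T = transvection q p (- (inverse t ^ 2 * (z * inverse x ^ 2)))"
    unfolding Tinv using torus_conj_transvection[OF qp(2,1), of "- (z * inverse x ^ 2)"] by simp
  finally have 1: "transvection q p (- (inverse t ^ 2 * (z * inverse x ^ 2))) ** transvection p q (- (t ^ 2 * z)) \<in> M" .
  have 2: "transvection q p (- (t ^ 2 * z * inverse x ^ 2)) ** transvection p q (- (t ^ 2 * z)) \<in> M"
    using t zK by (intro id) auto
  have cancel: "A ** B ** adjugate (A' ** B) = A ** adjugate A'" if "det A' = 1" "det B = 1" for A A' B :: "'a^'n^'n"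
  proof -
    have "A ** B ** adjugate (A' ** B) = A ** (B ** adjugate B) ** adjugate A'"
      using that by (simp add: adjugate_mult matrix_mul_assoc)
    then show ?thesis using that by (simp add: adjugate_right)
  qed
  have "transvection q p (- (inverse t ^ 2 * (z * inverse x ^ 2))) ** adjugate (transvection q p (- (t ^ 2 * z * inverse x ^ 2))) \<in> M"
    using M_div[OF 1 2] pq qp by (simp add: cancel det_transvection)
  then have "transvection q p (- (z * ?c)) \<in> M"
    using qp by (simp add: adjugate_transvection transvection_add algebra_simps)
  then show ?thesis using \<open>?c \<noteq> 0\<close> by (simp add: z_def)
qed

text \<open>The preceding lemma turns one transvection into the whole opposite root group and swaps
  the indices of any full root group in \<open>M\<close>; commutators change the second index.
  Together these moves reach all pairs.\<close>

lemma M_transvection_imp_full: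
  assumes "p \<noteq> q" "x \<in> K" "x \<noteq> 0" "transvection p q x \<in> M"
  shows "M = G"
proof -
  define P where "P p q \<longleftrightarrow> p \<noteq> q \<and> (\<forall>x\<in>K. transvection p q x \<in> M)" for p q :: 'n
  have sym: "P q p" if "P p q" for p q
    using that M_transvection_imp_root_group[of p q 1] unfolding P_def by auto
  have col: "P p r" if pq: "P p q" and r: "r \<noteq> p" for p q r
  proof (cases "r = q")
    case False
    have "transvection p r x \<in> M" if x: "x \<in> K" for x
    proof -
      \<comment> \<open>The Steinberg commutator relation: the (p, q) and (q, r) root groups produce
        the (p, r) root group.\<close>
      have "transvection p q x ** (transvection q r 1 ** transvection p q (- x) ** adjugate (transvection q r 1)) \<in> M"
        using pq x False unfolding P_def by (intro M_mult M_conj transvection_SL) auto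
      also have "transvection p q x ** (transvection q r 1 ** transvection p q (- x) ** adjugate (transvection q r 1)) = transvection p r x"
        using pq r False unfolding P_def
        by (auto simp: vec_eq_iff adjugate_transvection mult_transvection transvection_mult) (auto simp: transvection_def)
      finally show ?thesis .
    qed
    then show ?thesis using r unfolding P_def by auto
  qed (use pq in simp)
  have Pqp: "P q p" unfolding P_def using M_transvection_imp_root_group[OF assms] assms(1) by auto
  have all: "P r s" if rs: "r \<noteq> s" for r s
  proof (cases "s = q")
    case True
    then have "P s r" using col[OF Pqp] rs by blast
    then show ?thesis by (rule sym)
  next
    case False
    then have "P s q" using col[OF Pqp, of s] sym by blast
    then have "P s r" using col rs by blast
    then show ?thesis by (rule sym)
  qed
  have "G \<subseteq> M" by (rule SL_generated) (use all in \<open>auto simp: P_def M_one M_mult\<close>)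
  then show ?thesis using M_G by blast
qed

lemma base_dichotomy:
  assumes "M \<noteq> G"
  shows "M \<subseteq> center (SL K)"
    and "open N \<Longrightarrow> mat 1 \<in> N \<Longrightarrow> \<exists>U\<in>\<U>. \<forall>u\<in>U. \<exists>m\<in>M. adjugate m ** u \<in> N"
proof -
  have nM: "\<forall>p q. p \<noteq> q \<longrightarrow> (\<forall>x\<in>K. transvection p q x \<in> M \<longrightarrow> x = 0)"
    using M_transvection_imp_full assms by blast
  show "M \<subseteq> center (SL K)"
  proof
    fix m assume m: "m \<in> M"
    then obtain c where "m = mat c" using M_scalar[OF nM] by blast
    then show "m \<in> center (SL K)" using m M_G by (auto simp: center_SL mat_SL_iff)
  qed
  show "open N \<Longrightarrow> mat 1 \<in> N \<Longrightarrow> \<exists>U\<in>\<U>. \<forall>u\<in>U. \<exists>m\<in>M. adjugate m ** u \<in> N"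
    using base_fine[OF nM] by blast
qed

end

section \<open>Hausdorff group topologies and quotients\<close>

text \<open>Pointwise neighbourhood conditions suit the later constructions, where basic open sets
  are produced by hand. The equivalences for the operations use the group law and the right
  underlying set, hence the final case split.\<close>

lemma hausdorff_group_topology_alt:
  "hausdorff_group_topology G T \<longleftrightarrow>
     group G \<and> topspace T = carrier G \<and> Hausdorff_space T \<and>
     (\<forall>W a b. openin T W \<and> a \<in> carrier G \<and> b \<in> carrier G \<and> a \<otimes>\<^bsub>G\<^esub> b \<in> W \<longrightarrow>
        (\<exists>U V. openin T U \<and> openin T V \<and> a \<in> U \<and> b \<in> V \<and> (\<forall>x\<in>U. \<forall>y\<in>V. x \<otimes>\<^bsub>G\<^esub> y \<in> W))) \<and>
     (\<forall>W a. openin T W \<and> a \<in> carrier G \<and> inv\<^bsub>G\<^esub> a \<in> W \<longrightarrow>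
        (\<exists>U. openin T U \<and> a \<in> U \<and> (\<forall>x\<in>U. inv\<^bsub>G\<^esub> x \<in> W)))"
  (is "_ \<longleftrightarrow> ?g \<and> ?t \<and> ?h \<and> ?m \<and> ?i")
proof -
  have m_iff: "continuous_map (prod_topology T T) T (\<lambda>(x, y). x \<otimes>\<^bsub>G\<^esub> y) \<longleftrightarrow> ?m"
    if "group G" "topspace T = carrier G"
  proof
    assume c: "continuous_map (prod_topology T T) T (\<lambda>(x, y). x \<otimes>\<^bsub>G\<^esub> y)"
    show ?m
    proof (intro allI impI; elim conjE)
      fix W a b assume W: "openin T W" and ab: "a \<in> carrier G" "b \<in> carrier G" "a \<otimes>\<^bsub>G\<^esub> b \<in> W"
      have "openin (prod_topology T T) {p \<in> topspace (prod_topology T T). (case p of (x, y) \<Rightarrow> x \<otimes>\<^bsub>G\<^esub> y) \<in> W}"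
        using c W by (rule openin_continuous_map_preimage)
      moreover have "(a, b) \<in> {p \<in> topspace (prod_topology T T). (case p of (x, y) \<Rightarrow> x \<otimes>\<^bsub>G\<^esub> y) \<in> W}"
        using ab that by simp
      ultimately have "\<exists>U V. openin T U \<and> openin T V \<and> a \<in> U \<and> b \<in> V \<and>
          U \<times> V \<subseteq> {p \<in> topspace (prod_topology T T). (case p of (x, y) \<Rightarrow> x \<otimes>\<^bsub>G\<^esub> y) \<in> W}"
        by (rule openin_prod_topology_alt[THEN iffD1, THEN spec, THEN spec, THEN mp])
      then obtain U V where "openin T U" "openin T V" "a \<in> U" "b \<in> V"
          "U \<times> V \<subseteq> {p \<in> topspace (prod_topology T T). (case p of (x, y) \<Rightarrow> x \<otimes>\<^bsub>G\<^esub> y) \<in> W}"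
        by (elim exE conjE)
      then show "\<exists>U V. openin T U \<and> openin T V \<and> a \<in> U \<and> b \<in> V \<and> (\<forall>x\<in>U. \<forall>y\<in>V. x \<otimes>\<^bsub>G\<^esub> y \<in> W)"
        by (intro exI[of _ U] exI[of _ V]) auto
    qed
  next
    assume m: ?m
    show "continuous_map (prod_topology T T) T (\<lambda>(x, y). x \<otimes>\<^bsub>G\<^esub> y)"
      unfolding continuous_map_def
    proof (intro conjI allI impI)
      show "(\<lambda>(x, y). x \<otimes>\<^bsub>G\<^esub> y) \<in> topspace (prod_topology T T) \<rightarrow> topspace T"
        using monoid.m_closed[OF group.is_monoid[OF that(1)]] by (simp add: that(2) Pi_iff split_beta)
      fix W assume W: "openin T W"
      show "openin (prod_topology T T) {p \<in> topspace (prod_topology T T). (case p of (x, y) \<Rightarrow> x \<otimes>\<^bsub>G\<^esub> y) \<in> W}"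
        unfolding openin_prod_topology_alt
      proof (intro allI impI)
        fix a b assume "(a, b) \<in> {p \<in> topspace (prod_topology T T). (case p of (x, y) \<Rightarrow> x \<otimes>\<^bsub>G\<^esub> y) \<in> W}"
        then have "a \<in> carrier G" "b \<in> carrier G" "a \<otimes>\<^bsub>G\<^esub> b \<in> W" using that by auto
        then obtain U V where UV: "openin T U" "openin T V" "a \<in> U" "b \<in> V" "\<forall>x\<in>U. \<forall>y\<in>V. x \<otimes>\<^bsub>G\<^esub> y \<in> W"
          using m[rule_format, of W a b] W by auto
        moreover have "U \<times> V \<subseteq> {p \<in> topspace (prod_topology T T). (case p of (x, y) \<Rightarrow> x \<otimes>\<^bsub>G\<^esub> y) \<in> W}"
          using UV(5) openin_subset[OF UV(1)] openin_subset[OF UV(2)] by auto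
        ultimately show "\<exists>U V. openin T U \<and> openin T V \<and> a \<in> U \<and> b \<in> V \<and>
            U \<times> V \<subseteq> {p \<in> topspace (prod_topology T T). (case p of (x, y) \<Rightarrow> x \<otimes>\<^bsub>G\<^esub> y) \<in> W}"
          by blast
      qed
    qed
  qed
  have i_iff: "continuous_map T T (\<lambda>x. inv\<^bsub>G\<^esub> x) \<longleftrightarrow> ?i"
    if "group G" "topspace T = carrier G"
  proof -
    have "(\<lambda>x. inv\<^bsub>G\<^esub> x) \<in> topspace T \<rightarrow> topspace T" using group.inv_closed[OF that(1)] by (simp add: that(2) Pi_iff)
    then have "continuous_map T T (\<lambda>x. inv\<^bsub>G\<^esub> x)
        \<longleftrightarrow> (\<forall>W. openin T W \<longrightarrow> openin T {x \<in> carrier G. inv\<^bsub>G\<^esub> x \<in> W})"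
      using that by (simp add: continuous_map_def)
    also have "\<dots> \<longleftrightarrow> ?i"
    proof
      assume *: "\<forall>W. openin T W \<longrightarrow> openin T {x \<in> carrier G. inv\<^bsub>G\<^esub> x \<in> W}"
      show ?i
      proof (intro allI impI; elim conjE)
        fix W a assume "openin T W" "a \<in> carrier G" "inv\<^bsub>G\<^esub> a \<in> W"
        then show "\<exists>U. openin T U \<and> a \<in> U \<and> (\<forall>x\<in>U. inv\<^bsub>G\<^esub> x \<in> W)"
          using * by (intro exI[of _ "{x \<in> carrier G. inv\<^bsub>G\<^esub> x \<in> W}"]) auto
      qed
    next
      assume i: ?i
      show "\<forall>W. openin T W \<longrightarrow> openin T {x \<in> carrier G. inv\<^bsub>G\<^esub> x \<in> W}"
      proof (intro allI impI)
        fix W assume W: "openin T W"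
        show "openin T {x \<in> carrier G. inv\<^bsub>G\<^esub> x \<in> W}"
        proof (subst openin_subopen, intro ballI)
          fix a assume "a \<in> {x \<in> carrier G. inv\<^bsub>G\<^esub> x \<in> W}"
          then obtain U where U: "openin T U" "a \<in> U" "\<forall>x\<in>U. inv\<^bsub>G\<^esub> x \<in> W"
            using i[rule_format, of W a] W by auto
          then have "U \<subseteq> {x \<in> carrier G. inv\<^bsub>G\<^esub> x \<in> W}" using openin_subset[OF U(1)] that by auto
          then show "\<exists>T'. openin T T' \<and> a \<in> T' \<and> T' \<subseteq> {x \<in> carrier G. inv\<^bsub>G\<^esub> x \<in> W}"
            using U by blast
        qed
      qed
    qed
    finally show ?thesis .
  qed
  show ?thesis
  proof (cases "group G \<and> topspace T = carrier G")
    case True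
    show ?thesis
      unfolding hausdorff_group_topology_def m_iff[OF conjunct1[OF True] conjunct2[OF True]]
        i_iff[OF conjunct1[OF True] conjunct2[OF True]] by (rule refl)
  next
    case False
    show ?thesis
      unfolding hausdorff_group_topology_def
      by (rule iffI; elim conjE; rule notE[OF False]; intro conjI; assumption)
  qed
qed

locale hausdorff_group = group G for G (structure) +
  fixes T
  assumes hgt: "hausdorff_group_topology G T"
begin

lemma topspace_T: "topspace T = carrier G"
  using hgt by (simp add: hausdorff_group_topology_alt)

lemma Hausdorff_T: "Hausdorff_space T"
  using hgt by (simp add: hausdorff_group_topology_alt)

lemma open_subset: "openin T W \<Longrightarrow> W \<subseteq> carrier G"
  using openin_subset topspace_T by metis

lemma mult_nhd:
  assumes "openin T W" "a \<in> carrier G" "b \<in> carrier G" "a \<otimes> b \<in> W"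
  shows "\<exists>U V. openin T U \<and> openin T V \<and> a \<in> U \<and> b \<in> V \<and> (\<forall>x\<in>U. \<forall>y\<in>V. x \<otimes> y \<in> W)"
  using hgt[unfolded hausdorff_group_topology_alt, THEN conjunct2, THEN conjunct2, THEN conjunct2, THEN conjunct1] assms by auto

lemma inv_nhd:
  assumes "openin T W" "a \<in> carrier G" "inv a \<in> W"
  shows "\<exists>U. openin T U \<and> a \<in> U \<and> (\<forall>x\<in>U. inv x \<in> W)"
  using hgt[unfolded hausdorff_group_topology_alt, THEN conjunct2, THEN conjunct2, THEN conjunct2, THEN conjunct2] assms by auto

lemma div_nhd:
  assumes W: "openin T W" "a \<in> carrier G" "b \<in> carrier G" "a \<otimes> inv b \<in> W"
  shows "\<exists>U V. openin T U \<and> openin T V \<and> a \<in> U \<and> b \<in> V \<and> (\<forall>x\<in>U. \<forall>y\<in>V. x \<otimes> inv y \<in> W)"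
proof -
  obtain U V where UV: "openin T U" "openin T V" "a \<in> U" "inv b \<in> V" "\<forall>x\<in>U. \<forall>y\<in>V. x \<otimes> y \<in> W"
    using mult_nhd[of W a "inv b"] W by auto
  obtain V' where "openin T V'" "b \<in> V'" "\<forall>x\<in>V'. inv x \<in> V" using inv_nhd[of V b] UV W by auto
  then show ?thesis using UV by (intro exI[of _ U] exI[of _ V']) auto
qed

lemma openin_translate:
  assumes W: "openin T W" and g: "g \<in> carrier G"
  shows "openin T {x \<in> carrier G. g \<otimes> x \<in> W}"
proof (subst openin_subopen, intro ballI)
  fix a assume a: "a \<in> {x \<in> carrier G. g \<otimes> x \<in> W}"
  then obtain U V where UV: "openin T U" "openin T V" "g \<in> U" "a \<in> V" "\<forall>x\<in>U. \<forall>y\<in>V. x \<otimes> y \<in> W"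
    using mult_nhd[of W g a] W g by auto
  then have "V \<subseteq> {x \<in> carrier G. g \<otimes> x \<in> W}" using open_subset[of V] by auto
  then show "\<exists>T'. openin T T' \<and> a \<in> T' \<and> T' \<subseteq> {x \<in> carrier G. g \<otimes> x \<in> W}" using UV by blast
qed

lemma openin_translate_right:
  assumes W: "openin T W" and g: "g \<in> carrier G"
  shows "openin T {x \<in> carrier G. x \<otimes> g \<in> W}"
proof (subst openin_subopen, intro ballI)
  fix a assume a: "a \<in> {x \<in> carrier G. x \<otimes> g \<in> W}"
  then obtain U V where UV: "openin T U" "openin T V" "a \<in> U" "g \<in> V" "\<forall>x\<in>U. \<forall>y\<in>V. x \<otimes> y \<in> W"
    using mult_nhd[of W a g] W g by auto
  then have "U \<subseteq> {x \<in> carrier G. x \<otimes> g \<in> W}" using open_subset[of U] by auto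
  then show "\<exists>T'. openin T T' \<and> a \<in> T' \<and> T' \<subseteq> {x \<in> carrier G. x \<otimes> g \<in> W}" using UV by blast
qed

lemma openin_conj:
  assumes W: "openin T W" and g: "g \<in> carrier G"
  shows "openin T {x \<in> carrier G. g \<otimes> x \<otimes> inv g \<in> W}"
proof -
  have "openin T {x \<in> carrier G. g \<otimes> x \<in> {x \<in> carrier G. x \<otimes> inv g \<in> W}}"
    using W g by (intro openin_translate openin_translate_right) auto
  moreover have "{x \<in> carrier G. g \<otimes> x \<in> {x \<in> carrier G. x \<otimes> inv g \<in> W}} = {x \<in> carrier G. g \<otimes> x \<otimes> inv g \<in> W}"
    using g by auto
  ultimately show ?thesis by simp
qed

lemma div_nhd_one:
  assumes W: "openin T W" "\<one> \<in> W"
  shows "\<exists>V. openin T V \<and> \<one> \<in> V \<and> (\<forall>x\<in>V. \<forall>y\<in>V. x \<otimes> inv y \<in> W)"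
proof -
  obtain U V where UV: "openin T U" "openin T V" "\<one> \<in> U" "\<one> \<in> V" "\<forall>x\<in>U. \<forall>y\<in>V. x \<otimes> inv y \<in> W"
    using div_nhd[of W \<one> \<one>] W by auto
  then show ?thesis by (intro exI[of _ "U \<inter> V"]) auto
qed

lemma finer_imp_eq:
  assumes T': "hausdorff_group_topology G T'" and le: "\<And>U. openin T' U \<Longrightarrow> openin T U"
    and nhd: "\<And>Y. openin T Y \<Longrightarrow> \<one> \<in> Y \<Longrightarrow> \<exists>P. openin T' P \<and> \<one> \<in> P \<and> P \<subseteq> Y"
  shows "T' = T"
proof -
  interpret T': hausdorff_group G T' by unfold_locales (rule T')
  have "openin T' Y" if Y: "openin T Y" for Y
  proof (subst openin_subopen, intro ballI)
    fix y assume y: "y \<in> Y"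
    then have yG: "y \<in> carrier G" using open_subset Y by blast
    have "openin T {x \<in> carrier G. y \<otimes> x \<in> Y}" using Y yG by (rule openin_translate)
    moreover have "\<one> \<in> {x \<in> carrier G. y \<otimes> x \<in> Y}" using y yG by simp
    ultimately obtain P where P: "openin T' P" "\<one> \<in> P" "P \<subseteq> {x \<in> carrier G. y \<otimes> x \<in> Y}"
      using nhd by meson
    have "openin T' {x \<in> carrier G. inv y \<otimes> x \<in> P}" using P yG by (intro T'.openin_translate) auto
    moreover have "y \<in> {x \<in> carrier G. inv y \<otimes> x \<in> P}" using P yG by simp
    moreover have "{x \<in> carrier G. inv y \<otimes> x \<in> P} \<subseteq> Y"
    proof
      fix x assume "x \<in> {x \<in> carrier G. inv y \<otimes> x \<in> P}"
      then have "x \<in> carrier G" "y \<otimes> (inv y \<otimes> x) \<in> Y" using P(3) by auto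
      then show "x \<in> Y" using yG by (simp add: m_assoc[symmetric])
    qed
    ultimately show "\<exists>V. openin T' V \<and> y \<in> V \<and> V \<subseteq> Y" by blast
  qed
  then show ?thesis using le by (auto simp: topology_eq)
qed

end

lemma hausdorff_groupI: "hausdorff_group_topology G T \<Longrightarrow> hausdorff_group G T"
  by (simp add: hausdorff_group_def hausdorff_group_axioms_def hausdorff_group_topology_def)

text \<open>The projection is open, since the saturation of an open set is a union of translates.
  Cosets are separated by continuity of division, because the complement of \<open>N\<close> is
  open.\<close>

lemma (in hausdorff_group) hausdorff_group_topology_quotient:
  assumes N: "N \<lhd> G" and closed: "closedin T N"
  shows "hausdorff_group_topology (G Mod N) (quotient_group_topology G N T)"
proof -
  interpret normal N G by (rule N)
  let ?Q = "quotient_group_topology G N T"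
  let ?p = "\<lambda>x. N #> x"
  have qm: "quotient_map T ?Q ?p" using quotient_map_quotient_group_topology[OF topspace_T] .
  have car: "carrier (G Mod N) = ?p ` carrier G" by (auto simp: FactGroup_def RCOSETS_def)
  have top: "topspace ?Q = carrier (G Mod N)"
    using quotient_imp_surjective_map[OF qm] topspace_T car by simp
  have mult: "?p x \<otimes>\<^bsub>G Mod N\<^esub> ?p y = ?p (x \<otimes> y)" if "x \<in> carrier G" "y \<in> carrier G" for x y
    using that by (simp add: FactGroup_def rcos_sum)
  have pinv: "inv\<^bsub>G Mod N\<^esub> ?p x = ?p (inv x)" if x: "x \<in> carrier G" for x
    using inv_FactGroup[of "?p x"] rcos_inv[OF x] x car by auto
  have p_eq: "x \<otimes> inv y \<in> N" if "?p x = ?p y" "x \<in> carrier G" "y \<in> carrier G" for x y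
    using that coset_mult_inv2[OF that subset] coset_join1[OF _ _ is_subgroup] by auto
  have image_open: "openin ?Q (?p ` U)" if U: "openin T U" for U
  proof -
    have "openin T (\<Union>n\<in>N. {x \<in> carrier G. n \<otimes> x \<in> U})"
      using U subset by (intro openin_clauses(3)) (auto intro!: openin_translate)
    moreover have "(\<Union>n\<in>N. {x \<in> carrier G. n \<otimes> x \<in> U}) = {x \<in> carrier G. ?p x \<in> ?p ` U}"
    proof (intro equalityI subsetI)
      fix x assume "x \<in> (\<Union>n\<in>N. {x \<in> carrier G. n \<otimes> x \<in> U})"
      then obtain n where n: "n \<in> N" "x \<in> carrier G" "n \<otimes> x \<in> U" by blast
      then have "?p (n \<otimes> x) = ?p x"
        using repr_independence[OF _ n(2) is_subgroup, of "n \<otimes> x"] by (simp add: rcosI subset)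
      then show "x \<in> {x \<in> carrier G. ?p x \<in> ?p ` U}" using n by (metis (mono_tags, lifting) image_eqI mem_Collect_eq)
    next
      fix x assume "x \<in> {x \<in> carrier G. ?p x \<in> ?p ` U}"
      then obtain u where x: "x \<in> carrier G" and u: "u \<in> U" "?p u = ?p x" by auto
      have uG: "u \<in> carrier G" using u open_subset[OF U] by blast
      have "(u \<otimes> inv x) \<otimes> x = u" using x uG by (simp add: m_assoc)
      then show "x \<in> (\<Union>n\<in>N. {x \<in> carrier G. n \<otimes> x \<in> U})"
        using p_eq[OF u(2) uG x] x u by (intro UN_I[of "u \<otimes> inv x"]) auto
    qed
    ultimately show ?thesis
      using open_subset[OF U] car by (auto simp: openin_quotient_group_topology)
  qed
  have preim: "openin T {x \<in> carrier G. ?p x \<in> W}" if "openin ?Q W" for W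
    using that by (simp add: openin_quotient_group_topology)
  have hd: "Hausdorff_space ?Q"
    unfolding Hausdorff_space_def
  proof (intro allI impI; elim conjE)
    fix x y assume "x \<in> topspace ?Q" "y \<in> topspace ?Q" and xy: "x \<noteq> y"
    then obtain a b where ab: "a \<in> carrier G" "x = ?p a" "b \<in> carrier G" "y = ?p b"
      using top car by auto
    have "a \<otimes> inv b \<notin> N"
    proof
      assume "a \<otimes> inv b \<in> N"
      then have "?p (a \<otimes> inv b) = N" using ab by (intro coset_join2 is_subgroup) auto
      then show False using coset_mult_inv1[of N a b] ab subset xy by auto
    qed
    moreover have "openin T (carrier G - N)" using closed topspace_T by (metis openin_diff openin_topspace)
    ultimately obtain U V where UV: "openin T U" "openin T V" "a \<in> U" "b \<in> V"
        "\<forall>x\<in>U. \<forall>y\<in>V. x \<otimes> inv y \<in> carrier G - N"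
      using div_nhd[of "carrier G - N" a b] ab by auto
    have "disjnt (?p ` U) (?p ` V)"
      unfolding disjnt_iff
    proof (intro allI notI; elim conjE imageE)
      fix z u v assume "z = ?p u" "u \<in> U" "z = ?p v" "v \<in> V"
      then show False using p_eq[of u v] UV open_subset by blast
    qed
    then show "\<exists>U V. openin ?Q U \<and> openin ?Q V \<and> x \<in> U \<and> y \<in> V \<and> disjnt U V"
      by (intro exI[of _ "?p ` U"] exI[of _ "?p ` V"] conjI image_open UV(1,2))
        (simp_all add: ab(2,4) imageI UV(3,4))
  qed
  have m: "\<exists>U V. openin ?Q U \<and> openin ?Q V \<and> x \<in> U \<and> y \<in> V \<and> (\<forall>u\<in>U. \<forall>v\<in>V. u \<otimes>\<^bsub>G Mod N\<^esub> v \<in> W)"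
    if W: "openin ?Q W" and xy: "x \<in> carrier (G Mod N)" "y \<in> carrier (G Mod N)" "x \<otimes>\<^bsub>G Mod N\<^esub> y \<in> W" for W x y
  proof -
    obtain a b where ab: "a \<in> carrier G" "x = ?p a" "b \<in> carrier G" "y = ?p b"
      using xy car by auto
    obtain U V where UV: "openin T U" "openin T V" "a \<in> U" "b \<in> V" "\<forall>u\<in>U. \<forall>v\<in>V. u \<otimes> v \<in> {x \<in> carrier G. ?p x \<in> W}"
      using mult_nhd[OF preim[OF W] ab(1,3)] ab xy mult[OF ab(1,3)] by auto
    have all: "\<forall>u\<in>?p ` U. \<forall>v\<in>?p ` V. u \<otimes>\<^bsub>G Mod N\<^esub> v \<in> W"
    proof (intro ballI; elim imageE)
      fix u v x y assume h: "u = ?p x" "x \<in> U" "v = ?p y" "y \<in> V"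
      then have "x \<in> carrier G" "y \<in> carrier G" "?p (x \<otimes> y) \<in> W" using UV open_subset by blast+
      then show "u \<otimes>\<^bsub>G Mod N\<^esub> v \<in> W" using h mult by simp
    qed
    show ?thesis
      by (intro exI[of _ "?p ` U"] exI[of _ "?p ` V"] conjI image_open UV(1,2) all)
        (simp_all add: ab(2,4) imageI UV(3,4))
  qed
  have i: "\<exists>U. openin ?Q U \<and> x \<in> U \<and> (\<forall>u\<in>U. inv\<^bsub>G Mod N\<^esub> u \<in> W)"
    if W: "openin ?Q W" and x: "x \<in> carrier (G Mod N)" "inv\<^bsub>G Mod N\<^esub> x \<in> W" for W x
  proof -
    obtain a where a: "a \<in> carrier G" "x = ?p a" using x car by auto
    obtain U where U: "openin T U" "a \<in> U" "\<forall>u\<in>U. inv u \<in> {x \<in> carrier G. ?p x \<in> W}"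
      using inv_nhd[OF preim[OF W] a(1)] a x pinv[OF a(1)] by auto
    have all: "\<forall>u\<in>?p ` U. inv\<^bsub>G Mod N\<^esub> u \<in> W"
    proof (intro ballI; elim imageE)
      fix u x assume h: "u = ?p x" "x \<in> U"
      then have "x \<in> carrier G" "?p (inv x) \<in> W" using U open_subset by blast+
      then show "inv\<^bsub>G Mod N\<^esub> u \<in> W" using h pinv by simp
    qed
    show ?thesis
      by (intro exI[of _ "?p ` U"] conjI image_open U(1) all) (simp add: a(2) imageI U(2))
  qed
  show ?thesis
    unfolding hausdorff_group_topology_alt
    by (intro conjI factorgroup_is_group top hd allI impI; elim conjE) ((rule m; assumption), (rule i; assumption))
qed

lemma (in hausdorff_group) hausdorff_group_topology_pullback:
  assumes H: "group H"
    and hom: "\<phi> \<in> hom H G" and inj: "inj_on \<phi> (carrier H)"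
  shows "hausdorff_group_topology H (pullback_topology (carrier H) \<phi> T)"
proof -
  interpret H: group H by (rule H)
  interpret group_hom H G \<phi> using hom by unfold_locales
  let ?P = "pullback_topology (carrier H) \<phi> T"
  have op: "openin ?P (\<phi> -` U \<inter> carrier H)" if "openin T U" for U
    using that by (auto simp: openin_pullback_topology)
  have top: "topspace ?P = carrier H"
    using topspace_T by (auto simp: topspace_pullback_topology)
  have hd: "Hausdorff_space ?P"
    unfolding Hausdorff_space_def
  proof (intro allI impI; elim conjE)
    fix x y assume xy: "x \<in> topspace ?P" "y \<in> topspace ?P" "x \<noteq> y"
    then have "\<phi> x \<in> topspace T" "\<phi> y \<in> topspace T" "\<phi> x \<noteq> \<phi> y"
      using top inj topspace_T by (auto dest: inj_onD)
    then obtain U V where "openin T U" "openin T V" "\<phi> x \<in> U" "\<phi> y \<in> V" "disjnt U V"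
      using Hausdorff_T unfolding Hausdorff_space_def by meson
    then show "\<exists>U V. openin ?P U \<and> openin ?P V \<and> x \<in> U \<and> y \<in> V \<and> disjnt U V"
      using op xy top by (intro exI[of _ "\<phi> -` U \<inter> carrier H"] exI[of _ "\<phi> -` V \<inter> carrier H"]) (auto simp: disjnt_iff)
  qed
  have m: "\<exists>U V. openin ?P U \<and> openin ?P V \<and> x \<in> U \<and> y \<in> V \<and> (\<forall>u\<in>U. \<forall>v\<in>V. u \<otimes>\<^bsub>H\<^esub> v \<in> W)"
    if W: "openin ?P W" and xy: "x \<in> carrier H" "y \<in> carrier H" "x \<otimes>\<^bsub>H\<^esub> y \<in> W" for W x y
  proof -
    obtain W' where W': "openin T W'" "W = \<phi> -` W' \<inter> carrier H"
      using W by (auto simp: openin_pullback_topology)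
    then obtain U V where "openin T U" "openin T V" "\<phi> x \<in> U" "\<phi> y \<in> V" "\<forall>x\<in>U. \<forall>y\<in>V. x \<otimes> y \<in> W'"
      using mult_nhd[of W' "\<phi> x" "\<phi> y"] xy by auto
    then show ?thesis
      using op xy W' by (intro exI[of _ "\<phi> -` U \<inter> carrier H"] exI[of _ "\<phi> -` V \<inter> carrier H"]) auto
  qed
  have i: "\<exists>U. openin ?P U \<and> x \<in> U \<and> (\<forall>u\<in>U. inv\<^bsub>H\<^esub> u \<in> W)"
    if W: "openin ?P W" and x: "x \<in> carrier H" "inv\<^bsub>H\<^esub> x \<in> W" for W x
  proof -
    obtain W' where W': "openin T W'" "W = \<phi> -` W' \<inter> carrier H"
      using W by (auto simp: openin_pullback_topology)
    then obtain U where "openin T U" "\<phi> x \<in> U" "\<forall>x\<in>U. inv x \<in> W'"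
      using inv_nhd[of W' "\<phi> x"] x by auto
    then show ?thesis
      using op x W' by (intro exI[of _ "\<phi> -` U \<inter> carrier H"]) auto
  qed
  show ?thesis
    unfolding hausdorff_group_topology_alt
    by (intro conjI H top hd allI impI; elim conjE) ((rule m; assumption), (rule i; assumption))
qed

section \<open>Finite groups and the degenerate cases\<close>

lemma minimal_group_finite:
  assumes hgt: "hausdorff_group_topology H T" and fin: "finite (carrier H)"
  shows "minimal_group H T"
proof -
  have "openin T' U \<longleftrightarrow> U \<subseteq> carrier H" if T': "hausdorff_group_topology H T'" for T' U
  proof
    assume U: "U \<subseteq> carrier H"
    have top: "topspace T' = carrier H" "Hausdorff_space T'"
      using T' by (auto simp: hausdorff_group_topology_def)
    have "closedin T' (carrier H - U)"
      by (rule compactin_imp_closedin[OF top(2)]) (use fin top in \<open>auto intro: finite_imp_compactin\<close>)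
    then have "openin T' (topspace T' - (carrier H - U))" by blast
    also have "topspace T' - (carrier H - U) = U" using U top by auto
    finally show "openin T' U" .
  qed (use T' openin_subset in \<open>force simp: hausdorff_group_topology_def\<close>)
  then show ?thesis using hgt unfolding minimal_group_def by (auto simp: topology_eq)
qed

lemma finite_vector_box:
  assumes "\<And>i. finite (S i)"
  shows "finite {v::'a^'n. \<forall>i. v $ i \<in> S i}"
proof -
  have "{v::'a^'n. \<forall>i. v $ i \<in> S i} \<subseteq> (\<lambda>f. \<chi> i. f i) ` PiE UNIV S"
    by (auto simp: image_iff PiE_iff intro!: bexI[of _ "vec_nth _"])
  moreover have "finite (PiE UNIV S)" using assms by (intro finite_PiE) auto
  ultimately show ?thesis using finite_surj by blast
qed

lemma finite_carrier_SL:
  assumes "finite F \<or> (\<forall>p q :: 'n. p = q)"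
  shows "finite (carrier (SL (F :: 'a::field set) :: ('a^'n^'n) monoid))"
  using assms
proof
  assume F: "finite F"
  have "finite {A::'a^'n^'n. \<forall>i. A $ i \<in> {v. \<forall>j. v $ j \<in> F}}"
    by (intro finite_vector_box F)
  then show ?thesis by (rule rev_finite_subset) (auto simp: SL_def)
next
  assume one: "\<forall>p q :: 'n. p = q"
  have "A = mat 1" if "A \<in> carrier (SL F)" for A :: "'a^'n^'n"
  proof -
    have A: "A = mat (A $ i $ i)" for i
      using one by (auto simp: vec_eq_iff mat_def) metis+
    have "det A = A $ i $ i" for i
    proof -
      have "det A = (\<Prod>j\<in>UNIV. A $ j $ j)" by (rule det_diagonal) (use one in auto)
      also have "\<dots> = (\<Prod>j\<in>{i}. A $ j $ j)" using one by (intro prod.cong) auto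
      finally show ?thesis by simp
    qed
    then show ?thesis using A[of undefined] that by (simp add: SL_carrier_iff)
  qed
  then have "carrier (SL F :: ('a^'n^'n) monoid) \<subseteq> {mat 1}" by blast
  then show ?thesis using finite_subset by blast
qed

section \<open>Quotients of SL(n, F)\<close>

lemma finite_roots_of_unity_in: "n > 0 \<Longrightarrow> finite (roots_of_unity_in n (K :: 'a::field set))"
proof -
  assume "n > 0"
  have "Polynomial.monom 1 n - 1 \<noteq> (0 :: 'a poly)"
  proof
    assume "Polynomial.monom 1 n - 1 = (0 :: 'a poly)"
    then have "Polynomial.coeff (Polynomial.monom 1 n - 1 :: 'a poly) n = 0" by simp
    then show False using \<open>n > 0\<close> by simp
  qed
  then have "finite {x :: 'a. poly (Polynomial.monom 1 n - 1) x = 0}" by (rule poly_roots_finite)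
  then show ?thesis by (rule rev_finite_subset) (auto simp: roots_of_unity_in_def poly_monom)
qed

lemma openin_SL_topology: "openin (SL_topology K) U \<longleftrightarrow> (\<exists>N. open N \<and> U = carrier (SL K) \<inter> N)"
  by (simp add: SL_topology_def openin_open)

lemma hausdorff_group_topology_SL:
  fixes T :: "('b::topological_field^'n^'n) topology"
  assumes "subfield_set L" "T = SL_topology L"
  shows "hausdorff_group_topology (SL L) T"
proof -
  interpret L: subfield_set L by fact
  have H: "Hausdorff_space T"
    unfolding assms(2) SL_topology_def by (intro Hausdorff_space_subtopology Hausdorff_space_matrix)
  have m: "\<exists>U V. openin T U \<and> openin T V \<and> a \<in> U \<and> b \<in> V \<and> (\<forall>x\<in>U. \<forall>y\<in>V. x \<otimes>\<^bsub>SL L\<^esub> y \<in> W)"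
    if W: "openin T W" and ab: "a \<in> carrier (SL L)" "b \<in> carrier (SL L)" "a \<otimes>\<^bsub>SL L\<^esub> b \<in> W" for W a b
  proof -
    obtain N where N: "open N" "W = carrier (SL L) \<inter> N" using W by (auto simp: assms(2) openin_SL_topology)
    have "open ((\<lambda>p. fst p ** snd p) -` N)"
      by (intro open_vimage N continuous_on_matrix_mult continuous_on_fst continuous_on_snd continuous_on_id)
    moreover have "(a, b) \<in> (\<lambda>p. fst p ** snd p) -` N" using ab N by simp
    ultimately obtain A B where AB: "open A" "open B" "(a, b) \<in> A \<times> B" "A \<times> B \<subseteq> (\<lambda>p. fst p ** snd p) -` N"
      by (rule open_prod_elim)
    have "\<forall>x\<in>carrier (SL L) \<inter> A. \<forall>y\<in>carrier (SL L) \<inter> B. x \<otimes>\<^bsub>SL L\<^esub> y \<in> W"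
      using AB(4) N(2) by (auto intro: L.mult_SL)
    then show ?thesis using AB ab
      by (intro exI[of _ "carrier (SL L) \<inter> A"] exI[of _ "carrier (SL L) \<inter> B"])
        (auto simp: assms(2) openin_SL_topology)
  qed
  have i: "\<exists>U. openin T U \<and> a \<in> U \<and> (\<forall>x\<in>U. inv\<^bsub>SL L\<^esub> x \<in> W)"
    if W: "openin T W" and a: "a \<in> carrier (SL L)" "inv\<^bsub>SL L\<^esub> a \<in> W" for W a
  proof -
    obtain N where N: "open N" "W = carrier (SL L) \<inter> N" using W by (auto simp: assms(2) openin_SL_topology)
    have o: "open (adjugate -` N)" by (intro open_vimage N continuous_on_adjugate continuous_on_id)
    show ?thesis using a N o
      by (intro exI[of _ "carrier (SL L) \<inter> adjugate -` N"])
        (auto simp: assms(2) openin_SL_topology L.inv_SL intro: L.adjugate_SL)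
  qed
  have top: "topspace T = carrier (SL L)" by (simp add: assms(2) SL_topology_def)
  show ?thesis
    unfolding hausdorff_group_topology_alt
    by (intro conjI L.group_SL top H allI impI; elim conjE) ((rule m; assumption), (rule i; assumption))
qed

text \<open>Approximating the entries of \<open>A\<close> from \<open>F\<close> yields a determinant
  close to 1 but not equal to it. Dividing one row by the determinant repairs this; that operation
  \<open>\<Phi>\<close> is continuous near \<open>A\<close>, fixes \<open>A\<close>, and keeps
  entries in \<open>F\<close>.\<close>

lemma SL_dense:
  fixes F :: "'a::topological_field set"
  assumes "subfield_set F"
  shows "carrier (SL (closure F)) \<subseteq> closure (carrier (SL F) :: ('a^'n^'n) set)"
proof
  interpret subfield_set F by fact
  fix A :: "'a^'n^'n" assume A: "A \<in> carrier (SL (closure F))"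
  define k :: 'n where "k = undefined"
  define \<Phi> :: "'a^'n^'n \<Rightarrow> 'a^'n^'n" where
    "\<Phi> B = (\<chi> i. if i = k then inverse (det B) *s B $ i else B $ i)" for B
  have \<Phi>_nth: "\<Phi> B $ i $ j = (if i = k then inverse (det B) else 1) * B $ i $ j" for B i j
    by (simp add: \<Phi>_def)
  have det\<Phi>: "det (\<Phi> B) = 1" if "det B \<noteq> 0" for B
  proof -
    have "det (\<Phi> B) = inverse (det B) * det (\<chi> i. if i = k then B $ i else B $ i)"
      unfolding \<Phi>_def by (rule det_row_mul)
    also have "(\<chi> i. if i = k then B $ i else B $ i) = B" by (simp add: vec_eq_iff)
    finally show ?thesis using that by simp
  qed
  have "\<exists>g\<in>carrier (SL F). g \<in> W" if W: "open W" "A \<in> W" for W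
  proof -
    let ?D = "{B :: 'a^'n^'n. det B \<noteq> 0}"
    have oD: "open ?D"
    proof -
      have "open (det -` (- {0}) :: ('a^'n^'n) set)"
        by (intro open_vimage continuous_on_det_field continuous_on_id) auto
      moreover have "det -` (- {0}) = ?D" by auto
      ultimately show ?thesis by simp
    qed
    have "continuous_on ?D (\<lambda>B. \<chi> i j. (if i = k then inverse (det B) else 1) * B $ i $ j)"
    proof (intro continuous_on_vec_lambda continuous_on_mult' continuous_on_component continuous_on_id)
      fix i show "continuous_on ?D (\<lambda>B. if i = k then inverse (det B) else 1)"
        by (cases "i = k") (auto intro!: continuous_on_inverse_field continuous_on_det_field continuous_on_id)
    qed
    moreover have "(\<lambda>B. \<chi> i j. (if i = k then inverse (det B) else 1) * B $ i $ j) = \<Phi>"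
      by (rule ext) (simp add: vec_eq_iff \<Phi>_nth)
    ultimately have "continuous_on ?D \<Phi>" by (simp only:)
    then have o: "open (?D \<inter> \<Phi> -` W)" by (rule continuous_open_preimage) (fact oD W)+
    have detA: "det A = 1" using A by (simp add: SL_carrier_iff)
    then have "\<Phi> A = A" by (simp add: vec_eq_iff \<Phi>_nth)
    then have A_in: "A \<in> ?D \<inter> \<Phi> -` W" using detA W by simp
    obtain R where R: "\<forall>i. open (R i) \<and> A $ i \<in> R i" "\<forall>B. (\<forall>i. B $ i \<in> R i) \<longrightarrow> B \<in> ?D \<inter> \<Phi> -` W"
      using open_vec_def[THEN iffD1, OF o, THEN bspec, OF A_in] by (elim exE conjE)
    have "\<exists>v. (\<forall>j. v $ j \<in> F) \<and> v \<in> R i" for i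
    proof -
      have "open (R i)" "A $ i \<in> R i" using R(1) by auto
      from open_vec_def[THEN iffD1, OF this(1), THEN bspec, OF this(2)]
      obtain E where E: "\<forall>j. open (E j) \<and> A $ i $ j \<in> E j" "\<forall>v. (\<forall>j. v $ j \<in> E j) \<longrightarrow> v \<in> R i"
        by (elim exE conjE)
      have "\<exists>x. x \<in> F \<and> x \<in> E j" for j
      proof -
        have "A $ i $ j \<in> closure F" using A by (simp add: SL_carrier_iff)
        then have "E j \<inter> F \<noteq> {}" using E(1) open_Int_closure_eq_empty[of "E j" F] by blast
        then show ?thesis by blast
      qed
      then obtain x where x: "\<And>j. x j \<in> F \<and> x j \<in> E j" by metis
      then show ?thesis using E(2) by (intro exI[of _ "\<chi> j. x j"]) auto
    qed
    then obtain B where B: "\<And>i. (\<forall>j. B i $ j \<in> F) \<and> B i \<in> R i" by metis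
    let ?B = "\<chi> i. B i"
    have BW: "?B \<in> ?D \<inter> \<Phi> -` W" by (rule R(2)[THEN spec, THEN mp]) (use B in simp)
    have "det ?B \<in> F" by (rule det_closed) (use B in simp)
    then have "\<Phi> ?B \<in> carrier (SL F)"
      using B BW by (auto simp: SL_carrier_iff \<Phi>_nth det\<Phi>)
    then show ?thesis using BW by blast
  qed
  then show "A \<in> closure (carrier (SL F))"
    unfolding closure_iff_nhds_not_empty by (metis IntI empty_iff subsetD)
qed

lemma SL_mono: "F \<subseteq> K \<Longrightarrow> carrier (SL F) \<subseteq> carrier (SL K)"
  by (auto simp: SL_carrier_iff subset_iff)

lemma (in group) center_normal: "center G \<lhd> G"
proof (rule normal_invI)
  show "subgroup (center G) G"
  proof (rule subgroupI)
    show "inv z \<in> center G" if z: "z \<in> center G" for z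
    proof -
      have zG: "z \<in> carrier G" using z by (simp add: center_def)
      have "inv z \<otimes> x = x \<otimes> inv z" if x: "x \<in> carrier G" for x
      proof -
        have "z \<otimes> inv x = inv x \<otimes> z" using z x by (simp add: center_def)
        then have "inv (z \<otimes> inv x) = inv (inv x \<otimes> z)" by simp
        then show ?thesis using zG x by (simp add: inv_mult_group)
      qed
      then show ?thesis using zG by (simp add: center_def)
    qed
    show "y \<otimes> z \<in> center G" if "y \<in> center G" "z \<in> center G" for y z
    proof -
      have yz: "y \<in> carrier G" "z \<in> carrier G" using that by (auto simp: center_def)
      have "y \<otimes> z \<otimes> x = x \<otimes> (y \<otimes> z)" if x: "x \<in> carrier G" for x
      proof -
        have "y \<otimes> z \<otimes> x = y \<otimes> (x \<otimes> z)" using \<open>z \<in> center G\<close> x yz by (simp add: center_def m_assoc)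
        also have "\<dots> = (y \<otimes> x) \<otimes> z" using x yz by (simp add: m_assoc)
        also have "\<dots> = x \<otimes> (y \<otimes> z)" using \<open>y \<in> center G\<close> x yz by (simp add: center_def m_assoc)
        finally show ?thesis .
      qed
      then show ?thesis using yz by (simp add: center_def)
    qed
  qed (auto simp: center_def intro: exI[of _ \<one>])
  show "x \<otimes> h \<otimes> inv x \<in> center G" if x: "x \<in> carrier G" and h: "h \<in> center G" for x h
  proof -
    have hG: "h \<in> carrier G" using h by (simp add: center_def)
    have "x \<otimes> h = h \<otimes> x" using h x by (simp add: center_def)
    then have "x \<otimes> h \<otimes> inv x = h" using x hG by (simp add: m_assoc)
    then show ?thesis using h by simp
  qed
qed

lemma closedin_center_SL:
  fixes F :: "'a::topological_field set"
  assumes "subfield_set F"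
  shows "closedin (SL_topology F) (center (SL F :: ('a^'n^'n) monoid))"
proof -
  interpret subfield_set F by fact
  have "finite (center (SL F :: ('a^'n^'n) monoid))"
    unfolding center_SL by (intro finite_imageI finite_roots_of_unity_in) simp
  moreover have "center (SL F :: ('a^'n^'n) monoid) \<subseteq> topspace (SL_topology F)"
    by (auto simp: center_def SL_topology_def)
  moreover have "Hausdorff_space (SL_topology F :: ('a^'n^'n) topology)"
    unfolding SL_topology_def by (intro Hausdorff_space_subtopology Hausdorff_space_matrix)
  ultimately show ?thesis using compactin_imp_closedin finite_imp_compactin by blast
qed

text \<open>A Hausdorff quotient of SL(n, F) given by an abstract quotient homomorphism, so that
  quotients of SL and of PSL are covered alike although their elements have different types.\<close>

locale SL_quotient = F: subfield_set F + H: hausdorff_group H T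
  for F :: "'a::local_field set" and H (structure) and T +
  fixes \<pi> :: "'a^'n^'n \<Rightarrow> _"
  assumes \<pi>_hom: "\<pi> \<in> hom (SL F) H"
    and \<pi>_quotient: "quotient_map (SL_topology F) T \<pi>"
begin

abbreviation "K \<equiv> closure F"

sublocale K: subfield_set K
  by (rule subfield_set_closure[OF F.subfield_set_axioms])

sublocale \<pi>: group_hom "SL F" H \<pi>
  using \<pi>_hom F.group_SL H.group_axioms by (simp add: group_hom_def group_hom_axioms_def)

abbreviation "GF \<equiv> carrier (SL F :: ('a^'n^'n) monoid)"
abbreviation "GK \<equiv> carrier (SL K :: ('a^'n^'n) monoid)"

lemma GF_GK: "GF \<subseteq> GK"
  by (rule SL_mono[OF closure_subset])

lemma \<pi>_surj: "\<pi> ` GF = carrier H"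
  using quotient_imp_surjective_map[OF \<pi>_quotient] H.topspace_T by (simp add: SL_topology_def)

lemma preimage: "x \<in> carrier H \<Longrightarrow> \<exists>g\<in>GF. x = \<pi> g"
  using \<pi>_surj by (simp add: image_iff set_eq_iff)

lemma \<pi>_mult: "A \<in> GF \<Longrightarrow> B \<in> GF \<Longrightarrow> \<pi> (A ** B) = \<pi> A \<otimes> \<pi> B"
  using \<pi>.hom_mult[of A B] by simp

lemma \<pi>_one: "\<pi> (mat 1) = \<one>"
  using \<pi>.hom_one by simp

lemma \<pi>_adjugate: "A \<in> GF \<Longrightarrow> \<pi> (adjugate A) = inv (\<pi> A)"
  using \<pi>.hom_inv[of A] by (simp add: F.inv_SL)

lemma openin_T: "openin T W \<longleftrightarrow> W \<subseteq> carrier H \<and> (\<exists>N. open N \<and> {g \<in> GF. \<pi> g \<in> W} = GF \<inter> N)"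
proof -
  have "openin T W \<longleftrightarrow> W \<subseteq> carrier H \<and> openin (SL_topology F) {g \<in> GF. \<pi> g \<in> W}"
  proof
    assume W: "openin T W"
    then have "W \<subseteq> topspace T" by (rule openin_subset)
    then show "W \<subseteq> carrier H \<and> openin (SL_topology F) {g \<in> GF. \<pi> g \<in> W}"
      using \<pi>_quotient W H.topspace_T unfolding quotient_map_def by (simp add: SL_topology_def)
  next
    assume "W \<subseteq> carrier H \<and> openin (SL_topology F) {g \<in> GF. \<pi> g \<in> W}"
    then show "openin T W"
      using \<pi>_quotient H.topspace_T unfolding quotient_map_def by (auto simp: SL_topology_def)
  qed
  then show ?thesis by (simp add: openin_SL_topology)
qed

lemma minimal:
  assumes roots: "roots_of_unity_in CARD('n) F = roots_of_unity_in CARD('n) K"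
  shows "minimal_group H T"
proof (cases "finite F \<or> (\<forall>p q :: 'n. p = q)")
  case True
  \<comment> \<open>The cases in which \<open>SL_nhd_base\<close> is not applicable: a finite field
    is discrete, and n = 1 leaves no pair of distinct indices.\<close>
  then have "finite GF" by (rule finite_carrier_SL)
  then have "finite (carrier H)" using \<pi>_surj by (metis finite_imageI)
  then show ?thesis using H.hgt by (rule minimal_group_finite[rotated])
next
  case False
  have "T' = T" if T': "hausdorff_group_topology H T'" and le: "\<forall>U. openin T' U \<longrightarrow> openin T U" for T'
  proof (rule H.finer_imp_eq[OF T'])
    show "openin T U" if "openin T' U" for U using le that by blast
    interpret T': hausdorff_group H T' by (rule hausdorff_groupI[OF T'])
    define pre where "pre P = {g \<in> GF. \<pi> g \<in> P}" for P
    define nhds' where "nhds' = {P. openin T' P \<and> \<one> \<in> P}"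
    define \<U> where "\<U> = (\<lambda>P. closure (pre P)) ` nhds'"
    have pre_nhd: "\<exists>N. open N \<and> mat 1 \<in> N \<and> N \<inter> GF = pre P" if P: "P \<in> nhds'" for P
    proof -
      have "openin T P" using P le by (simp add: nhds'_def)
      then obtain N where N: "open N" "{g \<in> GF. \<pi> g \<in> P} = GF \<inter> N" by (auto simp: openin_T)
      moreover have "mat 1 \<in> {g \<in> GF. \<pi> g \<in> P}" using P F.one_SL by (simp add: nhds'_def \<pi>_one)
      ultimately show ?thesis unfolding pre_def by (intro exI[of _ N]) auto
    qed
    have div: "\<exists>V\<in>nhds'. \<forall>x\<in>closure (pre V). \<forall>y\<in>closure (pre V). x ** adjugate y \<in> closure (pre P)"
      if P: "P \<in> nhds'" for P
    proof -
      obtain V where V: "openin T' V" "\<one> \<in> V" "\<forall>x\<in>V. \<forall>y\<in>V. x \<otimes> inv y \<in> P"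
        using T'.div_nhd_one[of P] P by (auto simp: nhds'_def)
      have "(\<lambda>p. fst p ** adjugate (snd p)) ` (pre V \<times> pre V) \<subseteq> closure (pre P)"
      proof -
        have "x ** adjugate y \<in> pre P" if xy: "x \<in> pre V" "y \<in> pre V" for x y
          using xy V(3) by (auto simp: pre_def \<pi>_mult \<pi>_adjugate F.adjugate_SL intro: F.mult_SL F.adjugate_SL)
        then show ?thesis using closure_subset[of "pre P"] by auto
      qed
      then have "(\<lambda>p. fst p ** adjugate (snd p)) ` closure (pre V \<times> pre V) \<subseteq> closure (pre P)"
        by (intro image_closure_subset continuous_on_matrix_mult continuous_on_adjugate
            continuous_on_fst continuous_on_snd continuous_on_id closed_closure)
      then have "\<forall>x\<in>closure (pre V). \<forall>y\<in>closure (pre V). x ** adjugate y \<in> closure (pre P)"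
        by (auto simp: closure_Times image_subset_iff)
      then show ?thesis using V by (auto simp: nhds'_def)
    qed
    have nhd: "\<exists>N. open N \<and> mat 1 \<in> N \<and> N \<inter> GK \<subseteq> closure (pre P)" if P: "P \<in> nhds'" for P
    proof -
      obtain N where N: "open N" "mat 1 \<in> N" "N \<inter> GF = pre P" using pre_nhd[OF P] by blast
      \<comment> \<open>Density makes the closure of a neighbourhood in SL(n, F) a neighbourhood in
        SL(n, K).\<close>
      have "N \<inter> GK \<subseteq> N \<inter> closure GF" using SL_dense[OF F.subfield_set_axioms] by blast
      also have "\<dots> \<subseteq> closure (N \<inter> GF)" by (rule open_Int_closure_subset[OF N(1)])
      finally show ?thesis using N by auto
    qed
    have conjF: "\<exists>V\<in>nhds'. \<forall>x\<in>closure (pre V). g ** x ** adjugate g \<in> closure (pre P)"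
      if P: "P \<in> nhds'" and g: "g \<in> GF" for P g
    proof -
      have \<pi>g: "\<pi> g \<in> carrier H" using g by (rule \<pi>.hom_closed)
      let ?V = "{x \<in> carrier H. \<pi> g \<otimes> x \<otimes> inv (\<pi> g) \<in> P}"
      have V: "?V \<in> nhds'" using P \<pi>g by (auto simp: nhds'_def intro: T'.openin_conj)
      have "(\<lambda>x. g ** x ** adjugate g) ` pre ?V \<subseteq> closure (pre P)"
      proof -
        have "g ** x ** adjugate g \<in> pre P" if x: "x \<in> pre ?V" for x
          using x g by (auto simp: pre_def \<pi>_mult \<pi>_adjugate F.adjugate_SL F.mult_SL)
        then show ?thesis using closure_subset[of "pre P"] by auto
      qed
      then have "(\<lambda>x. g ** x ** adjugate g) ` closure (pre ?V) \<subseteq> closure (pre P)"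
        by (intro image_closure_subset continuous_on_matrix_mult continuous_on_const
            continuous_on_id closed_closure)
      then show ?thesis using V by blast
    qed
    have mult: "\<exists>V\<in>nhds'. closure (pre V) \<subseteq> closure (pre P) \<and>
        (\<forall>x\<in>closure (pre V). \<forall>y\<in>closure (pre V). x ** y ** adjugate x \<in> closure (pre P))"
      if P: "P \<in> nhds'" for P
    proof -
      obtain P1 where P1: "P1 \<in> nhds'" "\<forall>x\<in>closure (pre P1). \<forall>y\<in>closure (pre P1). x ** adjugate y \<in> closure (pre P)"
        using div[OF P] by blast
      obtain P2 where P2: "P2 \<in> nhds'" "\<forall>x\<in>closure (pre P2). \<forall>y\<in>closure (pre P2). x ** adjugate y \<in> closure (pre P1)"
        using div[OF P1(1)] by blast
      obtain P3 where P3: "P3 \<in> nhds'" "\<forall>x\<in>closure (pre P3). \<forall>y\<in>closure (pre P3). x ** adjugate y \<in> closure (pre P2)"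
        using div[OF P2(1)] by blast
      have one: "mat 1 \<in> closure (pre Q)" if Q: "Q \<in> nhds'" for Q
        using nhd[OF Q] K.one_SL by blast
      have sub: "pre Q \<subseteq> GK" for Q using GF_GK by (auto simp: pre_def)
      have clGK: "closure (pre Q) \<subseteq> GK" for Q
        by (rule closure_minimal[OF sub closed_carrier_SL[OF closed_closure]])
      let ?V = "P3 \<inter> P2 \<inter> P1 \<inter> P"
      have V: "?V \<in> nhds'" using P P1 P2 P3 by (auto simp: nhds'_def)
      have clV: "closure (pre ?V) \<subseteq> closure (pre Q)" if "?V \<subseteq> Q" for Q
        by (rule closure_mono) (use that in \<open>auto simp: pre_def\<close>)
      have "x ** y ** adjugate x \<in> closure (pre P)"
        if x: "x \<in> closure (pre ?V)" and y: "y \<in> closure (pre ?V)" for x y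
      proof -
        have x3: "x \<in> closure (pre P3)" "x \<in> closure (pre P2)" "x \<in> closure (pre P1)" "y \<in> closure (pre P3)"
          using x y clV[of P3] clV[of P2] clV[of P1] by blast+
        have "mat 1 ** adjugate y \<in> closure (pre P2)" using P3 one[OF P3(1)] x3 by blast
        then have "x ** adjugate (adjugate y) \<in> closure (pre P1)" using P2 x3 by auto
        moreover have "det y = 1" using subsetD[OF clGK y] by (simp add: SL_carrier_iff)
        ultimately have "x ** y \<in> closure (pre P1)" by (simp add: adjugate_adjugate)
        then show ?thesis using P1 x3 by blast
      qed
      then show ?thesis using V clV[of P] by (intro bexI[of _ ?V]) auto
    qed
    have conjK: "\<exists>V\<in>nhds'. \<forall>x\<in>closure (pre V). g ** x ** adjugate g \<in> closure (pre P)"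
      if P: "P \<in> nhds'" and g: "g \<in> GK" for P g
    proof -
      obtain P1 where P1: "P1 \<in> nhds'"
          "\<forall>x\<in>closure (pre P1). \<forall>y\<in>closure (pre P1). x ** y ** adjugate x \<in> closure (pre P)"
        using mult[OF P] by blast
      obtain N where N: "open N" "mat 1 \<in> N" "N \<inter> GK \<subseteq> closure (pre P1)" using nhd[OF P1(1)] by blast
      have dg: "det g = 1" using g by (simp add: SL_carrier_iff)
      \<comment> \<open>By density \<open>g\<close> is a product of some \<open>?k\<close> close to
        the identity and some \<open>h\<close> over \<open>F\<close>. Conjugation by
        \<open>h\<close> is continuous over \<open>F\<close>, and \<open>?k\<close> is absorbed by
        the joint estimate \<open>mult\<close>.\<close>
      have "open ((\<lambda>h. g ** adjugate h) -` N)"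
        by (intro open_vimage N continuous_on_matrix_mult continuous_on_adjugate continuous_on_const continuous_on_id)
      moreover have "g \<in> (\<lambda>h. g ** adjugate h) -` N" using N dg by (simp add: adjugate_right)
      moreover have "g \<in> closure GF" using g SL_dense[OF F.subfield_set_axioms] by blast
      ultimately have "(\<lambda>h. g ** adjugate h) -` N \<inter> GF \<noteq> {}"
        using open_Int_closure_eq_empty by blast
      then obtain h where h: "h \<in> GF" "g ** adjugate h \<in> N" by blast
      have dh: "det h = 1" using h by (simp add: SL_carrier_iff)
      let ?k = "g ** adjugate h"
      have k: "?k \<in> closure (pre P1)" using N h g GF_GK by (auto intro: K.mult_SL K.adjugate_SL)
      obtain V where V: "V \<in> nhds'" "\<forall>x\<in>closure (pre V). h ** x ** adjugate h \<in> closure (pre P1)"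
        using conjF[OF P1(1) h(1)] by blast
      have "g ** x ** adjugate g \<in> closure (pre P)" if x: "x \<in> closure (pre V)" for x
      proof -
        have "?k ** (h ** x ** adjugate h) ** adjugate ?k \<in> closure (pre P)" using P1 k V x by blast
        also have "adjugate ?k = h ** adjugate g"
          using dg dh by (simp add: adjugate_mult det_adjugate adjugate_adjugate)
        also have "?k ** (h ** x ** adjugate h) ** (h ** adjugate g)
            = g ** (adjugate h ** h) ** x ** (adjugate h ** h) ** adjugate g"
          by (simp add: matrix_mul_assoc)
        finally show ?thesis using dh by (simp add: adjugate_left)
      qed
      then show ?thesis using V(1) by blast
    qed
    interpret B: SL_nhd_base K \<U>
    proof unfold_locales
      show "closed K" by simp
      show "\<exists>x\<in>K. x \<noteq> 0 \<and> x \<in> N" if N: "open N" "0 \<in> N" for N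
      proof (rule ccontr)
        assume "\<not> ?thesis"
        then have "N \<inter> F \<subseteq> {0}" using closure_subset[of F] by blast
        then have "finite F" using N by (intro discrete_subfield_finite[of F N]) auto
        then show False using False by blast
      qed
      show "\<exists>p q :: 'n. p \<noteq> q" using False by blast
      show "U \<subseteq> GK" if "U \<in> \<U>" for U
      proof -
        have "pre P \<subseteq> GK" for P using GF_GK by (auto simp: pre_def)
        then show ?thesis using that closure_minimal[OF _ closed_carrier_SL[OF closed_closure]]
          unfolding \<U>_def by blast
      qed
      show "closed U" if "U \<in> \<U>" for U using that by (auto simp: \<U>_def)
      have "carrier H \<in> nhds'"
        using T'.topspace_T openin_topspace[of T'] by (simp add: nhds'_def)
      then show "\<U> \<noteq> {}" by (auto simp: \<U>_def)
      show "\<exists>W\<in>\<U>. W \<subseteq> U \<inter> V" if UV: "U \<in> \<U>" "V \<in> \<U>" for U V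
      proof -
        obtain P Q where PQ: "P \<in> nhds'" "Q \<in> nhds'" "U = closure (pre P)" "V = closure (pre Q)"
          using UV by (auto simp: \<U>_def)
        have "P \<inter> Q \<in> nhds'" using PQ by (auto simp: nhds'_def)
        moreover have "closure (pre (P \<inter> Q)) \<subseteq> closure (pre P)" "closure (pre (P \<inter> Q)) \<subseteq> closure (pre Q)"
          by (rule closure_mono; force simp: pre_def)+
        ultimately show ?thesis using PQ by (auto simp: \<U>_def)
      qed
      show "\<exists>N. open N \<and> mat 1 \<in> N \<and> N \<inter> GK \<subseteq> U" if "U \<in> \<U>" for U
        using that nhd by (auto simp: \<U>_def)
      show "\<exists>V\<in>\<U>. \<forall>x\<in>V. \<forall>y\<in>V. x ** adjugate y \<in> U" if "U \<in> \<U>" for U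
        using that div by (auto simp: \<U>_def)
      show "\<exists>V\<in>\<U>. \<forall>x\<in>V. g ** x ** adjugate g \<in> U" if "U \<in> \<U>" "g \<in> GK" for U g
        using that conjK by (auto simp: \<U>_def)
    qed
    \<comment> \<open>An element of \<open>M\<close> over \<open>F\<close> is approximated by some
      \<open>w\<close> in \<open>pre V\<close> with \<open>adjugate g ** w\<close> also in
      \<open>pre V\<close>. Hence \<open>\<pi> g\<close> is a quotient of two elements of
      \<open>V\<close> and lies in every neighbourhood of the identity for \<open>T'\<close>, which
      is Hausdorff.\<close>
    have kernel: "\<pi> g = \<one>" if g: "g \<in> GF" "g \<in> B.M" for g
    proof (rule ccontr)
      assume ne: "\<pi> g \<noteq> \<one>"
      have \<pi>g: "\<pi> g \<in> carrier H" using g(1) by (rule \<pi>.hom_closed)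
      obtain P P' where P: "openin T' P" "\<one> \<in> P" "\<pi> g \<in> P'" "disjnt P P'"
        using T'.Hausdorff_T ne \<pi>g T'.topspace_T H.one_closed unfolding Hausdorff_space_def by metis
      then have gP: "\<pi> g \<notin> P" by (auto simp: disjnt_iff)
      obtain V where V: "openin T' V" "\<one> \<in> V" "\<forall>x\<in>V. \<forall>y\<in>V. x \<otimes> inv y \<in> P"
        using T'.div_nhd_one[OF P(1,2)] by blast
      then have Vn: "V \<in> nhds'" by (simp add: nhds'_def)
      obtain N where N: "open N" "mat 1 \<in> N" "N \<inter> GF = pre V" using pre_nhd[OF Vn] by blast
      have dg: "det g = 1" using g by (simp add: SL_carrier_iff)
      have "open ((\<lambda>h. adjugate g ** h) -` N)"
        by (intro open_vimage N continuous_on_matrix_mult continuous_on_const continuous_on_id)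
      moreover have "g \<in> (\<lambda>h. adjugate g ** h) -` N" using N dg by (simp add: adjugate_left)
      moreover have "closure (pre V) \<in> \<U>" using Vn by (simp add: \<U>_def)
      then have "g \<in> closure (pre V)" using B.M_subset g(2) by blast
      ultimately have "(\<lambda>h. adjugate g ** h) -` N \<inter> pre V \<noteq> {}"
        using open_Int_closure_eq_empty by blast
      then obtain w where w: "w \<in> pre V" "adjugate g ** w \<in> N" by blast
      then have wF: "w \<in> GF" by (simp add: pre_def)
      have u: "adjugate g ** w \<in> pre V" using w N wF g by (auto intro: F.mult_SL F.adjugate_SL)
      have "\<pi> (adjugate g ** w) = inv (\<pi> g) \<otimes> \<pi> w"
        using wF g by (simp add: \<pi>_mult \<pi>_adjugate F.adjugate_SL)
      then have "\<pi> w \<otimes> inv (\<pi> (adjugate g ** w)) = \<pi> g"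
        using wF g \<pi>.hom_closed by (simp add: H.inv_mult_group H.m_assoc[symmetric])
      moreover have "\<pi> w \<otimes> inv (\<pi> (adjugate g ** w)) \<in> P"
        using V(3) w(1) u by (simp add: pre_def)
      ultimately show False using gP by simp
    qed
    fix Y assume Y: "openin T Y" "\<one> \<in> Y"
    show "\<exists>P. openin T' P \<and> \<one> \<in> P \<and> P \<subseteq> Y"
    proof (cases "B.M = GK")
      case True
      have "\<pi> g = \<one>" if "g \<in> GF" for g using kernel[OF that] GF_GK that True by blast
      then have "carrier H \<subseteq> {\<one>}" using \<pi>_surj by (metis image_subsetI singletonI)
      then show ?thesis using Y T'.topspace_T openin_topspace[of T'] by (metis H.one_closed insert_subset subset_iff singletonD)
    next
      case False
      obtain N where N: "open N" "{g \<in> GF. \<pi> g \<in> Y} = GF \<inter> N" using Y(1) by (auto simp: openin_T)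
      have "mat 1 \<in> {g \<in> GF. \<pi> g \<in> Y}" using Y F.one_SL by (simp add: \<pi>_one)
      then have "mat 1 \<in> N" using N by blast
      then obtain P where P: "P \<in> nhds'" "\<forall>u\<in>closure (pre P). \<exists>m\<in>B.M. adjugate m ** u \<in> N"
        using B.base_dichotomy(2)[OF False N(1)] by (auto simp: \<U>_def)
      \<comment> \<open>The condition on roots of unity enters here: \<open>M\<close> is a group of
        scalar matrices over \<open>K\<close>, all of which are then defined over \<open>F\<close>,
        where \<open>kernel\<close> applies.\<close>
      have MF: "B.M \<subseteq> GF"
      proof -
        have "B.M \<subseteq> center (SL F)"
          using B.base_dichotomy(1)[OF False] by (simp add: K.center_SL F.center_SL roots)
        then show ?thesis by (auto simp: center_def)
      qed
      have "P \<subseteq> Y"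
      proof
        fix y assume y: "y \<in> P"
        then have "y \<in> \<pi> ` GF" using P(1) \<pi>_surj T'.open_subset by (auto simp: nhds'_def)
        then obtain u where u: "u \<in> GF" "y = \<pi> u" by blast
        then have "u \<in> closure (pre P)" using y closure_subset[of "pre P"] by (auto simp: pre_def)
        then obtain m where m: "m \<in> B.M" "adjugate m ** u \<in> N" using P(2) by blast
        have m': "adjugate m \<in> GF" "adjugate m \<in> B.M" using m MF B.M_adjugate by blast+
        have "adjugate m ** u \<in> {g \<in> GF. \<pi> g \<in> Y}" unfolding N(2) using m m' u by (auto intro: F.mult_SL)
        then have "\<pi> (adjugate m) \<otimes> \<pi> u \<in> Y" using m' u by (simp add: \<pi>_mult)
        then show "y \<in> Y" using kernel[OF m'] u \<pi>.hom_closed[OF u(1)] by simp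
      qed
      then show ?thesis using P by (auto simp: nhds'_def)
    qed
  qed
  then show ?thesis using H.hgt unfolding minimal_group_def by blast
qed

text \<open>Here \<open>H\<close> is algebraically PSL(n, F), and it embeds into PSL(n, K).
  Minimality forces \<open>T\<close> to be the topology induced by this embedding, which a root of
  unity \<open>l\<close> missing from \<open>F\<close> contradicts.\<close>

lemma roots_of_unity_eq:
  assumes minimal: "minimal_group H T"
    and ker: "\<And>g. g \<in> GF \<Longrightarrow> \<pi> g = \<one> \<longleftrightarrow> g \<in> center (SL F)"
  shows "roots_of_unity_in CARD('n) F = roots_of_unity_in CARD('n) K"
proof (rule ccontr)
  assume ne: "\<not> ?thesis"
  have "roots_of_unity_in CARD('n) F \<subseteq> roots_of_unity_in CARD('n) K"
    using closure_subset by (auto simp: roots_of_unity_in_def)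
  then obtain l where l: "l \<in> roots_of_unity_in CARD('n) K" "l \<notin> roots_of_unity_in CARD('n) F"
    using ne by blast
  let ?Z = "center (SL K :: ('a^'n^'n) monoid)"
  let ?p = "\<lambda>x. ?Z #>\<^bsub>SL K\<^esub> x"
  let ?Q = "quotient_group_topology (SL K) ?Z (SL_topology K)"
  interpret GK: hausdorff_group "SL K :: ('a^'n^'n) monoid" "SL_topology K"
    by (rule hausdorff_groupI[OF hausdorff_group_topology_SL[OF K.subfield_set_axioms refl]])
  interpret Z: normal ?Z "SL K" by (rule GK.center_normal)
  interpret Q: hausdorff_group "SL K Mod ?Z" ?Q
    by (rule hausdorff_groupI[OF GK.hausdorff_group_topology_quotient[OF GK.center_normal
          closedin_center_SL[OF K.subfield_set_axioms]]])
  have Z_F: "g \<in> center (SL F) \<longleftrightarrow> g \<in> ?Z" if g: "g \<in> GF" for g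
  proof
    show "g \<in> center (SL F)" if "g \<in> ?Z" using that g GF_GK unfolding center_def SL_simps by blast
    show "g \<in> ?Z" if "g \<in> center (SL F)"
      using that subsetD[OF closure_subset[of F]] unfolding F.center_SL K.center_SL roots_of_unity_in_def by blast
  qed
  have \<pi>_eq: "\<pi> g = \<pi> h \<longleftrightarrow> ?p g = ?p h" if g: "g \<in> GF" and h: "h \<in> GF" for g h
  proof -
    have gh: "g \<in> GK" "h \<in> GK" using g h GF_GK by auto
    have m: "g ** adjugate h \<in> GF" "g ** adjugate h \<in> GK"
      using g h gh by (auto intro: F.mult_SL F.adjugate_SL K.mult_SL K.adjugate_SL)
    have "\<pi> g = \<pi> h \<longleftrightarrow> \<pi> g \<otimes> inv (\<pi> h) = \<one>"
      using \<pi>.hom_closed[OF g] \<pi>.hom_closed[OF h] by (metis H.inv_equality H.inv_inv H.r_inv H.inv_closed)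
    also have "\<pi> g \<otimes> inv (\<pi> h) = \<pi> (g ** adjugate h)"
      using g h by (simp add: \<pi>_mult \<pi>_adjugate F.adjugate_SL)
    also have "\<dots> = \<one> \<longleftrightarrow> g ** adjugate h \<in> ?Z" by (simp add: ker Z_F m)
    also have "g ** adjugate h = g \<otimes>\<^bsub>SL K\<^esub> inv\<^bsub>SL K\<^esub> h" using gh by (simp add: K.inv_SL)
    also have "\<dots> \<in> ?Z \<longleftrightarrow> ?p g = ?p h"
    proof
      assume a: "g \<otimes>\<^bsub>SL K\<^esub> inv\<^bsub>SL K\<^esub> h \<in> ?Z"
      have "?p (g \<otimes>\<^bsub>SL K\<^esub> inv\<^bsub>SL K\<^esub> h) = ?Z"
        by (rule GK.coset_join2[OF _ Z.is_subgroup a]) (rule GK.m_closed[OF gh(1) GK.inv_closed[OF gh(2)]])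
      then show "?p g = ?p h" by (rule GK.coset_mult_inv1[OF _ gh Z.subset])
    next
      assume "?p g = ?p h"
      then have "?p (g \<otimes>\<^bsub>SL K\<^esub> inv\<^bsub>SL K\<^esub> h) = ?Z" by (rule GK.coset_mult_inv2[OF _ gh Z.subset])
      then show "g \<otimes>\<^bsub>SL K\<^esub> inv\<^bsub>SL K\<^esub> h \<in> ?Z"
        by (rule GK.coset_join1[OF _ GK.m_closed[OF gh(1) GK.inv_closed[OF gh(2)]] Z.is_subgroup])
    qed
    finally show ?thesis .
  qed
  \<comment> \<open>The map induced on \<open>H\<close> by the coset projection of SL(n, K); the
    choice of a preimage is harmless by \<open>\<pi>_eq\<close>.\<close>
  define \<phi> where "\<phi> x = ?p (SOME g. g \<in> GF \<and> \<pi> g = x)" for x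
  have \<phi>\<pi>: "\<phi> (\<pi> g) = ?p g" if g: "g \<in> GF" for g
  proof -
    have "(SOME h. h \<in> GF \<and> \<pi> h = \<pi> g) \<in> GF \<and> \<pi> (SOME h. h \<in> GF \<and> \<pi> h = \<pi> g) = \<pi> g"
      by (rule someI[of _ g]) (simp add: g)
    then show ?thesis unfolding \<phi>_def using \<pi>_eq g by blast
  qed
  have car: "?p g \<in> carrier (SL K Mod ?Z)" if "g \<in> GK" for g
    using that by (auto simp: FactGroup_def RCOSETS_def)
  have hom: "\<phi> \<in> hom H (SL K Mod ?Z)"
  proof (rule homI)
    fix x y assume x: "x \<in> carrier H" and y: "y \<in> carrier H"
    obtain g where g: "g \<in> GF" "x = \<pi> g" using preimage[OF x] by blast
    obtain h where h: "h \<in> GF" "y = \<pi> h" using preimage[OF y] by blast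
    have gh: "g \<in> GK" "h \<in> GK" using g h GF_GK by auto
    show "\<phi> x \<in> carrier (SL K Mod ?Z)" using g gh car by (simp add: \<phi>\<pi>)
    have "\<phi> (x \<otimes> y) = ?p (g ** h)"
      using g h F.mult_SL[OF g(1) h(1)] by (simp add: \<phi>\<pi> \<pi>_mult[symmetric])
    also have "\<dots> = \<phi> x \<otimes>\<^bsub>SL K Mod ?Z\<^esub> \<phi> y"
      using Z.rcos_sum[OF gh] g h by (simp add: \<phi>\<pi> FactGroup_def)
    finally show "\<phi> (x \<otimes> y) = \<phi> x \<otimes>\<^bsub>SL K Mod ?Z\<^esub> \<phi> y" .
  qed
  have inj: "inj_on \<phi> (carrier H)"
  proof (rule inj_onI)
    fix x y assume x: "x \<in> carrier H" and y: "y \<in> carrier H" and e: "\<phi> x = \<phi> y"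
    obtain g where g: "g \<in> GF" "x = \<pi> g" using preimage[OF x] by blast
    obtain h where h: "h \<in> GF" "y = \<pi> h" using preimage[OF y] by blast
    show "x = y" using e g h \<pi>_eq[OF g(1) h(1)] by (simp add: \<phi>\<pi>)
  qed
  let ?T' = "pullback_topology (carrier H) \<phi> ?Q"
  have "hausdorff_group_topology H ?T'"
    by (rule Q.hausdorff_group_topology_pullback[OF H.group_axioms hom inj])
  moreover have "openin T U" if U: "openin ?T' U" for U
  proof -
    obtain V where V: "openin ?Q V" "U = \<phi> -` V \<inter> carrier H"
      using U by (auto simp: openin_pullback_topology)
    then have "openin (SL_topology K) {x \<in> GK. ?p x \<in> V}" by (simp add: openin_quotient_group_topology)
    then obtain N where N: "open N" "{x \<in> GK. ?p x \<in> V} = GK \<inter> N" by (auto simp: openin_SL_topology)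
    have "{g \<in> GF. \<pi> g \<in> U} = GF \<inter> {x \<in> GK. ?p x \<in> V}"
      using GF_GK by (auto simp: V(2) \<phi>\<pi>)
    also have "\<dots> = GF \<inter> N" unfolding N(2) using GF_GK by blast
    finally show ?thesis using N(1) V(2) by (auto simp: openin_T)
  qed
  ultimately have T': "?T' = T" using minimal unfolding minimal_group_def by blast
  text \<open>Elements of \<open>SL F\<close> near the new central element \<open>mat l\<close> are near the identity for the
    pulled back topology, but not for \<open>T\<close>.\<close>
  let ?R = "roots_of_unity_in CARD('n) F"
  have Rfin: "finite ?R" by (rule finite_roots_of_unity_in) simp
  have "\<exists>A B :: ('a^'n^'n) set. open A \<and> open B \<and> mat c \<in> A \<and> mat l \<in> B \<and> A \<inter> B = {}" if c: "c \<in> ?R" for c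
  proof -
    have "(mat c :: 'a^'n^'n) $ undefined $ undefined \<noteq> (mat l :: 'a^'n^'n) $ undefined $ undefined"
      using c l by (auto simp: mat_def)
    then have "(mat c :: 'a^'n^'n) \<noteq> mat l" by metis
    then show ?thesis
      using Hausdorff_space_matrix[where 'a = 'a and 'n = 'n and 'm = 'n]
      unfolding Hausdorff_space_def disjnt_def by simp
  qed
  then obtain A B :: "'a \<Rightarrow> ('a^'n^'n) set" where AB: "\<And>c. c \<in> ?R \<Longrightarrow>
      open (A c) \<and> open (B c) \<and> mat c \<in> A c \<and> mat l \<in> B c \<and> A c \<inter> B c = {}" by metis
  \<comment> \<open>\<open>E0\<close> is shrunk so that its translate by each root \<open>c\<close>
    stays in \<open>A c\<close>. The union \<open>E\<close> of its translates is then an open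
    neighbourhood of 1, invariant under the centre of SL(n, F) and disjoint from the neighbourhood
    \<open>E1\<close> of \<open>mat l\<close>.\<close>
  define E0 where "E0 = (\<Inter>c\<in>?R. (\<lambda>g. mat c ** g) -` A c)"
  define E where "E = (\<Union>c\<in>?R. (\<lambda>g. mat c ** g) -` E0)"
  define E1 where "E1 = (\<Inter>c\<in>?R. B c)"
  have R1: "1 \<in> ?R" by (simp add: roots_of_unity_in_def)
  have oE0: "open E0" unfolding E0_def
    by (intro open_INT Rfin ballI open_vimage continuous_on_matrix_mult continuous_on_const continuous_on_id)
      (use AB in blast)
  have oE: "open E" unfolding E_def
    by (intro open_UN ballI open_vimage oE0 continuous_on_matrix_mult continuous_on_const continuous_on_id)
  have oE1: "open E1" unfolding E1_def by (intro open_INT Rfin ballI) (use AB in blast)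
  have lE1: "mat l \<in> E1" unfolding E1_def using AB by blast
  have one_E: "mat 1 \<in> E"
    unfolding E_def using AB R1 by (intro UN_I[of 1]) (auto simp: E0_def)
  have mat_mat: "mat c ** (mat d ** g) = mat (c * d) ** g" for c d and g :: "'a^'n^'n"
    by (simp add: vec_eq_iff mat_mult_nth mult.assoc)
  have disj: "g \<notin> E1" if g: "g \<in> E" for g
  proof -
    obtain c where c: "c \<in> ?R" "mat c ** g \<in> E0" using g by (auto simp: E_def)
    have c0: "c \<noteq> 0" using c(1) by (auto simp: roots_of_unity_in_def power_0_left)
    then have ic: "inverse c \<in> ?R" using c(1) by (auto simp: roots_of_unity_in_def power_inverse)
    then have "mat (inverse c) ** (mat c ** g) \<in> A (inverse c)" using c(2) by (auto simp: E0_def)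
    then have "g \<in> A (inverse c)" using c0 by (simp add: mat_mat)
    then show ?thesis using AB[OF ic] ic by (auto simp: E1_def)
  qed
  let ?Y = "\<pi> ` (GF \<inter> E)"
  \<comment> \<open>\<open>E\<close> meets SL(n, F) in a saturated set: fibres of
    \<open>\<pi>\<close> are cosets of the centre, and multiplying by a root of unity only permutes
    the translates forming \<open>E\<close>.\<close>
  have pre: "{g \<in> GF. \<pi> g \<in> ?Y} = GF \<inter> E"
  proof (intro equalityI subsetI)
    fix g assume "g \<in> {g \<in> GF. \<pi> g \<in> ?Y}"
    then obtain h where g: "g \<in> GF" and h: "h \<in> GF" "h \<in> E" "\<pi> g = \<pi> h" by auto
    have "\<pi> (h ** adjugate g) = \<pi> h \<otimes> inv (\<pi> g)"
      using g h by (simp add: \<pi>_mult \<pi>_adjugate F.adjugate_SL)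
    then have "h ** adjugate g \<in> center (SL F)"
      using h(3) \<pi>.hom_closed[OF h(1)] ker[of "h ** adjugate g"] F.mult_SL[OF h(1) F.adjugate_SL[OF g]] by simp
    then obtain d where d: "d \<in> ?R" "h ** adjugate g = mat d" by (auto simp: F.center_SL)
    have "h = h ** (adjugate g ** g)" using g by (simp add: adjugate_left SL_carrier_iff)
    also have "\<dots> = mat d ** g" by (simp add: d(2)[symmetric] matrix_mul_assoc)
    finally have hd: "h = mat d ** g" .
    obtain c where c: "c \<in> ?R" "mat c ** h \<in> E0" using h(2) by (auto simp: E_def)
    then have "mat (c * d) ** g \<in> E0" by (simp add: hd mat_mat)
    moreover have "c * d \<in> ?R" using c(1) d(1) by (auto simp: roots_of_unity_in_def power_mult_distrib)
    ultimately show "g \<in> GF \<inter> E" using g by (auto simp: E_def)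
  qed auto
  have "?Y \<subseteq> carrier H" using \<pi>_surj by blast
  then have "openin T ?Y" using pre oE by (auto simp: openin_T)
  then have "openin ?T' ?Y" by (simp add: T')
  then obtain U where U: "openin ?Q U" "?Y = \<phi> -` U \<inter> carrier H"
    unfolding openin_pullback_topology by blast
  have "openin (SL_topology K) {x \<in> GK. ?p x \<in> U}" using U(1) by (simp add: openin_quotient_group_topology)
  then obtain N where N: "open N" "{x \<in> GK. ?p x \<in> U} = GK \<inter> N" by (auto simp: openin_SL_topology)
  have lZ: "mat l \<in> ?Z" using l by (auto simp: K.center_SL)
  have lG: "mat l \<in> GK" using l by (simp add: K.mat_SL_iff)
  \<comment> \<open>Over \<open>K\<close> the scalar \<open>l\<close> is central, so every
    neighbourhood of the trivial coset has a preimage containing \<open>mat l\<close>, and by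
    density elements of SL(n, F) near it.\<close>
  have "?p (mat l) = ?p (mat 1)"
    using GK.coset_join2[OF lG Z.is_subgroup lZ] GK.coset_join2[OF K.one_SL Z.is_subgroup] Z.one_closed by simp
  moreover have "?p (mat 1) \<in> U"
  proof -
    have "\<pi> (mat 1) \<in> ?Y" using one_E F.one_SL by blast
    then have "\<phi> (\<pi> (mat 1)) \<in> U" using U(2) by blast
    then show ?thesis by (simp add: \<phi>\<pi> F.one_SL)
  qed
  ultimately have "mat l \<in> N \<inter> E1" using lE1 lG N(2) by auto
  moreover have "mat l \<in> closure GF" using lG SL_dense[OF F.subfield_set_axioms] by blast
  ultimately have "(N \<inter> E1) \<inter> GF \<noteq> {}"
    using open_Int_closure_eq_empty[OF open_Int[OF N(1) oE1], of GF] by blast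
  then obtain g where g: "g \<in> GF" "g \<in> N" "g \<in> E1" by blast
  then have "?p g \<in> U" using N(2) GF_GK by blast
  then have "\<pi> g \<in> ?Y" using U(2) g(1) \<phi>\<pi> \<pi>.hom_closed by auto
  then have "g \<in> E" using pre g(1) by blast
  then show False using disj g(3) by blast
qed

end

section \<open>Total minimality of SL and PSL\<close>

lemma (in hausdorff_group) rcoset_quotient:
  assumes "N \<lhd> G"
  shows "(\<lambda>x. N #> x) \<in> hom G (G Mod N)"
    and "quotient_map T (quotient_group_topology G N T) (\<lambda>x. N #> x)"
  using normal.r_coset_hom_Mod[OF assms] quotient_map_quotient_group_topology[OF topspace_T] by auto

lemma (in subfield_set) center_SL_eq_iff:
  assumes "subfield_set L"
  shows "center (SL K :: ('a^'n^'n) monoid) = center (SL L) \<longleftrightarrow>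
     roots_of_unity_in CARD('n) K = roots_of_unity_in CARD('n) L"
proof -
  interpret L: subfield_set L by fact
  have "inj (mat :: 'a \<Rightarrow> 'a^'n^'n)"
  proof (rule injI)
    fix x y :: 'a assume "(mat x :: 'a^'n^'n) = mat y"
    then have "(mat x :: 'a^'n^'n) $ undefined $ undefined = (mat y :: 'a^'n^'n) $ undefined $ undefined" by simp
    then show "x = y" by (simp add: mat_def)
  qed
  then show ?thesis by (simp add: center_SL L.center_SL inj_image_eq_iff)
qed

text \<open>Every quotient by a closed normal subgroup is an instance of \<open>SL_quotient\<close>,
  which gives sufficiency. Necessity is tested on the quotient by the centre alone.\<close>

lemma SL_totally_minimal_iff:
  fixes F :: "'a::local_field set"
  assumes "subfield_set F"
  shows "totally_minimal_group (SL F :: ('a^'n^'n) monoid) (SL_topology F) \<longleftrightarrow>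
    roots_of_unity_in CARD('n) F = roots_of_unity_in CARD('n) (closure F)" (is "?tm \<longleftrightarrow> ?roots")
proof -
  interpret F: subfield_set F by fact
  let ?G = "SL F :: ('a^'n^'n) monoid"
  interpret G: hausdorff_group ?G "SL_topology F"
    by (rule hausdorff_groupI[OF hausdorff_group_topology_SL[OF assms refl]])
  have quo: "SL_quotient F (?G Mod N) (quotient_group_topology ?G N (SL_topology F)) (\<lambda>x. N #>\<^bsub>?G\<^esub> x)"
    if N: "N \<lhd> ?G" "closedin (SL_topology F) N" for N
    using assms hausdorff_groupI[OF G.hausdorff_group_topology_quotient[OF N]] G.rcoset_quotient[OF N(1)]
    by (simp add: SL_quotient_def SL_quotient_axioms_def)
  show ?thesis
  proof
    assume ?roots
    then show ?tm
      unfolding totally_minimal_group_def using G.hgt SL_quotient.minimal[OF quo] by blast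
  next
    assume tm: ?tm
    let ?Z = "center ?G"
    have Z: "?Z \<lhd> ?G" "closedin (SL_topology F) ?Z"
      by (rule G.center_normal, rule closedin_center_SL[OF assms])
    have "minimal_group (?G Mod ?Z) (quotient_group_topology ?G ?Z (SL_topology F))"
      using tm Z unfolding totally_minimal_group_def by blast
    moreover have "?Z #>\<^bsub>?G\<^esub> g = \<one>\<^bsub>?G Mod ?Z\<^esub> \<longleftrightarrow> g \<in> ?Z" if "g \<in> carrier ?G" for g
      using that G.coset_join1[of ?Z g] G.coset_join2[of g ?Z] normal_imp_subgroup[OF Z(1)]
      by (auto simp: FactGroup_def)
    ultimately show ?roots by (rule SL_quotient.roots_of_unity_eq[OF quo[OF Z]])
  qed
qed

text \<open>Composing two projections makes each quotient of PSL a quotient of SL, so the same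
  criterion applies. Necessity is tested on the trivial subgroup.\<close>

lemma PSL_totally_minimal_iff:
  fixes F :: "'a::local_field set"
  assumes "subfield_set F"
  shows "totally_minimal_group (PSL F :: ('a^'n^'n) set monoid) (PSL_topology F) \<longleftrightarrow>
    roots_of_unity_in CARD('n) F = roots_of_unity_in CARD('n) (closure F)" (is "?tm \<longleftrightarrow> ?roots")
proof -
  interpret F: subfield_set F by fact
  let ?G = "SL F :: ('a^'n^'n) monoid" and ?P = "PSL F :: ('a^'n^'n) set monoid"
  let ?Z = "center ?G" and ?TP = "PSL_topology F :: ('a^'n^'n) set topology"
  interpret G: hausdorff_group ?G "SL_topology F"
    by (rule hausdorff_groupI[OF hausdorff_group_topology_SL[OF assms refl]])
  have Z: "?Z \<lhd> ?G" "closedin (SL_topology F) ?Z"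
    by (rule G.center_normal, rule closedin_center_SL[OF assms])
  interpret P: hausdorff_group ?P ?TP
    unfolding PSL_def PSL_topology_def
    by (rule hausdorff_groupI[OF G.hausdorff_group_topology_quotient[OF Z]])
  let ?q = "\<lambda>x. ?Z #>\<^bsub>?G\<^esub> x"
  have q: "?q \<in> hom ?G ?P" "quotient_map (SL_topology F) ?TP ?q"
    using G.rcoset_quotient[OF Z(1)] by (simp_all add: PSL_def PSL_topology_def)
  have quo: "SL_quotient F (?P Mod N) (quotient_group_topology ?P N ?TP) ((\<lambda>y. N #>\<^bsub>?P\<^esub> y) \<circ> ?q)"
    if N: "N \<lhd> ?P" "closedin ?TP N" for N
    using assms hausdorff_groupI[OF P.hausdorff_group_topology_quotient[OF N]]
      Group.hom_compose[OF q(1) P.rcoset_quotient(1)[OF N(1)]]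
      quotient_map_compose[OF q(2) P.rcoset_quotient(2)[OF N(1)]]
    by (simp add: SL_quotient_def SL_quotient_axioms_def)
  show ?thesis
  proof
    assume ?roots
    then show ?tm
      unfolding totally_minimal_group_def using P.hgt SL_quotient.minimal[OF quo] by blast
  next
    assume tm: ?tm
    \<comment> \<open>The quotient by the trivial subgroup is a copy of PSL consisting of
      singletons; the kernel of the composite map is the centre of SL, as
      \<open>roots_of_unity_eq\<close> demands.\<close>
    let ?N = "{\<one>\<^bsub>?P\<^esub>}"
    have N: "?N \<lhd> ?P" "closedin ?TP ?N"
      using P.one_is_normal P.Hausdorff_T P.topspace_T
      by (auto intro!: compactin_imp_closedin finite_imp_compactin)
    have "minimal_group (?P Mod ?N) (quotient_group_topology ?P ?N ?TP)"
      using tm N unfolding totally_minimal_group_def by blast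
    moreover have "((\<lambda>y. ?N #>\<^bsub>?P\<^esub> y) \<circ> ?q) g = \<one>\<^bsub>?P Mod ?N\<^esub> \<longleftrightarrow> g \<in> ?Z"
      if g: "g \<in> carrier ?G" for g
    proof -
      have "?q g \<in> carrier ?P" using q(1) g by (auto simp: hom_def)
      then have "?N #>\<^bsub>?P\<^esub> ?q g = {?q g}" by (auto simp: r_coset_def)
      moreover have "\<one>\<^bsub>?P\<^esub> = ?Z" "\<one>\<^bsub>?P Mod ?N\<^esub> = ?N" by (simp_all add: PSL_def FactGroup_def)
      moreover have "?q g = ?Z \<longleftrightarrow> g \<in> ?Z"
        using g G.coset_join1[of ?Z g] G.coset_join2[of g ?Z] normal_imp_subgroup[OF Z(1)] by auto
      ultimately show ?thesis by simp
    qed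
    ultimately show ?roots by (rule SL_quotient.roots_of_unity_eq[OF quo[OF N]])
  qed
qed

theorem theorem4p7:
  fixes F :: "'a::local_field set"
  assumes "subfield F (ring_of_type_algebra :: 'a ring)"
  shows "(totally_minimal_group (PSL F :: ('a^'n^'n) set monoid) (PSL_topology F) \<longleftrightarrow>
            totally_minimal_group (SL F :: ('a^'n^'n) monoid) (SL_topology F)) \<and>
         (totally_minimal_group (SL F :: ('a^'n^'n) monoid) (SL_topology F) \<longleftrightarrow>
            center (SL F :: ('a^'n^'n) monoid) = center (SL (closure F))) \<and>
         (center (SL F :: ('a^'n^'n) monoid) = center (SL (closure F)) \<longleftrightarrow>
            roots_of_unity_in CARD('n) F = roots_of_unity_in CARD('n) (closure F))"
proof -
  have F: "subfield_set F" using assms by (rule subfield_set_if_subfield)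
  show ?thesis
    unfolding PSL_totally_minimal_iff[OF F] SL_totally_minimal_iff[OF F]
      subfield_set.center_SL_eq_iff[OF F subfield_set_closure[OF F]]
    by blast
qed

end
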